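(* Let $\mathcal T$ be a simplicial mesh of $\Omega\subset\mathbb R^d$, let $k\ge1$, and let $u_h$ be any $P_k$ Lagrange finite element function on $\mathcal T$. Put $\eta_\ell=\#\mathcal X_k^\ell(\mathcal T)$ and $\tau_\ell=\max_{\bm p\in\mathcal X_k^\ell(\mathcal T)}\tau(\bm p)$ for $\ell=0,1,\dots,d$. Then there are a depth $L$, widths $n_1,\dots,n_L$ and a network $\widetilde u_h\in\Sigma^{1,2}_{n_{1:L}}$ such that $\widetilde u_h(\bm x)=u_h(\bm x)$ for every $\bm x\in\Omega$, with the following bounds. (i) If $\mathcal T$ is vertex-convex, one may take $$L\le\sum_{\ell=0}^d\eta_\ell\Big(\lceil\log_2(\tau_\ell)\rceil+\max\{\lceil\log_2(\ell+1)\rceil,\lceil\log_2(k-\ell-1)\rceil\}+3\Big)$$ and $$\max_j n_j\le 4\max_\ell\big\{\max\{\ell+1,k-\ell-1\}\,\tau_\ell\big\}+2d+1.$$ (ii) If $\mathcal T$ is arbitrary, one may take $$L\le\Big(\lceil\log_2(\tau_0)\rceil+\lceil\log_2(d+1)\rceil+\lceil\log_2(k)\rceil+7\Big)\sum_{\ell=0}^d\eta_\ell$$ and $$\max_j n_j\le 4(d+1)\min\{d,k+1\}\,\tau_0+2d+1.$$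
   Context: $\Omega\subset\mathbb R^d$ is a bounded polytope domain. A simplicial mesh $\mathcal T=\{T_1,\dots,T_N\}$ of $\Omega$ is a finite set of (closed, nondegenerate) $d$-dimensional simplices with $\Omega=\bigcup_{T\in\mathcal T}T$ such that any two of them intersect in the empty set or in a common sub-simplex (face). $\Delta_\ell(\mathcal T)$ is the set of all $\ell$-dimensional sub-simplices (convex hulls of $\ell+1$ vertices) of simplices of $\mathcal T$. The mesh is vertex-convex if for every vertex $\bm v\in\Delta_0(\mathcal T)$ the patch $P_{\bm v}=\bigcup_{\bm v\in T\in\mathcal T}T$ is convex. For $T=\mathrm{Conv}(\bm v_0,\dots,\bm v_d)$, $\mathcal X_k(T)=\{\frac1k\sum_{i=0}^d\alpha_i\bm v_i:\bm\alpha\in\mathbb N^{d+1},\ \sum_i\alpha_i=k\}$ (with $0\in\mathbb N$) and $\mathcal X_k(\mathcal T)=\bigcup_T\mathcal X_k(T)$. $\mathcal X_k^\ell(\mathcal T)$ is the set of points of $\mathcal X_k(\mathcal T)$ lying in the relative interior of some $f\in\Delta_\ell(\mathcal T)$ (the relative interior of a vertex is the vertex itself). $\tau(\bm p)$ is the number of simplices of $\mathcal T$ containing $\bm p$. A $P_k$ Lagrange finite element function on $\mathcal T$ is a continuous function on $\Omega$ whose restriction to each $T\in\mathcal T$ is a polynomial of degree at most $k$. Conventions: $\log_2 0=-\infty$ (so it does not contribute to a maximum), and indices $\ell$ with $\mathcal X_k^\ell(\mathcal T)=\emptyset$ (i.e. $\eta_\ell=0$) are omitted from the sums and maxima; for the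 remaining $\ell$ one has $k\ge\ell+1$. Networks: $\mathrm{ReLU}(t)=\max\{0,t\}$, $\mathrm{ReLU}^2(t)=(\mathrm{ReLU}(t))^2$. $\Sigma^{1,2}_{n_{1:L}}$ is the set of functions $u:\mathbb R^d\to\mathbb R$ of the form $u^0(\bm x)=\bm x$, $[u^j(\bm x)]_i=\sigma_i^j([W^ju^{j-1}(\bm x)+b^j]_i)$ for $i=1,\dots,n_j$, $j=1,\dots,L$, $u(\bm x)=W^{L+1}u^L(\bm x)+b^{L+1}$, with arbitrary real matrices $W^j$ and vectors $b^j$ of compatible sizes (so $u^j(\bm x)\in\mathbb R^{n_j}$, and the output is scalar) and activations $\sigma_i^j(t)=a_i^j\,\mathrm{ReLU}(t)+c_i^j\,\mathrm{ReLU}^2(t)$ with arbitrary $a_i^j,c_i^j\in\mathbb R$. *)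

theory Defs
  imports "HOL-Analysis.Analysis"
begin

text \<open>
  The space R^d is \<^typ>\<open>real^'d\<close>, with d = \<^term>\<open>CARD('d)\<close>.  A polytope domain need not be
  convex.  As the closed simplices of a mesh cover it exactly, it is taken here to be a closed
  set: the closure of its interior, where the interior is the nonempty connected open set that is
  called a domain.  Boundedness is implied, as every \<^const>\<open>polytope\<close> is compact.
\<close>

definition polytope_domain :: "(real^'d) set \<Rightarrow> bool" where
  "polytope_domain \<Omega> \<longleftrightarrow>
     interior \<Omega> \<noteq> {} \<and> connected (interior \<Omega>) \<and> \<Omega> = closure (interior \<Omega>) \<and>
     (\<exists>P. finite P \<and> (\<forall>Q\<in>P. polytope Q) \<and> \<Omega> = \<Union>P)"

text \<open>
  \<^const>\<open>triangulation\<close> states that there are finitely many simplices, any two of which meet in a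
  common face; the empty set counts as a face.
\<close>

definition simplicial_mesh :: "(real^'d) set set \<Rightarrow> (real^'d) set \<Rightarrow> bool" where
  "simplicial_mesh \<T> \<Omega> \<longleftrightarrow>
     triangulation \<T> \<and> (\<forall>T\<in>\<T>. int CARD('d) simplex T) \<and> \<Union>\<T> = \<Omega>"

definition vertices :: "(real^'d) set \<Rightarrow> (real^'d) set" where
  "vertices T = {v. v extreme_point_of T}"

definition subsimplices :: "nat \<Rightarrow> (real^'d) set set \<Rightarrow> (real^'d) set set" where
  "subsimplices l \<T> = {convex hull C | C T. T \<in> \<T> \<and> C \<subseteq> vertices T \<and> card C = l + 1}"

definition patch :: "(real^'d) set set \<Rightarrow> real^'d \<Rightarrow> (real^'d) set" where
  "patch \<T> v = \<Union>{T \<in> \<T>. v \<in> T}"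

definition vertex_convex :: "(real^'d) set set \<Rightarrow> bool" where
  "vertex_convex \<T> \<longleftrightarrow> (\<forall>v. {v} \<in> subsimplices 0 \<T> \<longrightarrow> convex (patch \<T> v))"

definition lattice_simplex :: "nat \<Rightarrow> (real^'d) set \<Rightarrow> (real^'d) set" where
  "lattice_simplex k T =
     {(1 / real k) *\<^sub>R (\<Sum>v\<in>vertices T. real (\<alpha> v) *\<^sub>R v) | \<alpha> :: real^'d \<Rightarrow> nat.
        (\<Sum>v\<in>vertices T. \<alpha> v) = k}"

definition lattice :: "nat \<Rightarrow> (real^'d) set set \<Rightarrow> (real^'d) set" where
  "lattice k \<T> = (\<Union>T\<in>\<T>. lattice_simplex k T)"

definition lattice_on :: "nat \<Rightarrow> nat \<Rightarrow> (real^'d) set set \<Rightarrow> (real^'d) set" where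
  "lattice_on k l \<T> = {p \<in> lattice k \<T>. \<exists>f\<in>subsimplices l \<T>. p \<in> rel_interior f}"

definition tau_point :: "(real^'d) set set \<Rightarrow> real^'d \<Rightarrow> nat" where
  "tau_point \<T> p = card {T \<in> \<T>. p \<in> T}"

definition eta :: "nat \<Rightarrow> (real^'d) set set \<Rightarrow> nat \<Rightarrow> nat" where
  "eta k \<T> l = card (lattice_on k l \<T>)"

text \<open>
  Only meaningful if \<^prop>\<open>eta k \<T> l \<noteq> 0\<close>; all other indices are to be left out of sums and
  maxima.  For the remaining ones l + 1 <= k, so that k - l - 1 is not truncated.
\<close>

definition tau :: "nat \<Rightarrow> (real^'d) set set \<Rightarrow> nat \<Rightarrow> nat" where
  "tau k \<T> l = (MAX p\<in>lattice_on k l \<T>. tau_point \<T> p)"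

definition multi_indices :: "nat \<Rightarrow> ('d::finite \<Rightarrow> nat) set" where
  "multi_indices k = {\<alpha>. (\<Sum>i\<in>UNIV. \<alpha> i) \<le> k}"

lemma finite_multi_indices: "finite (multi_indices k :: ('d::finite \<Rightarrow> nat) set)"
proof (rule finite_subset)
  show "(multi_indices k :: ('d \<Rightarrow> nat) set) \<subseteq> UNIV \<rightarrow>\<^sub>E {..k}"
  proof
    fix \<alpha> :: "'d \<Rightarrow> nat"
    assume "\<alpha> \<in> multi_indices k"
    then have "(\<Sum>i\<in>UNIV. \<alpha> i) \<le> k"
      by (simp add: multi_indices_def)
    moreover have "\<alpha> i \<le> (\<Sum>i\<in>UNIV. \<alpha> i)" for i
      by (rule member_le_sum) auto
    ultimately show "\<alpha> \<in> UNIV \<rightarrow>\<^sub>E {..k}"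
      by (auto intro: order_trans)
  qed
qed (simp add: finite_PiE)

definition polynomial_of_degree_le :: "nat \<Rightarrow> (real^'d \<Rightarrow> real) \<Rightarrow> bool" where
  "polynomial_of_degree_le k p \<longleftrightarrow>
     (\<exists>c. \<forall>x. p x = (\<Sum>\<alpha>\<in>multi_indices k. c \<alpha> * (\<Prod>i\<in>UNIV. (x $ i) ^ \<alpha> i)))"

text \<open>The function is total, but only its values on the union of the mesh matter.\<close>

definition lagrange_function :: "nat \<Rightarrow> (real^'d) set set \<Rightarrow> (real^'d \<Rightarrow> real) \<Rightarrow> bool" where
  "lagrange_function k \<T> u \<longleftrightarrow>
     continuous_on (\<Union>\<T>) u \<and>
     (\<forall>T\<in>\<T>. \<exists>p. polynomial_of_degree_le k p \<and> (\<forall>x\<in>T. u x = p x))"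

definition relu :: "real \<Rightarrow> real" where
  "relu t = max 0 t"

definition activation :: "real \<Rightarrow> real \<Rightarrow> real \<Rightarrow> real" where
  "activation a c t = a * relu t + c * (relu t)\<^sup>2"

text \<open>
  Networks of depth L >= 1 with positive widths n 1, ..., n L.  The components of the j-th hidden
  layer are z j x 1, ..., z j x (n j).  The first weight matrix V has its columns indexed by the
  coordinates of \<^typ>\<open>real^'d\<close>, and therefore a different type from the matrices W 2, ..., W L;
  the row vector w and the number \<beta> form the output layer.
\<close>

definition relu_networks :: "nat \<Rightarrow> (nat \<Rightarrow> nat) \<Rightarrow> (real^'d \<Rightarrow> real) set" where
  "relu_networks L n =
     {u. 1 \<le> L \<and> (\<forall>j\<in>{1..L}. 1 \<le> n j) \<and>
       (\<exists>(V :: nat \<Rightarrow> 'd \<Rightarrow> real) (W :: nat \<Rightarrow> nat \<Rightarrow> nat \<Rightarrow> real) (b :: nat \<Rightarrow> nat \<Rightarrow> real)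
          (a :: nat \<Rightarrow> nat \<Rightarrow> real) (c :: nat \<Rightarrow> nat \<Rightarrow> real) (w :: nat \<Rightarrow> real) (\<beta> :: real)
          (z :: nat \<Rightarrow> real^'d \<Rightarrow> nat \<Rightarrow> real).
          (\<forall>x. \<forall>i\<in>{1..n 1}.
             z 1 x i = activation (a 1 i) (c 1 i) ((\<Sum>m\<in>UNIV. V i m * x $ m) + b 1 i)) \<and>
          (\<forall>x. \<forall>j\<in>{2..L}. \<forall>i\<in>{1..n j}.
             z j x i = activation (a j i) (c j i)
               ((\<Sum>m=1..n (j - 1). W j i m * z (j - 1) x m) + b j i)) \<and>
          (\<forall>x. u x = (\<Sum>m=1..n L. w m * z L x m) + \<beta>))}"

end

theory Submission
  imports Defs
begin

text \<open>
  The restriction of a Lagrange function to a simplex is a homogeneous polynomial of degree \<open>k\<close> in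
  the barycentric coordinates.  Its coefficients are unique, even on faces, and hence agree on
  common faces: the function is globally a combination of Bernstein monomials
  \<open>\<Prod>v. hat v x ^ \<alpha> v\<close>, and the multi-indices \<open>\<alpha>\<close> correspond to the lattice points.  The
  monomials are computed one after the other, while the coordinates and the partial sum are carried
  along by one neuron each.

  In a monomial the hat function of \<open>v\<close> may be replaced by a function that agrees with it on the
  cells \<open>T\<close> containing the lattice point, as long as the product still vanishes elsewhere.  If all
  vertex patches are convex, then so is the domain (Tietze-Nakajima), and the positive part of the
  minimum over \<open>T\<close> of the affine extensions of the barycentric coordinate from \<open>T\<close> will do; the
  monomial is then a product of \<open>k\<close> factors, computed by a binary tree.  For a general mesh, the
  affine extension from \<open>T\<close> is first lowered by a large multiple of the negative parts of
  the barycentric coordinates of \<open>T\<close>, after which the maximum over \<open>T\<close> can be taken; here the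
  powers are computed by repeated squaring, so that the width does not depend on \<open>k\<close>.
\<close>

section \<open>Functions computed by layers\<close>

text \<open>Bernstein monomials suit the purpose because each factor is nonnegative and vanishes off
  the patch of its vertex: a surrogate factor must be exact only on the cells around the node, and
  beyond them a single vanishing factor settles the product. The bare affine extension of a
  coordinate can be too large in other cells; convexity of the patches, or else the penalty, removes
  this. The mesh statistics enter through one correspondence: \<open>node k\<close> sends an index
  with l + 1 support vertices to a lattice point in the relative interior of an l-dimensional face,
  and the cells containing this point are those having the whole support as vertices. So
  \<open>eta\<close> counts the monomials by dimension, and \<open>tau\<close> bounds the number of
  cells under each minimum or maximum. Constants: running the monomials in sequence costs d + 1
  extra neurons per layer, and the layer that prepares the penalty needs another d to pass the
  coordinates on, whence 2d + 1. Since k is at most (l + 1) + (k - l - 1), the logarithm of k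
  exceeds the larger of the two logarithms by at most 1. The other constants leave slack.\<close>

inductive_set aff :: "'a set \<Rightarrow> ('a \<Rightarrow> real) set \<Rightarrow> ('a \<Rightarrow> real) set"
  for D :: "'a set" and S :: "('a \<Rightarrow> real) set" where
  aff_base: "f \<in> S \<Longrightarrow> f \<in> aff D S"
| aff_const: "(\<lambda>x. c) \<in> aff D S"
| aff_add: "f \<in> aff D S \<Longrightarrow> g \<in> aff D S \<Longrightarrow> (\<lambda>x. f x + g x) \<in> aff D S"
| aff_scale: "f \<in> aff D S \<Longrightarrow> (\<lambda>x. c * f x) \<in> aff D S"
| aff_cong: "f \<in> aff D S \<Longrightarrow> (\<And>x. x \<in> D \<Longrightarrow> g x = f x) \<Longrightarrow> g \<in> aff D S"

lemma aff_diff: "f \<in> aff D S \<Longrightarrow> g \<in> aff D S \<Longrightarrow> (\<lambda>x. f x - g x) \<in> aff D S"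
  using aff_add[OF _ aff_scale[of g D S "-1"], of f] by simp

lemma aff_sum:
  assumes "\<And>i. i \<in> I \<Longrightarrow> f i \<in> aff D S"
  shows "(\<lambda>x. \<Sum>i\<in>I. f i x) \<in> aff D S"
  using assms by (induction I rule: infinite_finite_induct) (auto intro: aff_const aff_add)

lemma aff_subset:
  assumes "S \<subseteq> aff D S'"
  shows "aff D S \<subseteq> aff D S'"
proof
  fix f assume "f \<in> aff D S"
  then show "f \<in> aff D S'"
    by induction (use assms in \<open>auto intro: aff_const aff_add aff_scale aff_cong\<close>)
qed

lemma aff_mono: "S \<subseteq> S' \<Longrightarrow> aff D S \<subseteq> aff D S'"
  by (rule aff_subset) (auto intro: aff_base)

text \<open>Turns membership in a span back into weights and a bias. The coefficients belong to
  indices, not to functions, because \<open>Z\<close> need not be injective.\<close>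

lemma aff_imageE:
  assumes "f \<in> aff D (Z ` I)" and fin: "finite I"
  obtains c b where "\<And>x. x \<in> D \<Longrightarrow> f x = (\<Sum>i\<in>I. c i * Z i x) + b"
proof -
  have "\<exists>c b. \<forall>x\<in>D. f x = (\<Sum>i\<in>I. c i * Z i x) + b"
    using assms(1)
  proof induction
    case (aff_base f)
    then obtain i where i: "i \<in> I" "f = Z i" by auto
    have "\<forall>x\<in>D. f x = (\<Sum>j\<in>I. (if j = i then 1 else 0) * Z j x) + 0"
      using i fin by (simp add: if_distrib[of "\<lambda>t. t * _"] cong: if_cong)
    then show ?case by meson
  next
    case (aff_const c)
    have "\<forall>x\<in>D. c = (\<Sum>j\<in>I. 0 * Z j x) + c" by simp
    then show ?case by meson
  next
    case (aff_add f g)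
    then obtain c b c' b' where "\<forall>x\<in>D. f x = (\<Sum>i\<in>I. c i * Z i x) + b"
      "\<forall>x\<in>D. g x = (\<Sum>i\<in>I. c' i * Z i x) + b'" by blast
    then have "\<forall>x\<in>D. f x + g x = (\<Sum>i\<in>I. (c i + c' i) * Z i x) + (b + b')"
      by (simp add: distrib_right sum.distrib)
    then show ?case by (intro exI)
  next
    case (aff_scale f r)
    then obtain c b where "\<forall>x\<in>D. f x = (\<Sum>i\<in>I. c i * Z i x) + b" by blast
    then have "\<forall>x\<in>D. r * f x = (\<Sum>i\<in>I. (r * c i) * Z i x) + r * b"
      by (simp add: distrib_left sum_distrib_left mult.assoc)
    then show ?case by (intro exI)
  next
    case (aff_cong f g)
    then show ?case by auto
  qed
  then show ?thesis using that by blast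
qed

text \<open>The invariant that permits shifting arguments into the range where \<open>relu\<close>
  is the identity; the bound may depend on the function.\<close>

definition bdd_funs :: "'a set \<Rightarrow> ('a \<Rightarrow> real) set \<Rightarrow> bool" where
  "bdd_funs D S \<longleftrightarrow> (\<forall>f\<in>S. \<exists>M. \<forall>x\<in>D. \<bar>f x\<bar> \<le> M)"

lemma bdd_funs_aff:
  assumes "bdd_funs D S"
  shows "bdd_funs D (aff D S)"
proof -
  have "\<exists>M. \<forall>x\<in>D. \<bar>f x\<bar> \<le> M" if "f \<in> aff D S" for f
    using that
  proof induction
    case (aff_base f)
    then show ?case using assms by (auto simp: bdd_funs_def)
  next
    case (aff_const c)
    then show ?case by blast
  next
    case (aff_add f g)
    then obtain M M' where "\<forall>x\<in>D. \<bar>f x\<bar> \<le> M" "\<forall>x\<in>D. \<bar>g x\<bar> \<le> M'" by blast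
    then have "\<forall>x\<in>D. \<bar>f x + g x\<bar> \<le> M + M'" by (meson abs_triangle_ineq add_mono order_trans)
    then show ?case by blast
  next
    case (aff_scale f c)
    then obtain M where "\<forall>x\<in>D. \<bar>f x\<bar> \<le> M" by blast
    then have "\<forall>x\<in>D. \<bar>c * f x\<bar> \<le> \<bar>c\<bar> * M" by (auto simp: abs_mult intro: mult_left_mono)
    then show ?case by blast
  next
    case (aff_cong f g)
    then show ?case by auto
  qed
  then show ?thesis by (auto simp: bdd_funs_def)
qed

lemma bdd_funs_subset: "bdd_funs D S \<Longrightarrow> A \<subseteq> aff D S \<Longrightarrow> bdd_funs D A"
  using bdd_funs_aff[of D S] unfolding bdd_funs_def by blast

lemma bdd_affE:
  assumes "bdd_funs D S" "f \<in> aff D S"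
  obtains M where "\<forall>x\<in>D. \<bar>f x\<bar> \<le> M"
  using bdd_funs_aff[OF assms(1)] assms(2) by (auto simp: bdd_funs_def)

text \<open>Weight matrices are absorbed into affine spans: a layer is described by the set of its neurons,
  and \<open>reach D w n S S'\<close> means that every function in \<open>S'\<close> is an affine combination of the outputs of
  the last of \<open>n\<close> layers of width \<open>w\<close> that are fed with \<open>S\<close>.  All identities are only required on
  \<open>D\<close>; this lets single neurons carry bounded functions.\<close>

definition neurons :: "'a set \<Rightarrow> ('a \<Rightarrow> real) set \<Rightarrow> ('a \<Rightarrow> real) set" where
  "neurons D S = {g. \<exists>a c. \<exists>h\<in>aff D S. \<forall>x\<in>D. g x = activation a c (h x)}"

definition layer :: "'a set \<Rightarrow> nat \<Rightarrow> ('a \<Rightarrow> real) set \<Rightarrow> ('a \<Rightarrow> real) set \<Rightarrow> bool" where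
  "layer D w S S' \<longleftrightarrow> (\<exists>G. finite G \<and> card G \<le> w \<and> G \<subseteq> neurons D S \<and> S' \<subseteq> aff D G)"

fun reach :: "'a set \<Rightarrow> nat \<Rightarrow> nat \<Rightarrow> ('a \<Rightarrow> real) set \<Rightarrow> ('a \<Rightarrow> real) set \<Rightarrow> bool" where
  "reach D w 0 S S' \<longleftrightarrow> S' \<subseteq> aff D S"
| "reach D w (Suc n) S S' \<longleftrightarrow> (\<exists>S1. layer D w S S1 \<and> reach D w n S1 S')"

lemma neurons_mono: "S \<subseteq> aff D S' \<Longrightarrow> neurons D S \<subseteq> neurons D S'"
  using aff_subset unfolding neurons_def by blast

lemma layer_mono:
  assumes "layer D w S A" "w \<le> w'" "S \<subseteq> aff D S'" "A' \<subseteq> aff D A"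
  shows "layer D w' S' A'"
proof -
  obtain G where G: "finite G" "card G \<le> w" "G \<subseteq> neurons D S" "A \<subseteq> aff D G"
    using assms(1) by (auto simp: layer_def)
  then have "card G \<le> w'" "G \<subseteq> neurons D S'" "A' \<subseteq> aff D G"
    using assms neurons_mono[OF assms(3)] aff_subset[OF G(4)] by auto
  then show ?thesis using G(1) by (auto simp: layer_def)
qed

lemma layer_Un:
  assumes "layer D w S A" "layer D w' S' A'"
  shows "layer D (w + w') (S \<union> S') (A \<union> A')"
proof -
  obtain G where G: "finite G" "card G \<le> w" "G \<subseteq> neurons D S" "A \<subseteq> aff D G"
    using assms(1) by (auto simp: layer_def)
  obtain G' where G': "finite G'" "card G' \<le> w'" "G' \<subseteq> neurons D S'" "A' \<subseteq> aff D G'"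
    using assms(2) by (auto simp: layer_def)
  have "card (G \<union> G') \<le> w + w'"
    using card_Un_le[of G G'] G(2) G'(2) by linarith
  moreover have "neurons D S \<subseteq> neurons D (S \<union> S')" "neurons D S' \<subseteq> neurons D (S \<union> S')"
    by (rule neurons_mono; auto intro: aff_base)+
  moreover have "aff D G \<subseteq> aff D (G \<union> G')" "aff D G' \<subseteq> aff D (G \<union> G')"
    by (auto intro!: aff_mono)
  ultimately show ?thesis
    unfolding layer_def using G G' by (intro exI[of _ "G \<union> G'"]) blast
qed

lemma bdd_neurons:
  assumes "bdd_funs D S"
  shows "bdd_funs D (neurons D S)"
  unfolding bdd_funs_def
proof
  fix g assume "g \<in> neurons D S"
  then obtain a c h where h: "h \<in> aff D S" and g: "\<forall>x\<in>D. g x = activation a c (h x)"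
    by (auto simp: neurons_def)
  obtain M where M: "\<forall>x\<in>D. \<bar>h x\<bar> \<le> M"
    by (rule bdd_affE[OF assms h])
  have "\<bar>g x\<bar> \<le> \<bar>a\<bar> * \<bar>M\<bar> + \<bar>c\<bar> * \<bar>M\<bar>\<^sup>2" if "x \<in> D" for x
  proof -
    have r: "\<bar>relu (h x)\<bar> \<le> \<bar>M\<bar>" using bspec[OF M that] by (auto simp: relu_def)
    then have "(relu (h x))\<^sup>2 \<le> \<bar>M\<bar>\<^sup>2" using power_mono[of "\<bar>relu (h x)\<bar>" "\<bar>M\<bar>" 2] by simp
    then have "\<bar>c * (relu (h x))\<^sup>2\<bar> \<le> \<bar>c\<bar> * \<bar>M\<bar>\<^sup>2"
      by (auto simp: abs_mult intro: mult_left_mono)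
    moreover have "\<bar>a * relu (h x)\<bar> \<le> \<bar>a\<bar> * \<bar>M\<bar>"
      using r by (auto simp: abs_mult intro: mult_left_mono)
    ultimately show ?thesis using g that by (auto simp: activation_def)
  qed
  then show "\<exists>M. \<forall>x\<in>D. \<bar>g x\<bar> \<le> M" by blast
qed

lemma layer_bdd: "layer D w S A \<Longrightarrow> bdd_funs D S \<Longrightarrow> bdd_funs D A"
  unfolding layer_def
  by (meson bdd_funs_subset bdd_neurons aff_base subset_iff aff_mono)

text \<open>Boundedness therefore has to be checked for the input coordinates only.\<close>

lemma reach_bdd: "reach D w n S A \<Longrightarrow> bdd_funs D S \<Longrightarrow> bdd_funs D A"
  by (induction n arbitrary: S) (auto dest: layer_bdd bdd_funs_subset)

text \<open>A change of input or output within affine spans is absorbed by the first or last affine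
  map, and the width is merely an upper bound.\<close>

lemma reach_mono:
  assumes "reach D w n S A" "w \<le> w'" "S \<subseteq> aff D S'" "A' \<subseteq> aff D A"
  shows "reach D w' n S' A'"
  using assms
proof (induction n arbitrary: S S')
  case 0
  then show ?case using aff_subset[of S D S'] aff_subset[of A D S] by auto
next
  case (Suc n)
  then obtain S1 where "layer D w S S1" "reach D w n S1 A" by auto
  moreover have "layer D w' S' S1"
    by (rule layer_mono[OF \<open>layer D w S S1\<close> Suc.prems(2,3)]) (auto intro: aff_base)
  ultimately show ?case using Suc.IH[of S1 S1] Suc.prems aff_base[of _ S1 D] by fastforce
qed

text \<open>Parallel composition: blocks of equal depth are put side by side layer by layer.\<close>

lemma reach_Un:
  assumes "reach D w n S A" "reach D w' n S' A'"
  shows "reach D (w + w') n (S \<union> S') (A \<union> A')"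
  using assms
proof (induction n arbitrary: S S')
  case 0
  then show ?case using aff_mono[of S "S \<union> S'" D] aff_mono[of S' "S \<union> S'" D] by auto
next
  case (Suc n)
  then obtain S1 S2 where "layer D w S S1" "reach D w n S1 A" "layer D w' S' S2" "reach D w' n S2 A'"
    by auto
  then show ?case using layer_Un Suc.IH by (metis reach.simps(2))
qed

lemma reach_Un_same:
  "reach D w n S A \<Longrightarrow> reach D w' n S A' \<Longrightarrow> reach D (w + w') n S (A \<union> A')"
  using reach_Un[of D w n S A w' S A'] by simp

lemma layer_empty: "layer D 0 S {}"
  by (auto simp: layer_def intro!: exI[of _ "{}"])

lemma reach_empty: "reach D 0 n S {}"
  by (induction n arbitrary: S) (use layer_empty in \<open>auto\<close>)

lemma reach_UN:
  assumes "finite I" "\<And>i. i \<in> I \<Longrightarrow> reach D w n S (A i)"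
  shows "reach D (card I * w) n S (\<Union>i\<in>I. A i)"
  using assms
proof (induction I)
  case empty
  then show ?case by (simp add: reach_empty)
next
  case (insert i I)
  then have "reach D (w + card I * w) n S (A i \<union> (\<Union>i\<in>I. A i))"
    by (intro reach_Un_same) auto
  then show ?case using insert by simp
qed

text \<open>Sequential composition needs no layer in between, because the output map of the first
  block merges with the input map of the second.\<close>

lemma reach_trans:
  "reach D w m S A \<Longrightarrow> reach D w n A B \<Longrightarrow> reach D w (m + n) S B"
proof (induction m arbitrary: S)
  case 0
  then show ?case using reach_mono[of D w n A B w S B] by (auto intro: aff_base)
next
  case (Suc m)
  then show ?case by auto
qed

lemma reach_layer: "reach D w (Suc 0) S A \<longleftrightarrow> layer D w S A"
proof
  show "reach D w (Suc 0) S A \<Longrightarrow> layer D w S A"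
    using layer_mono[of D w S _ w S A] by (auto intro: aff_base)
  show "layer D w S A \<Longrightarrow> reach D w (Suc 0) S A"
    by (auto intro: aff_base)
qed

section \<open>Elementary operations computed by a single layer\<close>

lemma layer_relu:
  assumes "f \<in> aff D S"
  shows "layer D 1 S {\<lambda>x. relu (f x)}"
proof -
  have "(\<lambda>x. relu (f x)) \<in> neurons D S"
    using assms unfolding neurons_def mem_Collect_eq
    by (intro exI[of _ 1] exI[of _ 0] bexI[of _ f]) (simp_all add: activation_def)
  then show ?thesis
    by (auto simp: layer_def intro!: exI[of _ "{\<lambda>x. relu (f x)}"] aff_base)
qed

text \<open>On a set where \<open>f\<close> is bounded, one neuron represents any quadratic polynomial in \<open>f\<close>
  up to a constant: shift the argument until it is positive.\<close>

lemma neuron_quadratic: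
  assumes "bdd_funs D S" "f \<in> aff D S"
  obtains g where "g \<in> neurons D S" "(\<lambda>x. a * f x + c * (f x)\<^sup>2) \<in> aff D {g}"
proof -
  obtain M where M: "\<forall>x\<in>D. \<bar>f x\<bar> \<le> M"
    by (rule bdd_affE[OF assms])
  \<comment> \<open>The correction \<open>- 2 * M * c\<close> of the linear coefficient cancels the
    cross term from squaring \<open>f x + M\<close>; only a constant is left over.\<close>
  let ?g = "\<lambda>x. activation (a - 2 * M * c) c (f x + M)"
  have "?g \<in> neurons D S"
    using aff_add[OF assms(2) aff_const[of M]] unfolding neurons_def mem_Collect_eq
    by (intro exI bexI[of _ "\<lambda>x. f x + M"]) auto
  moreover have "(\<lambda>x. a * f x + c * (f x)\<^sup>2) \<in> aff D {?g}"
  proof (rule aff_cong)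
    show "(\<lambda>x. ?g x + (c * M\<^sup>2 - a * M)) \<in> aff D {?g}"
      by (intro aff_add aff_const aff_base) simp
    fix x assume "x \<in> D"
    then have "relu (f x + M) = f x + M" using M by (force simp: relu_def)
    then show "a * f x + c * (f x)\<^sup>2 = ?g x + (c * M\<^sup>2 - a * M)"
      by (simp add: activation_def power2_eq_square algebra_simps)
  qed
  ultimately show ?thesis using that by blast
qed

lemma layer_quadratic:
  assumes "bdd_funs D S" "f \<in> aff D S"
  shows "layer D 1 S {\<lambda>x. a * f x + c * (f x)\<^sup>2}"
proof -
  obtain g where "g \<in> neurons D S" "(\<lambda>x. a * f x + c * (f x)\<^sup>2) \<in> aff D {g}"
    using neuron_quadratic[OF assms] by blast
  then show ?thesis by (auto simp: layer_def intro!: exI[of _ "{g}"])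
qed

lemma layer_id:
  assumes "bdd_funs D S" "f \<in> aff D S"
  shows "layer D 1 S {f}"
  using layer_quadratic[OF assms, of 1 0] by simp

lemma layer_two:
  assumes "layer D 1 S {f}" "layer D 1 S {g}" "h \<in> aff D {f, g}"
  shows "layer D 2 S {h}"
  using layer_mono[OF layer_Un[OF assms(1,2)], of 2 S "{h}"] assms(3)
  by (auto simp: insert_commute numeral_2_eq_2 intro: aff_base)

text \<open>Polarization: the product is a quarter of the difference of the squares of sum and
  difference, with one neuron for each square.\<close>

lemma layer_mult:
  assumes "bdd_funs D S" "f \<in> aff D S" "g \<in> aff D S"
  shows "layer D 2 S {\<lambda>x. f x * g x}"
proof -
  let ?p = "\<lambda>x. 0 * (f x + g x) + (1 / 4) * (f x + g x)\<^sup>2"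
  let ?q = "\<lambda>x. 0 * (f x - g x) + (1 / 4) * (f x - g x)\<^sup>2"
  have "layer D 1 S {?p}" "layer D 1 S {?q}"
    using layer_quadratic[OF assms(1) aff_add[OF assms(2,3)], of 0 "1/4"]
      layer_quadratic[OF assms(1) aff_diff[OF assms(2,3)], of 0 "1/4"] by auto
  moreover have "(\<lambda>x. f x * g x) \<in> aff D {?p, ?q}"
    by (rule aff_cong[OF aff_diff[of ?p _ _ ?q]])
      (auto intro: aff_base simp: power2_eq_square field_simps)
  ultimately show ?thesis by (rule layer_two)
qed

text \<open>The maximum is \<open>g\<close> plus the positive part of \<open>f - g\<close>; the
  second neuron only transports \<open>g\<close>.\<close>

lemma layer_max:
  assumes "bdd_funs D S" "f \<in> aff D S" "g \<in> aff D S"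
  shows "layer D 2 S {\<lambda>x. max (f x) (g x)}"
proof -
  have "(\<lambda>x. max (f x) (g x)) \<in> aff D {g, \<lambda>x. relu (f x - g x)}"
    by (rule aff_cong[OF aff_add[of g _ _ "\<lambda>x. relu (f x - g x)"]])
      (auto intro: aff_base simp: relu_def)
  then show ?thesis
    by (rule layer_two[OF layer_id[OF assms(1,3)] layer_relu[OF aff_diff[OF assms(2,3)]]])
qed

lemma layer_min:
  assumes "bdd_funs D S" "f \<in> aff D S" "g \<in> aff D S"
  shows "layer D 2 S {\<lambda>x. min (f x) (g x)}"
proof -
  have "(\<lambda>x. min (f x) (g x)) \<in> aff D {g, \<lambda>x. relu (g x - f x)}"
    by (rule aff_cong[OF aff_diff[of g _ _ "\<lambda>x. relu (g x - f x)"]])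
      (auto intro: aff_base simp: relu_def)
  then show ?thesis
    by (rule layer_two[OF layer_id[OF assms(1,3)] layer_relu[OF aff_diff[OF assms(3,2)]]])
qed

section \<open>Delay neurons and binary trees\<close>

lemma reach_id:
  assumes "bdd_funs D S" "f \<in> aff D S"
  shows "reach D 1 n S {f}"
  using assms
proof (induction n arbitrary: S)
  case (Suc n)
  have l: "layer D 1 S {f}" using layer_id[OF Suc.prems] .
  then have "reach D 1 n {f} {f}"
    using Suc.IH[of "{f}"] layer_bdd[OF l Suc.prems(1)] by (auto intro: aff_base)
  then show ?case using l by auto
qed simp

lemma reach_ids:
  assumes "bdd_funs D C" "finite C"
  shows "reach D (card C) n C C"
  using reach_UN[of C D 1 n C "\<lambda>f. {f}"] reach_id[OF assms(1)] assms(2) by (auto intro: aff_base)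

text \<open>Halving the list lowers the depth bound by one, and combining two nonempty halves takes
  two neurons, so the number of leaves suffices as width. Stating \<open>F2\<close> for nonempty
  lists only avoids a neutral element, which minimum and maximum do not have.\<close>

lemma reach_tree:
  fixes F :: "real list \<Rightarrow> real"
  assumes op: "\<And>S f g. bdd_funs D S \<Longrightarrow> f \<in> aff D S \<Longrightarrow> g \<in> aff D S \<Longrightarrow> layer D 2 S {\<lambda>x. op (f x) (g x)}"
    and F1: "\<And>a. F [a] = a"
    and F2: "\<And>xs ys. xs \<noteq> [] \<Longrightarrow> ys \<noteq> [] \<Longrightarrow> F (xs @ ys) = op (F xs) (F ys)"
    and S: "bdd_funs D S"
  shows "set fs \<subseteq> aff D S \<Longrightarrow> fs \<noteq> [] \<Longrightarrow> length fs \<le> 2 ^ n \<Longrightarrow>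
    reach D (length fs) n S {\<lambda>x. F (map (\<lambda>f. f x) fs)}"
proof (induction n arbitrary: fs)
  case 0
  then obtain f where "fs = [f]" by (cases fs) auto
  then show ?case using 0 F1 by auto
next
  case (Suc n)
  show ?case
  proof (cases "length fs = 1")
    case True
    then obtain f where "fs = [f]" by (auto simp: length_Suc_conv)
    \<comment> \<open>A lone leaf is delayed by identity neurons, since the subtrees that are joined
      must have equal depth.\<close>
    then show ?thesis using reach_id[OF S, of f "Suc n"] Suc.prems(1) F1 by (simp del: reach.simps)
  next
    case False
    define m where "m = length fs div 2"
    define as where "as = take m fs"
    define bs where "bs = drop m fs"
    have fs: "fs = as @ bs" by (simp add: as_def bs_def)
    have l2: "length fs \<ge> 2" using False Suc.prems(2) by (cases fs) (auto simp: Suc_le_eq)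
    have "length as = m" using m_def by (simp add: as_def)
    moreover have "length bs = length fs - m" by (simp add: bs_def)
    ultimately have la: "length as \<le> 2 ^ n" "length bs \<le> 2 ^ n" "as \<noteq> []" "bs \<noteq> []"
      using Suc.prems(3) l2 by (auto simp: m_def simp flip: length_greater_0_conv)
    let ?A = "\<lambda>x. F (map (\<lambda>f. f x) as)" and ?B = "\<lambda>x. F (map (\<lambda>f. f x) bs)"
    have "reach D (length as) n S {?A}" "reach D (length bs) n S {?B}"
      using Suc.IH[of as] Suc.IH[of bs] la Suc.prems(1) fs by auto
    from reach_Un_same[OF this] have r: "reach D (length fs) n S {?A, ?B}"
      by (simp add: fs insert_commute)
    have "layer D 2 {?A, ?B} {\<lambda>x. op (?A x) (?B x)}"
      by (rule op) (use reach_bdd[OF r S] in \<open>auto intro: aff_base\<close>)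
    then have "reach D 2 (Suc 0) {?A, ?B} {\<lambda>x. op (?A x) (?B x)}"
      by (simp only: reach_layer)
    then have "reach D (length fs) (Suc 0) {?A, ?B} {\<lambda>x. op (?A x) (?B x)}"
      by (rule reach_mono) (use l2 in \<open>auto intro: aff_base\<close>)
    from reach_trans[OF r this] show ?thesis
      using F2 la by (simp add: fs del: reach.simps)
  qed
qed

lemma reach_prod_list:
  assumes "bdd_funs D S" "set fs \<subseteq> aff D S" "fs \<noteq> []" "length fs \<le> 2 ^ n"
  shows "reach D (length fs) n S {\<lambda>x. prod_list (map (\<lambda>f. f x) fs)}"
  by (rule reach_tree[where op = "(*)" and F = prod_list, OF layer_mult _ _ assms]) simp_all

lemma reach_Min:
  assumes "bdd_funs D S" "finite I" "I \<noteq> {}" "f ` I \<subseteq> aff D S" "card I \<le> 2 ^ n"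
  shows "reach D (card I) n S {\<lambda>x. MIN i\<in>I. f i x}"
proof -
  obtain xs where xs: "set xs = I" "distinct xs" using finite_distinct_list[OF assms(2)] by blast
  have len: "length (map f xs) = card I" using xs distinct_card by fastforce
  have "reach D (length (map f xs)) n S {\<lambda>x. Min (set (map (\<lambda>f. f x) (map f xs)))}"
  proof (rule reach_tree[where op = min and F = "\<lambda>ys. Min (set ys)", OF layer_min _ _ assms(1)])
    show "length (map f xs) \<le> 2 ^ n" using len assms(5) by simp
  qed (use assms(3,4) xs in \<open>auto simp: Min_Un\<close>)
  then show ?thesis using xs(1) len by (simp add: image_image)
qed

lemma reach_Max:
  assumes "bdd_funs D S" "finite I" "I \<noteq> {}" "f ` I \<subseteq> aff D S" "card I \<le> 2 ^ n"
  shows "reach D (card I) n S {\<lambda>x. MAX i\<in>I. f i x}"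
proof -
  obtain xs where xs: "set xs = I" "distinct xs" using finite_distinct_list[OF assms(2)] by blast
  have len: "length (map f xs) = card I" using xs distinct_card by fastforce
  have "reach D (length (map f xs)) n S {\<lambda>x. Max (set (map (\<lambda>f. f x) (map f xs)))}"
  proof (rule reach_tree[where op = max and F = "\<lambda>ys. Max (set ys)", OF layer_max _ _ assms(1)])
    show "length (map f xs) \<le> 2 ^ n" using len assms(5) by simp
  qed (use assms(3,4) xs in \<open>auto simp: Max_Un\<close>)
  then show ?thesis using xs(1) len by (simp add: image_image)
qed

lemma reach_prod:
  assumes "bdd_funs D S" "finite I" "I \<noteq> {}" "f ` I \<subseteq> aff D S" "card I \<le> 2 ^ n"
  shows "reach D (card I) n S {\<lambda>x. \<Prod>i\<in>I. f i x}"
proof -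
  obtain xs where xs: "set xs = I" "distinct xs" using finite_distinct_list[OF assms(2)] by blast
  have "reach D (length (map f xs)) n S {\<lambda>x. prod_list (map (\<lambda>f. f x) (map f xs))}"
    by (rule reach_prod_list) (use assms xs distinct_card[OF xs(2)] in auto)
  moreover have "prod_list (map (\<lambda>f. f x) (map f xs)) = (\<Prod>i\<in>I. f i x)" for x
    using prod.distinct_set_conv_list[OF xs(2), of "\<lambda>i. f i x"] xs(1) by (simp add: comp_def)
  ultimately show ?thesis using distinct_card[OF xs(2)] xs(1) by simp
qed

text \<open>Powers are unrolled into repeated factors, indexed by the pairs (i, j) with j below the
  exponent of i; there are \<open>k\<close> of them, so one product tree of width \<open>k\<close>
  suffices.\<close>

lemma reach_monomial:
  assumes "bdd_funs D S" "finite I" "f ` I \<subseteq> aff D S" "sum \<alpha> I = k" "1 \<le> k" "k \<le> 2 ^ n"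
  shows "reach D k n S {\<lambda>x. \<Prod>i\<in>I. f i x ^ \<alpha> i}"
proof -
  let ?J = "SIGMA i:I. {..<\<alpha> i}"
  have c: "card ?J = k" using assms(2,4) by simp
  have "reach D (card ?J) n S {\<lambda>x. \<Prod>j\<in>?J. (\<lambda>j. f (fst j)) j x}"
    by (rule reach_prod) (use assms c in \<open>auto simp del: card_SigmaI\<close>)
  moreover have "(\<Prod>j\<in>?J. f (fst j) x) = (\<Prod>i\<in>I. f i x ^ \<alpha> i)" for x
    using prod.Sigma[of I "\<lambda>i. {..<\<alpha> i}" "\<lambda>i _. f i x"] assms(2) by (simp add: case_prod_beta)
  ultimately show ?thesis using c by simp
qed

text \<open>Square-and-multiply from the lowest bit: the state consists of the current square and the
  partial product, so that the width does not depend on the exponent.\<close>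

lemma reach_power:
  assumes "bdd_funs D S" "q \<in> aff D S" "r \<in> aff D S" "a < 2 ^ n"
  shows "reach D 3 n S {\<lambda>x. r x * q x ^ a}"
  using assms
proof (induction n arbitrary: S q r a)
  case 0
  then show ?case by auto
next
  case (Suc n)
  let ?q = "\<lambda>x. 0 * q x + 1 * (q x)\<^sup>2" and ?r = "\<lambda>x. r x * q x ^ (a mod 2)"
  \<comment> \<open>One neuron for the square and two for the conditional product give the width
    3.\<close>
  have q: "layer D 1 S {?q}" by (rule layer_quadratic) (use Suc.prems in auto)
  have "layer D 2 S {?r}"
  proof (cases "a mod 2 = 0")
    case True
    then show ?thesis
      using layer_mono[OF layer_id[OF Suc.prems(1,3)], of 2 S "{?r}"] by (auto intro: aff_base)
  next
    case False
    then have "a mod 2 = 1" by simp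
    then show ?thesis using layer_mult[OF Suc.prems(1,3,2)] by simp
  qed
  from layer_Un[OF q this] have l: "layer D 3 S {?q, ?r}" by (simp add: insert_commute numeral_3_eq_3)
  have "reach D 3 n {?q, ?r} {\<lambda>x. ?r x * ?q x ^ (a div 2)}"
    by (rule Suc.IH) (use Suc.prems layer_bdd[OF l] in \<open>auto intro: aff_base\<close>)
  moreover have "(\<lambda>x. ?r x * ?q x ^ (a div 2)) = (\<lambda>x. r x * q x ^ a)"
  proof
    fix x
    have "q x ^ a = q x ^ (a mod 2 + 2 * (a div 2))" by simp
    then show "?r x * ?q x ^ (a div 2) = r x * q x ^ a" unfolding power_add power_mult by simp
  qed
  ultimately have "reach D 3 n {?q, ?r} {\<lambda>x. r x * q x ^ a}" by (simp only:)
  then show ?case using l unfolding reach.simps by blast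
qed

section \<open>From affine spans to explicit weights\<close>

inductive hidden :: "nat \<Rightarrow> nat \<Rightarrow> (real^'d \<Rightarrow> nat \<Rightarrow> real) \<Rightarrow> bool" for W :: nat where
  hidden_first: "hidden W 1 (\<lambda>x i. activation (a i) (c i) ((\<Sum>m\<in>UNIV. V i m * x $ m) + b i))"
| hidden_step: "hidden W j Z \<Longrightarrow>
    hidden W (Suc j) (\<lambda>x i. activation (a i) (c i) ((\<Sum>m=1..W. A i m * Z x m) + b i))"

text \<open>Pads every layer to exactly \<open>W\<close> neurons, so that all hidden layers of the
  network can share one width.\<close>

lemma neurons_enum:
  assumes "finite G" "card G \<le> W" "G \<subseteq> neurons D S"
  obtains e where "\<And>i. e i \<in> neurons D S" "G \<subseteq> e ` {1..W::nat}"
proof -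
  obtain xs where xs: "set xs = G" "distinct xs" using finite_distinct_list[OF assms(1)] by blast
  \<comment> \<open>Neurons are numbered from 1 and list positions from 0; the zero function fills
    the positions past the end of the list.\<close>
  define e where "e i = (if i - 1 < length xs then xs ! (i - 1) else (\<lambda>_. 0))" for i
  have "(\<lambda>x. 0) \<in> neurons D S"
    using aff_const[of 0 D S]
    by (auto simp: neurons_def activation_def intro!: exI[of _ 0] bexI[of _ "\<lambda>_. 0"])
  then have "e i \<in> neurons D S" for i
    using assms(3) xs(1) nth_mem[of "i - 1" xs] by (auto simp: e_def)
  moreover have "G \<subseteq> e ` {1..W}"
  proof
    fix g assume "g \<in> G"
    then obtain i where "i < length xs" "xs ! i = g" using xs(1) by (metis in_set_conv_nth)
    then have "g = e (Suc i)" "Suc i \<in> {1..W}"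
      using assms(2) distinct_card[OF xs(2)] xs(1) by (auto simp: e_def)
    then show "g \<in> e ` {1..W}" by blast
  qed
  ultimately show ?thesis using that by blast
qed

abbreviation coords :: "(real^'d \<Rightarrow> real) set" where
  "coords \<equiv> range (\<lambda>i x. x $ i)"

text \<open>A member of \<open>neurons\<close> has the form of an activation only on
  \<open>D\<close>. \<open>Z\<close> is this form evaluated on the whole space, a difference that
  spans over \<open>D\<close> do not see.\<close>

lemma layer_imp_hidden_first:
  assumes "layer D W coords A"
  obtains Z where "hidden W 1 Z" "A \<subseteq> aff D ((\<lambda>i x. Z x i) ` {1..W})"
proof -
  obtain G where G: "finite G" "card G \<le> W" "G \<subseteq> neurons D coords" "A \<subseteq> aff D G"
    using assms by (auto simp: layer_def)
  obtain e where e: "\<And>i. e i \<in> neurons D coords" "G \<subseteq> e ` {1..W}"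
    using neurons_enum[OF G(1-3)] by blast
  have "\<exists>a c V b. \<forall>x\<in>D. e i x = activation a c ((\<Sum>m\<in>UNIV. V m * x $ m) + b)" for i
  proof -
    obtain a c h where h: "h \<in> aff D coords" "\<forall>x\<in>D. e i x = activation a c (h x)"
      using e(1)[of i] by (auto simp: neurons_def)
    obtain V b where "\<And>x. x \<in> D \<Longrightarrow> h x = (\<Sum>m\<in>UNIV. V m * x $ m) + b"
      by (rule aff_imageE[OF h(1)]) auto
    then show ?thesis using h(2) by metis
  qed
  then obtain a c V b
    where eq: "\<And>i x. x \<in> D \<Longrightarrow> e i x = activation (a i) (c i) ((\<Sum>m\<in>UNIV. V i m * x $ m) + b i)"
    by metis
  let ?Z = "\<lambda>x i. activation (a i) (c i) ((\<Sum>m\<in>UNIV. V i m * x $ m) + b i)"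
  have "e i \<in> aff D ((\<lambda>i x. ?Z x i) ` {1..W})" if "i \<in> {1..W}" for i
    by (rule aff_cong[OF aff_base[of "\<lambda>x. ?Z x i"]]) (use that eq in auto)
  then have "aff D G \<subseteq> aff D ((\<lambda>i x. ?Z x i) ` {1..W})"
    using e(2) by (intro aff_subset) blast
  then show ?thesis using that[OF hidden_first] G(4) by blast
qed

lemma layer_imp_hidden_step:
  assumes "hidden W j Z" "S \<subseteq> aff D ((\<lambda>i x. Z x i) ` {1..W})" "layer D W S A"
  obtains Z' where "hidden W (Suc j) Z'" "A \<subseteq> aff D ((\<lambda>i x. Z' x i) ` {1..W})"
proof -
  let ?Y = "(\<lambda>i x. Z x i) ` {1..W}"
  have "layer D W ?Y A" using layer_mono[OF assms(3) _ assms(2)] aff_base by blast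
  then obtain G where G: "finite G" "card G \<le> W" "G \<subseteq> neurons D ?Y" "A \<subseteq> aff D G"
    by (auto simp: layer_def)
  obtain e where e: "\<And>i. e i \<in> neurons D ?Y" "G \<subseteq> e ` {1..W}"
    using neurons_enum[OF G(1-3)] by blast
  have "\<exists>a c V b. \<forall>x\<in>D. e i x = activation a c ((\<Sum>m=1..W. V m * Z x m) + b)" for i
  proof -
    obtain a c h where h: "h \<in> aff D ?Y" "\<forall>x\<in>D. e i x = activation a c (h x)"
      using e(1)[of i] by (auto simp: neurons_def)
    obtain V b where "\<And>x. x \<in> D \<Longrightarrow> h x = (\<Sum>m=1..W. V m * Z x m) + b"
      by (rule aff_imageE[OF h(1)]) auto
    then show ?thesis using h(2) by metis
  qed
  then obtain a c V b
    where eq: "\<And>i x. x \<in> D \<Longrightarrow> e i x = activation (a i) (c i) ((\<Sum>m=1..W. V i m * Z x m) + b i)"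
    by metis
  let ?Z = "\<lambda>x i. activation (a i) (c i) ((\<Sum>m=1..W. V i m * Z x m) + b i)"
  have "e i \<in> aff D ((\<lambda>i x. ?Z x i) ` {1..W})" if "i \<in> {1..W}" for i
    by (rule aff_cong[OF aff_base[of "\<lambda>x. ?Z x i"]]) (use that eq in auto)
  then have "aff D G \<subseteq> aff D ((\<lambda>i x. ?Z x i) ` {1..W})"
    using e(2) by (intro aff_subset) blast
  then show ?thesis using that[OF hidden_step[OF assms(1)]] G(4) by blast
qed

lemma reach_imp_hidden:
  assumes "reach D W n S A" "hidden W j Z" "S \<subseteq> aff D ((\<lambda>i x. Z x i) ` {1..W})"
  obtains Z' where "hidden W (j + n) Z'" "A \<subseteq> aff D ((\<lambda>i x. Z' x i) ` {1..W})"
  using assms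
proof (induction n arbitrary: S j Z thesis)
  case 0
  then show ?case using aff_subset[OF 0(4)] by auto
next
  case (Suc n)
  then obtain S1 where S1: "layer D W S S1" "reach D W n S1 A" by auto
  obtain Z1 where "hidden W (Suc j) Z1" "S1 \<subseteq> aff D ((\<lambda>i x. Z1 x i) ` {1..W})"
    using layer_imp_hidden_step[OF Suc.prems(3,4) S1(1)] by blast
  then show ?case using Suc.IH[OF _ S1(2)] Suc.prems(1) by (metis add_Suc add_Suc_right)
qed

lemma hidden_imp_network:
  fixes Z :: "real^'d \<Rightarrow> nat \<Rightarrow> real"
  assumes "hidden W L Z" "1 \<le> W"
  shows "(\<lambda>x. (\<Sum>m=1..W. w m * Z x m) + \<beta>) \<in> relu_networks L (\<lambda>_. W)"
proof -
  have "1 \<le> L \<and> (\<exists>(V :: nat \<Rightarrow> 'd \<Rightarrow> real) A (b :: nat \<Rightarrow> nat \<Rightarrow> real) a c z.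
          (\<forall>x. \<forall>i\<in>{1..W}. z 1 x i = activation (a 1 i) (c 1 i) ((\<Sum>m\<in>UNIV. V i m * x $ m) + b 1 i)) \<and>
          (\<forall>x. \<forall>j\<in>{2..L}. \<forall>i\<in>{1..W}. z j x i = activation (a j i) (c j i)
               ((\<Sum>m=1..W. A j i m * z (j - 1) x m) + b j i)) \<and> z L = Z)"
    using assms(1)
  proof induction
    case (hidden_first a c V b)
    show ?case
      by (rule conjI, simp, rule exI[of _ V], rule exI[of _ "\<lambda>_ _ _. 0"], rule exI[of _ "\<lambda>_. b"],
          rule exI[of _ "\<lambda>_. a"], rule exI[of _ "\<lambda>_. c"],
          rule exI[of _ "\<lambda>_ x i. activation (a i) (c i) ((\<Sum>m\<in>UNIV. V i m * x $ m) + b i)"]) auto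
  next
    case (hidden_step j Z a' c' A' b')
    then obtain V :: "nat \<Rightarrow> 'd \<Rightarrow> real" and A and b :: "nat \<Rightarrow> nat \<Rightarrow> real" and a c z where
      1: "\<forall>x. \<forall>i\<in>{1..W}. z 1 x i = activation (a 1 i) (c 1 i) ((\<Sum>m\<in>UNIV. V i m * x $ m) + b 1 i)" and
      2: "\<forall>x. \<forall>j'\<in>{2..j}. \<forall>i\<in>{1..W}. z j' x i = activation (a j' i) (c j' i)
               ((\<Sum>m=1..W. A j' i m * z (j' - 1) x m) + b j' i)" and 3: "z j = Z"
      and 4: "1 \<le> j"
      by blast
    let ?Z = "\<lambda>x i. activation (a' i) (c' i) ((\<Sum>m=1..W. A' i m * Z x m) + b' i)"
    define z' where "z' = z(Suc j := ?Z)"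
    define A'' where "A'' = A(Suc j := A')"
    define b'' where "b'' = b(Suc j := b')"
    define a'' where "a'' = a(Suc j := a')"
    define c'' where "c'' = c(Suc j := c')"
    have "\<forall>x. \<forall>i\<in>{1..W}. z' 1 x i = activation (a'' 1 i) (c'' 1 i) ((\<Sum>m\<in>UNIV. V i m * x $ m) + b'' 1 i)"
      using 1 4 by (auto simp: z'_def a''_def c''_def b''_def)
    moreover have "z' j' x i = activation (a'' j' i) (c'' j' i)
               ((\<Sum>m=1..W. A'' j' i m * z' (j' - 1) x m) + b'' j' i)"
      if "j' \<in> {2..Suc j}" "i \<in> {1..W}" for x j' i
    proof (cases "j' = Suc j")
      case True
      then show ?thesis using 3 4 by (auto simp: z'_def a''_def c''_def b''_def A''_def)
    next
      case False
      then show ?thesis using 2 that by (auto simp: z'_def a''_def c''_def b''_def A''_def)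
    qed
    moreover have "z' (Suc j) = ?Z" by (simp add: z'_def)
    ultimately show ?case by (intro conjI) (simp, blast)
  qed
  then show ?thesis using assms(2) unfolding relu_networks_def by blast
qed

lemma reach_imp_network:
  assumes "reach D W L coords A" "f \<in> A" "1 \<le> W" "1 \<le> L"
  obtains u where "u \<in> relu_networks L (\<lambda>_. W)" "\<And>x. x \<in> D \<Longrightarrow> u x = f x"
proof -
  obtain n where L: "L = Suc n" using assms(4) by (cases L) auto
  then obtain S1 where S1: "layer D W coords S1" "reach D W n S1 A" using assms(1) by auto
  obtain Z1 where "hidden W 1 Z1" "S1 \<subseteq> aff D ((\<lambda>i x. Z1 x i) ` {1..W})"
    using layer_imp_hidden_first[OF S1(1)] by blast
  from reach_imp_hidden[OF S1(2) this] obtain Z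
    where Z: "hidden W L Z" "A \<subseteq> aff D ((\<lambda>i x. Z x i) ` {1..W})" by (auto simp: L)
  then obtain w \<beta> where "\<And>x. x \<in> D \<Longrightarrow> f x = (\<Sum>m=1..W. w m * Z x m) + \<beta>"
    using aff_imageE[of f D "\<lambda>i x. Z x i" "{1..W}"] assms(2) by blast
  then show ?thesis using that[OF hidden_imp_network[OF Z(1) assms(3), of w \<beta>]] by simp
qed

lemma bdd_coords:
  fixes D :: "(real^'d) set"
  assumes "bounded D"
  shows "bdd_funs D coords"
proof -
  obtain B where "\<forall>x\<in>D. norm x \<le> B" using assms by (auto simp: bounded_iff)
  then show ?thesis
    unfolding bdd_funs_def by (auto intro: order_trans[OF component_le_norm_cart])
qed

lemma reach_sum:
  fixes D :: "(real^'d) set"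
  assumes "bounded D" "finite I" "\<And>i. i \<in> I \<Longrightarrow> reach D W (n i) coords {f i}"
  shows "reach D (W + CARD('d) + 1) (sum n I) coords (insert (\<lambda>x. \<Sum>i\<in>I. f i x) coords)"
  using assms(2,3)
proof (induction I)
  case empty
  then show ?case by (auto intro: aff_const aff_base)
next
  case (insert i I)
  let ?F = "\<lambda>x. \<Sum>i\<in>I. f i x"
  have r: "reach D (W + CARD('d) + 1) (sum n I) coords (insert ?F coords)"
    using insert by auto
  have fin: "finite (coords :: (real^'d \<Rightarrow> real) set)" by simp
  have "reach D (card (insert ?F coords)) (n i) (insert ?F coords) (insert ?F coords)"
    by (rule reach_ids[OF reach_bdd[OF r bdd_coords[OF assms(1)]]]) simp
  from reach_Un[OF insert.prems[OF insertI1] this]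
  have "reach D (W + card (insert ?F coords)) (n i) (coords \<union> insert ?F coords) ({f i} \<union> insert ?F coords)" .
  moreover have "card (insert ?F coords) \<le> CARD('d) + 1"
    using card_image_le[of UNIV "\<lambda>i (x::real^'d). x $ i"] card_insert_le_m1[of "CARD('d) + 1" coords ?F] by simp
  \<comment> \<open>Adding the new term to the running sum costs no layer: it is affine in the
    outputs of the block and of the bypass neurons.\<close>
  ultimately have "reach D (W + CARD('d) + 1) (n i) (insert ?F coords)
      (insert (\<lambda>x. f i x + ?F x) coords)"
    by (elim reach_mono) (auto intro: aff_base aff_add)
  from reach_trans[OF r this] show ?case
    using insert by (simp add: add.commute)
qed

section \<open>Local convexity\<close>

text \<open>Being joined by a chain with steps at most \<open>e\<close> is an equivalence relation
  with open classes, so a connected set has only one class.\<close>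

lemma connected_chain:
  fixes S :: "'a::metric_space set"
  assumes "connected S" "a \<in> S" "b \<in> S" "0 < e"
  obtains N f where "f 0 = a" "f N = b" "\<forall>i. f i \<in> S" "\<forall>i<N. dist (f i) (f (Suc i)) \<le> e" "\<forall>i\<ge>N. f i = b"
proof -
  let ?R = "{(x, y). x \<in> S \<and> y \<in> S \<and> dist x y \<le> e}"
  have "sym ?R" by (auto simp: sym_def dist_commute)
  then have "sym (?R\<^sup>*)" by (rule sym_rtrancl)
  have "(a, b) \<in> ?R\<^sup>*"
  proof (rule connected_equivalence_relation[OF assms(1-3), of "\<lambda>x y. (x, y) \<in> ?R\<^sup>*"])
    fix x assume x: "x \<in> S"
    show "\<exists>T. openin (top_of_set S) T \<and> x \<in> T \<and> (\<forall>y\<in>T. (x, y) \<in> ?R\<^sup>*)"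
    proof (intro exI conjI ballI)
      show "openin (top_of_set S) (S \<inter> ball x e)" by (simp add: openin_open_Int)
      show "x \<in> S \<inter> ball x e" using x assms(4) by simp
      fix y assume "y \<in> S \<inter> ball x e"
      then show "(x, y) \<in> ?R\<^sup>*" using x by (intro r_into_rtrancl) auto
    qed
  qed (use \<open>sym (?R\<^sup>*)\<close> in \<open>auto dest: symD rtrancl_trans\<close>)
  then obtain N f where f: "f 0 = a" "f N = b" "\<forall>i<N. (f i, f (Suc i)) \<in> ?R"
    by (auto dest!: rtrancl_imp_relpow simp: relpow_fun_conv)
  \<comment> \<open>Continuing constantly after \<open>N\<close> turns the finite chain into a point
    of an infinite product of copies of \<open>S\<close>, the setting of the compactness argument
    that follows.\<close>
  let ?f = "\<lambda>i. if i < N then f i else b"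
  show ?thesis
  proof (rule that[of ?f N])
    show "\<forall>i<N. dist (?f i) (?f (Suc i)) \<le> e"
    proof (intro allI impI)
      fix i assume "i < N"
      then have "dist (f i) (f (Suc i)) \<le> e" "Suc i < N \<or> Suc i = N" using f(3) by auto
      then show "dist (?f i) (?f (Suc i)) \<le> e" using f(2) \<open>i < N\<close> by auto
    qed
  qed (use f assms(3) in auto)
qed

text \<open>Discretised geodesics: a chain of minimal energy from \<open>a\<close> to \<open>b\<close> has equidistant, collinear
  points, since otherwise a point could be replaced by the midpoint of its neighbours.\<close>

theorem locally_convex_imp_convex:
  fixes S :: "'a::euclidean_space set"
  assumes "compact S" "connected S" "0 < e"
    and loc: "\<And>x y. x \<in> S \<Longrightarrow> y \<in> S \<Longrightarrow> dist x y \<le> 2 * e \<Longrightarrow> closed_segment x y \<subseteq> S"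
  shows "convex S"
  unfolding convex_contains_segment
proof (intro ballI)
  fix a b assume ab: "a \<in> S" "b \<in> S"
  obtain N f0 where f0: "f0 0 = a" "f0 N = b" "\<forall>i. f0 i \<in> S" "\<forall>i<N. dist (f0 i) (f0 (Suc i)) \<le> e"
    "\<forall>i\<ge>N. f0 i = b"
    using connected_chain[OF assms(2) ab assms(3)] by metis
  define K where "K = {f. f 0 = a \<and> f N = b \<and> (\<forall>i. f i \<in> S) \<and> (\<forall>i<N. dist (f i) (f (Suc i)) \<le> e)}"
  define E :: "(nat \<Rightarrow> 'a) \<Rightarrow> real" where "E f = (\<Sum>i<N. (dist (f i) (f (Suc i)))\<^sup>2)" for f
  have cc: "continuous_on UNIV (\<lambda>f :: nat \<Rightarrow> 'a. f i)" for i by simp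
  \<comment> \<open>By Tychonoff the admissible chains are a closed subset of a compact product, so
    the energy attains its minimum.\<close>
  have "compactin (product_topology (\<lambda>_::nat. euclidean) UNIV) (PiE UNIV (\<lambda>_. S))"
    using assms(1) by (simp add: compactin_PiE)
  then have cS: "compact (PiE UNIV (\<lambda>_::nat. S))" by (simp add: euclidean_product_topology)
  have "closed {f :: nat \<Rightarrow> 'a. f 0 = a}" "closed {f :: nat \<Rightarrow> 'a. f N = b}"
    by (intro closed_Collect_eq cc continuous_on_const)+
  moreover have "closed {f :: nat \<Rightarrow> 'a. \<forall>i<N. dist (f i) (f (Suc i)) \<le> e}"
    by (intro closed_Collect_all closed_Collect_imp open_Collect_const closed_Collect_le continuous_on_dist cc continuous_on_const) 
  ultimately have "closed ({f :: nat \<Rightarrow> 'a. f 0 = a} \<inter> {f. f N = b} \<inter> {f. \<forall>i<N. dist (f i) (f (Suc i)) \<le> e})"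
    by (intro closed_Int)
  moreover have "K = PiE UNIV (\<lambda>_. S) \<inter> ({f :: nat \<Rightarrow> 'a. f 0 = a} \<inter> {f. f N = b} \<inter> {f. \<forall>i<N. dist (f i) (f (Suc i)) \<le> e})"
    by (auto simp: K_def PiE_def)
  ultimately have "compact K" using cS by (simp add: compact_Int_closed)
  moreover have "f0 \<in> K" using f0 by (auto simp: K_def)
  moreover have "continuous_on K E"
    unfolding E_def using continuous_on_subset[OF cc subset_UNIV]
    by (intro continuous_on_sum continuous_on_power continuous_on_dist) auto
  ultimately obtain f where f: "f \<in> K" and min: "\<And>g. g \<in> K \<Longrightarrow> E f \<le> E g"
    using continuous_attains_inf[of K E] by auto
  have mid: "f (Suc i) = midpoint (f i) (f (Suc (Suc i)))" if i: "Suc i < N" for i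
  proof -
    let ?p = "f i" and ?q = "f (Suc i)" and ?r = "f (Suc (Suc i))"
    let ?m = "midpoint ?p ?r"
    have pr: "?p \<in> S" "?r \<in> S" "dist ?p ?q \<le> e" "dist ?q ?r \<le> e" using f i by (auto simp: K_def)
    \<comment> \<open>Local convexity on the scale \<open>2 * e\<close> covers the two neighbours of
      a chain point. The steps to their midpoint are again at most \<open>e\<close>, so the modified
      chain stays admissible.\<close>
    then have "dist ?p ?r \<le> 2 * e" using dist_triangle[of ?p ?r ?q] by linarith
    then have m: "?m \<in> S" using loc[OF pr(1,2)] midpoint_in_closed_segment by blast
    define g where "g = f(Suc i := ?m)"
    have dm: "dist ?p ?m = dist ?p ?r / 2" "dist ?m ?r = dist ?p ?r / 2"
      by (simp_all add: dist_midpoint)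
    have "g \<in> K"
      unfolding K_def
    proof (intro CollectI conjI allI impI)
      show "g 0 = a" "g N = b" "g j \<in> S" for j using f i m by (auto simp: g_def K_def)
      fix j assume "j < N"
      then show "dist (g j) (g (Suc j)) \<le> e"
        using f dm \<open>dist ?p ?r \<le> 2 * e\<close> by (cases "j = i \<or> j = Suc i") (auto simp: g_def K_def)
    qed
    then have "E f \<le> E g" by (rule min)
    have split: "E h = (dist (h i) (h (Suc i)))\<^sup>2 + (dist (h (Suc i)) (h (Suc (Suc i))))\<^sup>2
       + (\<Sum>j\<in>{..<N} - {i, Suc i}. (dist (h j) (h (Suc j)))\<^sup>2)" for h
    proof -
      have "E h = (\<Sum>j\<in>{i, Suc i}. (dist (h j) (h (Suc j)))\<^sup>2) + (\<Sum>j\<in>{..<N} - {i, Suc i}. (dist (h j) (h (Suc j)))\<^sup>2)"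
        unfolding E_def using i by (subst add.commute, intro sum.subset_diff) auto
      then show ?thesis by simp
    qed
    have "(\<Sum>j\<in>{..<N} - {i, Suc i}. (dist (g j) (g (Suc j)))\<^sup>2) = (\<Sum>j\<in>{..<N} - {i, Suc i}. (dist (f j) (f (Suc j)))\<^sup>2)"
      by (rule sum.cong) (auto simp: g_def)
    then have "(dist ?p ?q)\<^sup>2 + (dist ?q ?r)\<^sup>2 \<le> (dist ?p ?m)\<^sup>2 + (dist ?m ?r)\<^sup>2"
      using \<open>E f \<le> E g\<close> split[of f] split[of g] by (simp add: g_def)
    also have "\<dots> = (dist ?p ?r)\<^sup>2 / 2" unfolding dm by (simp add: power_divide)
    \<comment> \<open>Parallelogram law: the squares of the two old steps sum to half the square of
      \<open>?r - ?p\<close> plus half the square of the difference of the steps.\<close>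
    finally have "(norm (?q - ?p - (?r - ?q)))\<^sup>2 \<le> 0"
      unfolding dist_norm power2_norm_eq_inner by (simp add: inner_commute algebra_simps)
    then have "?q - ?p = ?r - ?q" by simp
    then have "2 *\<^sub>R ?q = ?p + ?r" by (simp add: scaleR_2 algebra_simps)
    then show ?thesis by (metis midpoint_eq_iff scaleR_2)
  qed
  define d where "d = f 1 - a"
  have ap: "f i = a + real i *\<^sub>R d \<and> (i < N \<longrightarrow> f (Suc i) = a + real (Suc i) *\<^sub>R d)" if "i \<le> N" for i
    using that
  proof (induction i)
    case 0
    then show ?case using f by (auto simp: K_def d_def)
  next
    case (Suc i)
    then have IH: "f i = a + real i *\<^sub>R d" "f (Suc i) = a + real (Suc i) *\<^sub>R d" by auto
    have "f (Suc (Suc i)) = a + real (Suc (Suc i)) *\<^sub>R d" if "Suc i < N"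
    proof -
      have "f (Suc (Suc i)) = f (Suc i) + f (Suc i) - f i"
        using mid[OF that] by (metis midpoint_eq_iff add_diff_cancel_left')
      then show ?thesis using IH by (simp add: algebra_simps scaleR_2)
    qed
    then show ?case using IH(2) by auto
  qed
  show "closed_segment a b \<subseteq> S"
  proof
    fix x assume "x \<in> closed_segment a b"
    then obtain t where t: "0 \<le> t" "t \<le> 1" "x = (1 - t) *\<^sub>R a + t *\<^sub>R b" by (auto simp: in_segment)
    show "x \<in> S"
    \<comment> \<open>Split off because the floor taken in the other case would give
      \<open>N\<close>, which is past the last edge; this covers t = 1 and also the chain without
      edges.\<close>
    proof (cases "t * N = N")
      case True
      show ?thesis
      proof (cases "N = 0")
        case True
        then have "a = b" using f by (auto simp: K_def)
        then show ?thesis using t ab by (simp flip: scaleR_left_distrib)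
      next
        case False
        then have "t = 1" using True by simp
        then show ?thesis using t ab by simp
      qed
    next
      case False
      have "t * real N \<le> 1 * real N" by (rule mult_right_mono) (use t in auto)
      then have tN: "t * N < N" using False by simp
      define i where "i = nat \<lfloor>t * N\<rfloor>"
      have i: "real i \<le> t * N" "t * N < real i + 1" using t(1) by (auto simp: i_def)
      then have "i < N" using tN by linarith
      have "b = a + real N *\<^sub>R d" using ap[of N] f by (simp add: K_def)
      then have x: "x = a + (t * N) *\<^sub>R d" using t(3) by (simp add: algebra_simps)
      have fi: "f i = a + real i *\<^sub>R d" "f (Suc i) = a + real (Suc i) *\<^sub>R d" using ap[of i] \<open>i < N\<close> by auto
      have "x = (1 - (t * N - i)) *\<^sub>R f i + (t * N - i) *\<^sub>R f (Suc i)"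
        unfolding x fi by (simp add: algebra_simps)
      then have "x \<in> closed_segment (f i) (f (Suc i))"
        using i unfolding in_segment by (intro exI[of _ "t * N - i"]) auto
      moreover have "closed_segment (f i) (f (Suc i)) \<subseteq> S"
      proof (rule loc)
        have "dist (f i) (f (Suc i)) \<le> e" using f \<open>i < N\<close> by (auto simp: K_def)
        then show "dist (f i) (f (Suc i)) \<le> 2 * e" using assms(3) by linarith
      qed (use f in \<open>auto simp: K_def\<close>)
      ultimately show ?thesis by blast
    qed
  qed
qed

section \<open>Barycentric coordinates on a mesh\<close>

text \<open>A whole weight function is chosen, forced to be 0 off \<open>V\<close>, so that affine
  independence determines it for every \<open>v\<close>. No sign is imposed: this is the affine
  extension of the coordinate to the whole space.\<close>

definition bary :: "(real^'d) set \<Rightarrow> real^'d \<Rightarrow> real^'d \<Rightarrow> real" where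
  "bary V v x = (SOME u. (\<forall>w. w \<notin> V \<longrightarrow> u w = 0) \<and> sum u V = 1 \<and> (\<Sum>w\<in>V. u w *\<^sub>R w) = x) v"

lemma ex_affine_combination:
  assumes "finite V" "affine hull V = UNIV"
  shows "\<exists>u. (\<forall>w. w \<notin> V \<longrightarrow> u w = 0) \<and> sum u V = 1 \<and> (\<Sum>w\<in>V. u w *\<^sub>R w) = (x :: real^'d)"
proof -
  obtain u where u: "sum u V = 1" "(\<Sum>w\<in>V. u w *\<^sub>R w) = x"
    using assms by (auto simp: affine_hull_finite)
  have "sum (\<lambda>w. if w \<in> V then u w else 0) V = 1"
    "(\<Sum>w\<in>V. (if w \<in> V then u w else 0) *\<^sub>R w) = x"
    using u by (simp_all cong: sum.cong)
  then show ?thesis by (intro exI[of _ "\<lambda>w. if w \<in> V then u w else 0"]) auto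
qed

locale affine_frame =
  fixes V :: "(real^'d) set"
  assumes indep: "\<not> affine_dependent V" and hull: "affine hull V = UNIV"
begin

lemma fin: "finite V"
  using indep aff_independent_finite by blast

lemma bary_outside: "v \<notin> V \<Longrightarrow> bary V v x = 0"
  and sum_bary: "(\<Sum>v\<in>V. bary V v x) = 1"
  and bary_combination: "(\<Sum>v\<in>V. bary V v x *\<^sub>R v) = x"
  unfolding bary_def using someI_ex[OF ex_affine_combination[OF fin hull, of x]] by auto

lemma bary_unique:
  assumes "\<And>w. w \<notin> V \<Longrightarrow> u w = 0" "sum u V = 1" "(\<Sum>w\<in>V. u w *\<^sub>R w) = x"
  shows "bary V v x = u v"
proof (rule ccontr)
  assume ne: "bary V v x \<noteq> u v"
  then have "v \<in> V" using bary_outside assms(1) by metis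
  moreover have "(\<Sum>w\<in>V. bary V w x - u w) = 0"
    using sum_bary assms(2) by (simp add: sum_subtractf)
  moreover have "(\<Sum>w\<in>V. (bary V w x - u w) *\<^sub>R w) = 0"
    using bary_combination assms(3) by (simp add: scaleR_left_diff_distrib sum_subtractf)
  ultimately have "affine_dependent V"
    using ne unfolding affine_dependent_explicit_finite[OF fin]
    by (intro exI[of _ "\<lambda>w. bary V w x - u w"]) auto
  then show False using indep by blast
qed

text \<open>Averaging the weights of the points \<open>p i\<close> produces admissible weights for
  the averaged point, and weights are unique.\<close>

lemma bary_affine_sum:
  assumes "finite I" "sum c I = 1"
  shows "bary V v (\<Sum>i\<in>I. c i *\<^sub>R p i) = (\<Sum>i\<in>I. c i * bary V v (p i))"
proof (rule bary_unique)
  show "(\<Sum>i\<in>I. c i * bary V w (p i)) = 0" if "w \<notin> V" for w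
    using that by (simp add: bary_outside)
  have "(\<Sum>w\<in>V. \<Sum>i\<in>I. c i * bary V w (p i)) = (\<Sum>i\<in>I. c i * (\<Sum>w\<in>V. bary V w (p i)))"
    by (subst sum.swap) (simp add: sum_distrib_left)
  then show "(\<Sum>w\<in>V. \<Sum>i\<in>I. c i * bary V w (p i)) = 1"
    using assms(2) by (simp add: sum_bary)
  have "(\<Sum>w\<in>V. (\<Sum>i\<in>I. c i * bary V w (p i)) *\<^sub>R w) = (\<Sum>i\<in>I. c i *\<^sub>R (\<Sum>w\<in>V. bary V w (p i) *\<^sub>R w))"
    by (simp add: scaleR_sum_left scaleR_sum_right) (rule sum.swap)
  then show "(\<Sum>w\<in>V. (\<Sum>i\<in>I. c i * bary V w (p i)) *\<^sub>R w) = (\<Sum>i\<in>I. c i *\<^sub>R p i)"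
    by (simp add: bary_combination)
qed

lemma bary_line: "bary V v (x + t *\<^sub>R (y - x)) = bary V v x + t * (bary V v y - bary V v x)"
  using bary_affine_sum[of "{True, False}" "\<lambda>b. if b then t else 1 - t" v "\<lambda>b. if b then y else x"]
  by (simp add: algebra_simps)

lemma bary_vertex: "w \<in> V \<Longrightarrow> bary V v w = (if v = w then 1 else 0)"
  by (rule bary_unique) (auto simp: fin if_distrib[of "\<lambda>t. t *\<^sub>R _"] cong: if_cong)

lemma bary_coords: "bary V v x = bary V v 0 + (\<Sum>i\<in>UNIV. x $ i * (bary V v (axis i 1) - bary V v 0))"
proof -
  \<comment> \<open>A point is an affine combination of the origin and the unit vectors; the index
    \<open>None\<close> stands for the origin, which takes the remaining weight.\<close>
  define c where "c = case_option (1 - (\<Sum>i\<in>UNIV. x $ i)) (\<lambda>i. x $ i)"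
  define p :: "'d option \<Rightarrow> real^'d" where "p = case_option 0 (\<lambda>i. axis i 1)"
  have split: "sum g UNIV = g None + (\<Sum>i\<in>UNIV. g (Some i))" for g :: "'d option \<Rightarrow> 'b::comm_monoid_add"
    by (simp add: UNIV_option_conv sum.reindex)
  have "(\<Sum>i\<in>UNIV. (x $ i) *\<^sub>R axis i 1) = x"
    using basis_expansion[of x] by (simp add: scalar_mult_eq_scaleR)
  then have "(\<Sum>i\<in>UNIV. c i *\<^sub>R p i) = x"
    by (simp add: split c_def p_def)
  moreover have "sum c UNIV = 1" by (simp add: split c_def)
  ultimately have "bary V v x = (\<Sum>i\<in>UNIV. c i * bary V v (p i))"
    using bary_affine_sum[of UNIV c v p] by simp
  also have "\<dots> = (1 - (\<Sum>i\<in>UNIV. x $ i)) * bary V v 0 + (\<Sum>i\<in>UNIV. x $ i * bary V v (axis i 1))"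
    by (simp add: split c_def p_def)
  also have "\<dots> = bary V v 0 + (\<Sum>i\<in>UNIV. x $ i * (bary V v (axis i 1) - bary V v 0))"
    by (simp add: left_diff_distrib right_diff_distrib sum_subtractf sum_distrib_right)
  finally show ?thesis .
qed

lemma bary_aff_coords: "bary V v \<in> aff D coords"
proof -
  have "(\<lambda>x. bary V v 0 + (\<Sum>i\<in>UNIV. (bary V v (axis i 1) - bary V v 0) * x $ i)) \<in> aff D coords"
    by (intro aff_add aff_const aff_sum aff_scale aff_base) auto
  then show ?thesis
    by (rule aff_cong) (subst bary_coords, simp add: mult.commute)
qed

lemma continuous_bary: "continuous_on S (bary V v)"
proof -
  have "continuous_on S (\<lambda>x. bary V v 0 + (\<Sum>i\<in>UNIV. x $ i * (bary V v (axis i 1) - bary V v 0)))"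
    by (intro continuous_intros)
  moreover have "bary V v = (\<lambda>x. bary V v 0 + (\<Sum>i\<in>UNIV. x $ i * (bary V v (axis i 1) - bary V v 0)))"
    by (rule ext) (rule bary_coords)
  ultimately show ?thesis by argo
qed

lemma in_hull_iff:
  assumes "C \<subseteq> V"
  shows "x \<in> convex hull C \<longleftrightarrow> (\<forall>v. bary V v x \<ge> 0) \<and> (\<forall>v. v \<notin> C \<longrightarrow> bary V v x = 0)"
proof
  have finC: "finite C" using assms fin finite_subset by blast
  {
    assume "x \<in> convex hull C"
    then obtain u where u: "\<forall>w\<in>C. 0 \<le> u w" "sum u C = 1" "(\<Sum>w\<in>C. u w *\<^sub>R w) = x"
      using finC by (auto simp: convex_hull_finite)
    have "bary V v x = (if v \<in> C then u v else 0)" for v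
    proof (rule bary_unique)
      show "(\<Sum>w\<in>V. (if w \<in> C then u w else 0)) = 1"
        using u(2) assms fin by (simp add: sum.If_cases Int_absorb1)
      have "(\<Sum>w\<in>V. (if w \<in> C then u w else 0) *\<^sub>R w) = (\<Sum>w\<in>V. if w \<in> C then u w *\<^sub>R w else 0)"
        by (rule sum.cong) auto
      then show "(\<Sum>w\<in>V. (if w \<in> C then u w else 0) *\<^sub>R w) = x"
        using u(3) assms fin by (simp add: sum.If_cases Int_absorb1)
    qed (use assms in auto)
    then show "(\<forall>v. bary V v x \<ge> 0) \<and> (\<forall>v. v \<notin> C \<longrightarrow> bary V v x = 0)"
      using u(1) by auto
  }
  assume b: "(\<forall>v. bary V v x \<ge> 0) \<and> (\<forall>v. v \<notin> C \<longrightarrow> bary V v x = 0)"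
  have "(\<Sum>v\<in>C. bary V v x) = (\<Sum>v\<in>V. bary V v x)"
    "(\<Sum>v\<in>C. bary V v x *\<^sub>R v) = (\<Sum>v\<in>V. bary V v x *\<^sub>R v)"
    by (intro sum.mono_neutral_left; use fin assms b in auto)+
  then show "x \<in> convex hull C"
    using b sum_bary bary_combination finC by (auto simp: convex_hull_finite)
qed

end

section \<open>Compatibility of the coordinates across cells\<close>

lemma simplex_frame:
  assumes "int CARD('d) simplex (T :: (real^'d) set)"
  shows "affine_frame (vertices T)" "T = convex hull (vertices T)" "card (vertices T) = CARD('d) + 1"
proof -
  obtain C where C: "finite C" "\<not> affine_dependent C" "int (card C) = int CARD('d) + 1" "T = convex hull C"
    using assms by (auto simp: simplex)
  have v: "vertices T = C"
    using C(2,4) extreme_point_of_convex_hull_affine_independent by (auto simp: vertices_def)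
  have "aff_dim C = int DIM(real^'d)" using aff_dim_affine_independent[OF C(2)] C(3) by simp
  then have "affine hull C = UNIV" by (simp only: aff_dim_eq_full)
  then show "affine_frame (vertices T)" using C(2) by (simp add: affine_frame_def v)
  show "T = convex hull (vertices T)" "card (vertices T) = CARD('d) + 1" using C v by auto
qed

locale mesh =
  fixes \<T> :: "(real^'d) set set"
  assumes tri: "triangulation \<T>" and full_dim: "\<And>T. T \<in> \<T> \<Longrightarrow> int CARD('d) simplex T"
begin

abbreviation bc :: "(real^'d) set \<Rightarrow> real^'d \<Rightarrow> real^'d \<Rightarrow> real" where
  "bc T \<equiv> bary (vertices T)"

lemma finite_mesh: "finite \<T>"
  using tri by (simp add: triangulation_def)

lemma frame: "T \<in> \<T> \<Longrightarrow> affine_frame (vertices T)"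
  and hull_vertices: "T \<in> \<T> \<Longrightarrow> convex hull (vertices T) = T"
  and card_vertices: "T \<in> \<T> \<Longrightarrow> card (vertices T) = CARD('d) + 1"
  using simplex_frame full_dim by blast+

lemma finite_vertices: "T \<in> \<T> \<Longrightarrow> finite (vertices T)"
  using affine_frame.fin frame by blast

lemma vertices_nonempty: "T \<in> \<T> \<Longrightarrow> vertices T \<noteq> {}"
  using card_vertices by fastforce

lemma closed_cell: "T \<in> \<T> \<Longrightarrow> closed T"
  and compact_cell: "T \<in> \<T> \<Longrightarrow> compact T"
  using hull_vertices finite_vertices by (metis compact_imp_closed finite_imp_compact_convex_hull)+

lemma compact_mesh: "compact (\<Union>\<T>)"
  using finite_mesh compact_cell by blast

lemma in_cell_iff: "T \<in> \<T> \<Longrightarrow> x \<in> T \<longleftrightarrow> (\<forall>v. bc T v x \<ge> 0)"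
  using affine_frame.in_hull_iff[OF frame, of T "vertices T" x] hull_vertices[of T]
    affine_frame.bary_outside[OF frame] by auto

lemma vertices_inj: "T \<in> \<T> \<Longrightarrow> T' \<in> \<T> \<Longrightarrow> vertices T \<subseteq> vertices T' \<Longrightarrow> T = T'"
  using card_vertices finite_vertices hull_vertices by (metis card_subset_eq)

text \<open>The intersection is a face of both cells, hence the hull of vertices of \<open>T\<close>
  and also of vertices of \<open>T'\<close>. By affine independence both sets are its extreme
  points, so they coincide.\<close>

lemma cell_Int:
  assumes "T \<in> \<T>" "T' \<in> \<T>"
  shows "T \<inter> T' = convex hull (vertices T \<inter> vertices T')"
proof -
  have sub: "\<exists>C\<subseteq>vertices T. T \<inter> T' = convex hull C" if "T \<in> \<T>" "T' \<in> \<T>" for T T'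
  proof -
    have "(T \<inter> T') face_of convex hull (vertices T)"
      using tri that hull_vertices[OF that(1)] by (simp add: triangulation_def)
    then show ?thesis
      using face_of_convex_hull_affine_independent[OF affine_frame.indep[OF frame[OF that(1)]]] by blast
  qed
  obtain C where C: "C \<subseteq> vertices T" "T \<inter> T' = convex hull C" using sub assms by blast
  obtain C' where C': "C' \<subseteq> vertices T'" "T \<inter> T' = convex hull C'"
    using sub assms by (metis Int_commute)
  have "\<not> affine_dependent C" "\<not> affine_dependent C'"
    using C(1) C'(1) affine_frame.indep frame assms affine_independent_subset by metis+
  then have "C = C'"
    using C(2) C'(2) extreme_point_of_convex_hull_affine_independent by (metis subsetI subset_antisym)
  then have "T \<inter> T' \<subseteq> convex hull (vertices T \<inter> vertices T')"
    using C C' by (metis hull_mono Int_subset_iff)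
  moreover have "convex hull (vertices T \<inter> vertices T') \<subseteq> T \<inter> T'"
    using hull_vertices assms by (metis Int_lower1 Int_lower2 Int_subset_iff hull_mono)
  ultimately show ?thesis by blast
qed

text \<open>On the common face the weights with respect to \<open>T\<close> live on the shared
  vertices, so they are admissible weights for \<open>T'\<close> as well.\<close>

lemma bc_eq:
  assumes "T \<in> \<T>" "T' \<in> \<T>" "x \<in> T" "x \<in> T'"
  shows "bc T v x = bc T' v x"
proof -
  interpret A: affine_frame "vertices T" using frame assms by blast
  interpret B: affine_frame "vertices T'" using frame assms by blast
  let ?C = "vertices T \<inter> vertices T'"
  have "x \<in> convex hull ?C" using cell_Int assms by blast
  then have z: "bc T w x = 0" if "w \<notin> ?C" for w using A.in_hull_iff[of ?C x] that by auto
  have "bc T' v x = bc T v x"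
  proof (rule B.bary_unique)
    show "bc T w x = 0" if "w \<notin> vertices T'" for w using z that by blast
    have "(\<Sum>w\<in>vertices T'. bc T w x) = (\<Sum>w\<in>?C. bc T w x)"
      "(\<Sum>w\<in>vertices T'. bc T w x *\<^sub>R w) = (\<Sum>w\<in>?C. bc T w x *\<^sub>R w)"
      by (intro sum.mono_neutral_right; use z B.fin in auto)+
    moreover have "(\<Sum>w\<in>vertices T. bc T w x) = (\<Sum>w\<in>?C. bc T w x)"
      "(\<Sum>w\<in>vertices T. bc T w x *\<^sub>R w) = (\<Sum>w\<in>?C. bc T w x *\<^sub>R w)"
      by (intro sum.mono_neutral_right; use z A.fin in auto)+
    ultimately show "(\<Sum>w\<in>vertices T'. bc T w x) = 1" "(\<Sum>w\<in>vertices T'. bc T w x *\<^sub>R w) = x"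
      using A.sum_bary A.bary_combination by simp_all
  qed
  then show ?thesis by simp
qed

lemma bc_pos_vertex: "T \<in> \<T> \<Longrightarrow> bc T v x > 0 \<Longrightarrow> v \<in> vertices T"
  using affine_frame.bary_outside[OF frame] by fastforce

lemma vertices_subset: "T \<in> \<T> \<Longrightarrow> vertices T \<subseteq> T"
  using hull_vertices hull_subset by metis

lemma vertex_in_cell:
  assumes "T \<in> \<T>" "v \<in> vertices T" "T' \<in> \<T>"
  shows "v \<in> T' \<longleftrightarrow> v \<in> vertices T'"
  using assms bc_eq[of T T' v v] affine_frame.bary_vertex[OF frame, of T v v] bc_pos_vertex[of T' v v]
    vertices_subset by (metis subsetD zero_less_one)

text \<open>By \<open>bc_eq\<close> the choice of the cell does not matter on the mesh; off the mesh
  the value is arbitrary.\<close>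

definition hat :: "real^'d \<Rightarrow> real^'d \<Rightarrow> real" where
  "hat v x = bc (SOME T. T \<in> \<T> \<and> x \<in> T) v x"

lemma hat_eq: "T \<in> \<T> \<Longrightarrow> x \<in> T \<Longrightarrow> hat v x = bc T v x"
  unfolding hat_def by (rule bc_eq) (metis (mono_tags, lifting) someI)+

lemma hat_nonneg: "x \<in> \<Union>\<T> \<Longrightarrow> hat v x \<ge> 0"
  using hat_eq in_cell_iff by fastforce

text \<open>The finitely many cells that miss \<open>x\<close> have a closed union, so some ball
  around \<open>x\<close> avoids it.\<close>

lemma local_cells:
  obtains e where "0 < e" "\<And>y T. dist y x < e \<Longrightarrow> T \<in> \<T> \<Longrightarrow> y \<in> T \<Longrightarrow> x \<in> T"
proof -
  let ?U = "- \<Union>{T \<in> \<T>. x \<notin> T}"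
  have "closed (\<Union>{T \<in> \<T>. x \<notin> T})" using finite_mesh closed_cell by (intro closed_Union) auto
  then have "open ?U" by (simp add: open_Compl)
  moreover have "x \<in> ?U" by auto
  ultimately obtain e where "0 < e" "ball x e \<subseteq> ?U" using open_contains_ball by blast
  then have e: "0 < e" "\<forall>y T. dist y x < e \<longrightarrow> T \<in> \<T> \<longrightarrow> y \<in> T \<longrightarrow> x \<in> T"
    by (auto simp: subset_iff dist_commute)
  show ?thesis by (rule that[of e]) (use e in blast)+
qed

text \<open>The star of the face spanned by \<open>C\<close>. For the support of an index it
  consists of the cells containing the node, see \<open>cells_node\<close>.\<close>

definition cells :: "(real^'d) set \<Rightarrow> (real^'d) set set" where
  "cells C = {T \<in> \<T>. C \<subseteq> vertices T}"

lemma finite_cells: "finite (cells C)"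
  using finite_mesh by (simp add: cells_def)

end

section \<open>Hat functions\<close>

lemma relu_mult: "0 \<le> s \<Longrightarrow> relu (s * t) = s * relu t"
  by (simp add: relu_def max_mult_distrib_left)

lemma relu_eq_0_iff: "relu t = 0 \<longleftrightarrow> t \<le> 0"
  by (auto simp: relu_def max_def)

lemma half_cancel: "0 < q \<Longrightarrow> e / (2 * q) * q = e / (2::real)"
  by simp

context mesh begin

text \<open>The coordinates belonging to vertices outside of \<open>T'\<close> vanish on the common face, so both sides
  scale with the distance from it, and it suffices to consider the opposite face of \<open>T'\<close>, which is
  compact.\<close>

lemma negative_part_bound:
  assumes "T \<in> \<T>" "T' \<in> \<T>"
  obtains c where "0 < c" "\<And>x. x \<in> T' \<Longrightarrow>
    c * (\<Sum>w\<in>vertices T' - vertices T. bc T' w x) \<le> (\<Sum>w\<in>vertices T. relu (- bc T w x))"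
proof -
  interpret A: affine_frame "vertices T" using frame assms by blast
  interpret B: affine_frame "vertices T'" using frame assms by blast
  let ?C = "vertices T \<inter> vertices T'"
  let ?D = "vertices T' - vertices T"
  \<comment> \<open>Restricted to the vertices outside \<open>T'\<close>: these coordinates of
    \<open>T\<close> vanish at the shared vertices and hence scale exactly with the distance, which
    the others need not do.\<close>
  let ?G = "\<lambda>z. \<Sum>w\<in>vertices T - vertices T'. relu (- bc T w z)"
  let ?Z = "convex hull ?D"
  have "continuous_on ?Z ?G"
    unfolding relu_def by (intro continuous_intros A.continuous_bary)
  have "compact ?Z" using B.fin by (simp add: finite_imp_compact_convex_hull)
  \<comment> \<open>If \<open>?G z\<close> vanished, only coordinates of \<open>T\<close> at shared
    vertices could be negative. A short step from the barycentre \<open>y\<close> of the common face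
    towards \<open>z\<close> would then stay in both cells, hence in the common face, although
    \<open>z\<close> has no weight there. Without shared vertices \<open>z\<close> itself would lie
    in the empty intersection.\<close>
  have pos: "0 < ?G z" if z: "z \<in> ?Z" for z
  proof (rule ccontr)
    have relu_nonneg: "0 \<le> relu t" for t by (simp add: relu_def)
    assume "\<not> 0 < ?G z"
    moreover have "0 \<le> ?G z" by (intro sum_nonneg relu_nonneg)
    ultimately have "?G z = 0" by linarith
    then have "\<forall>w\<in>vertices T - vertices T'. relu (- bc T w z) = 0"
      by (subst (asm) sum_nonneg_eq_0_iff) (use A.fin relu_nonneg in auto)
    then have zn: "0 \<le> bc T w z" if "w \<notin> ?C" for w
      using that A.bary_outside[of w] by (cases "w \<in> vertices T") (auto simp: relu_eq_0_iff)
    have "?Z \<subseteq> T'" using hull_mono[of ?D "vertices T'" convex] hull_vertices assms by auto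
    then have zT': "z \<in> T'" using z by blast
    have zD: "\<forall>w. w \<notin> ?D \<longrightarrow> bc T' w z = 0" using B.in_hull_iff[of ?D z] z by auto
    show False
    proof (cases "?C = {}")
      case True
      then have "z \<in> T" using zn in_cell_iff assms by auto
      then show False using zT' cell_Int[OF assms] True by auto
    next
      case False
      define n where "n = real (card ?C)"
      have n: "0 < n" using False A.fin by (simp add: n_def card_gt_0_iff)
      define y where "y = (\<Sum>w\<in>?C. (1 / n) *\<^sub>R w)"
      have fC: "finite ?C" and sC: "(\<Sum>w\<in>?C. 1 / n) = 1" using A.fin n by (auto simp: n_def)
      have by1: "bc T v y = (if v \<in> ?C then 1 / n else 0)" for v
      proof -
        have "bc T v y = (\<Sum>w\<in>?C. 1 / n * bc T v w)"
          unfolding y_def by (rule A.bary_affine_sum[OF fC sC])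
        also have "\<dots> = (\<Sum>w\<in>?C. if v = w then 1 / n else 0)"
          by (rule sum.cong) (auto simp: A.bary_vertex)
        finally show ?thesis using fC by simp
      qed
      have by2: "bc T' v y = (if v \<in> ?C then 1 / n else 0)" for v
      proof -
        have "bc T' v y = (\<Sum>w\<in>?C. 1 / n * bc T' v w)"
          unfolding y_def by (rule B.bary_affine_sum[OF fC sC])
        also have "\<dots> = (\<Sum>w\<in>?C. if v = w then 1 / n else 0)"
          by (rule sum.cong) (auto simp: B.bary_vertex)
        finally show ?thesis using fC by simp
      qed
      \<comment> \<open>The coordinates of \<open>z\<close> at shared vertices are at least
        \<open>- m\<close>, and \<open>s\<close> is chosen such that (1 - s) / n = s m: the weight 1
        / n of \<open>y\<close> just absorbs the loss.\<close>
      define m where "m = 1 + (\<Sum>w\<in>?C. \<bar>bc T w z\<bar>)"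
      define s where "s = 1 / (n * m + 1)"
      have m: "1 \<le> m" unfolding m_def by (simp add: sum_nonneg)
      then have nm: "0 < n * m" using n by simp
      then have s: "0 < s" "s \<le> 1" by (auto simp: s_def)
      let ?x = "y + s *\<^sub>R (z - y)"
      have x1: "bc T v ?x = (1 - s) * bc T v y + s * bc T v z" for v
        using A.bary_line[of v y s z] by (simp add: algebra_simps)
      have x2: "bc T' v ?x = (1 - s) * bc T' v y + s * bc T' v z" for v
        using B.bary_line[of v y s z] by (simp add: algebra_simps)
      have "0 \<le> bc T v ?x" for v
      proof (cases "v \<in> ?C")
        case True
        have "\<bar>bc T v z\<bar> \<le> (\<Sum>w\<in>?C. \<bar>bc T w z\<bar>)" by (rule member_le_sum) (use True fC in auto)
        then have "- m \<le> bc T v z" unfolding m_def by linarith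
        then have "s * (- m) \<le> s * bc T v z" using s by (intro mult_left_mono) auto
        moreover have "(1 - s) * (1 / n) = s * m"
          using n nm by (simp add: s_def field_simps)
        ultimately show ?thesis unfolding x1 using by1[of v] True by simp
      next
        case False
        then show ?thesis unfolding x1 using by1[of v] zn[OF False] s by auto
      qed
      then have "?x \<in> T" using in_cell_iff assms by blast
      moreover have "?x \<in> T'"
      proof -
        have "0 \<le> bc T' v ?x" for v
          unfolding x2 using by2[of v] in_cell_iff[of T' z] zT' assms s n by auto
        then show ?thesis using in_cell_iff assms by blast
      qed
      ultimately have "?x \<in> convex hull ?C" using cell_Int assms by blast
      then have "\<forall>v. v \<notin> ?C \<longrightarrow> bc T' v ?x = 0" using B.in_hull_iff[of ?C ?x] by auto
      then have "bc T' v z = 0" if "v \<in> ?D" for v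
        using that x2[of v] by2[of v] s by auto
      then have "bc T' v z = 0" for v using zD by blast
      then show False using B.sum_bary[of z] by simp
    qed
  qed
  have "\<exists>c>0. \<forall>z\<in>?Z. c \<le> ?G z"
  proof (cases "?Z = {}")
    case True
    then have "\<forall>z\<in>?Z. 1 \<le> ?G z" by blast
    then show ?thesis using zero_less_one by blast
  next
    case False
    then obtain z where "z \<in> ?Z" "\<forall>y\<in>?Z. ?G z \<le> ?G y"
      using continuous_attains_inf[OF \<open>compact ?Z\<close> _ \<open>continuous_on ?Z ?G\<close>] by blast
    then show ?thesis using pos by blast
  qed
  then obtain c where c: "0 < c" "\<And>z. z \<in> ?Z \<Longrightarrow> c \<le> ?G z" by blast
  have "c * (\<Sum>w\<in>?D. bc T' w x) \<le> (\<Sum>w\<in>vertices T. relu (- bc T w x))" if x: "x \<in> T'" for x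
  proof -
    define s where "s = (\<Sum>w\<in>?D. bc T' w x)"
    have nn: "0 \<le> bc T' w x" for w using x in_cell_iff assms by blast
    then have "0 \<le> s" unfolding s_def by (intro sum_nonneg) auto
    have rest: "0 \<le> (\<Sum>w\<in>vertices T. relu (- bc T w x))" by (intro sum_nonneg) (simp add: relu_def)
    show ?thesis
    proof (cases "s = 0")
      case True
      then show ?thesis using rest by (simp add: s_def)
    next
      case False
      then have "0 < s" using \<open>0 \<le> s\<close> by simp
      \<comment> \<open>The projection of \<open>x\<close> from the common face onto the opposite
        one: shared weights are dropped and the others are divided by their sum
        \<open>s\<close>.\<close>
      define z where "z = (\<Sum>w\<in>?D. (bc T' w x / s) *\<^sub>R w)"
      have one: "(\<Sum>w\<in>?D. bc T' w x / s) = 1"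
        using \<open>0 < s\<close> by (simp add: s_def flip: sum_divide_distrib)
      have fD: "finite ?D" using B.fin by simp
      have "z \<in> ?Z"
        unfolding convex_hull_finite[OF fD] z_def using one nn \<open>0 < s\<close>
        by (intro CollectI exI[of _ "\<lambda>w. bc T' w x / s"]) auto
      have "bc T v x = s * bc T v z" if v: "v \<in> vertices T - vertices T'" for v
      proof -
        have "bc T v x = bc T v (\<Sum>w\<in>vertices T'. bc T' w x *\<^sub>R w)" by (simp add: B.bary_combination)
        also have "\<dots> = (\<Sum>w\<in>vertices T'. bc T' w x * bc T v w)"
          by (rule A.bary_affine_sum[OF B.fin B.sum_bary])
        also have "\<dots> = (\<Sum>w\<in>?D. bc T' w x * bc T v w)"
          by (rule sum.mono_neutral_right) (use B.fin v A.bary_vertex in auto)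
        also have "\<dots> = s * (\<Sum>w\<in>?D. bc T' w x / s * bc T v w)"
          using \<open>0 < s\<close> by (simp add: sum_distrib_left)
        also have "\<dots> = s * bc T v z"
          unfolding z_def by (simp add: A.bary_affine_sum[OF fD one])
        finally show ?thesis .
      qed
      then have "relu (- bc T v x) = s * relu (- bc T v z)" if "v \<in> vertices T - vertices T'" for v
        using that relu_mult[OF \<open>0 \<le> s\<close>, of "- bc T v z"] by (metis mult_minus_right)
      then have "(\<Sum>w\<in>vertices T - vertices T'. relu (- bc T w x)) = s * ?G z"
        unfolding sum_distrib_left by (intro sum.cong refl)
      moreover have "(\<Sum>w\<in>vertices T - vertices T'. relu (- bc T w x)) \<le> (\<Sum>w\<in>vertices T. relu (- bc T w x))"
        by (rule sum_mono2) (use A.fin in \<open>auto simp: relu_def\<close>)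
      moreover have "s * c \<le> s * ?G z" using c(2)[OF \<open>z \<in> ?Z\<close>] \<open>0 < s\<close> by (intro mult_left_mono) auto
      ultimately show ?thesis by (simp add: s_def mult.commute)
    qed
  qed
  then show ?thesis using that c(1) by blast
qed

text \<open>Expand \<open>bc T v x\<close> over the vertices of \<open>T'\<close>. The shared ones
  contribute exactly \<open>bc T' v x\<close>, the others at most \<open>K\<close> times their total
  weight, which \<open>negative_part_bound\<close> estimates by the negative parts; hence the factor
  \<open>K / c\<close>.\<close>

lemma penalty_pair:
  assumes "T \<in> \<T>" "T' \<in> \<T>"
  shows "\<exists>M\<ge>0. \<forall>x\<in>T'. \<forall>v\<in>vertices T.
    bc T v x - M * (\<Sum>w\<in>vertices T. relu (- bc T w x)) \<le> bc T' v x"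
proof -
  interpret A: affine_frame "vertices T" using frame assms by blast
  interpret B: affine_frame "vertices T'" using frame assms by blast
  obtain c where c: "0 < c" "\<And>x. x \<in> T' \<Longrightarrow>
    c * (\<Sum>w\<in>vertices T' - vertices T. bc T' w x) \<le> (\<Sum>w\<in>vertices T. relu (- bc T w x))"
    using negative_part_bound[OF assms] by metis
  define K where "K = (\<Sum>v\<in>vertices T. \<Sum>w\<in>vertices T'. \<bar>bc T v w\<bar>)"
  have K: "bc T v w \<le> K" if "v \<in> vertices T" "w \<in> vertices T'" for v w
  proof -
    have "\<bar>bc T v w\<bar> \<le> (\<Sum>w\<in>vertices T'. \<bar>bc T v w\<bar>)"
      by (rule member_le_sum) (use that B.fin in auto)
    also have "\<dots> \<le> K" unfolding K_def
      by (rule member_le_sum) (use that A.fin in \<open>auto intro: sum_nonneg\<close>)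
    finally show ?thesis by linarith
  qed
  have "0 \<le> K" unfolding K_def by (intro sum_nonneg) auto
  have "bc T v x - K / c * (\<Sum>w\<in>vertices T. relu (- bc T w x)) \<le> bc T' v x"
    if x: "x \<in> T'" and v: "v \<in> vertices T" for x v
  proof -
    let ?D = "vertices T' - vertices T"
    have nn: "0 \<le> bc T' w x" for w using x in_cell_iff assms by blast
    have "bc T v x = bc T v (\<Sum>w\<in>vertices T'. bc T' w x *\<^sub>R w)" by (simp add: B.bary_combination)
    also have "\<dots> = (\<Sum>w\<in>vertices T'. bc T' w x * bc T v w)"
      by (rule A.bary_affine_sum[OF B.fin B.sum_bary])
    also have "\<dots> = (\<Sum>w\<in>?D. bc T' w x * bc T v w) + (\<Sum>w\<in>vertices T' \<inter> vertices T. bc T' w x * bc T v w)"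
      by (subst sum.Int_Diff[OF B.fin, of _ "vertices T"]) (rule add.commute)
    also have "(\<Sum>w\<in>vertices T' \<inter> vertices T. bc T' w x * bc T v w) =
        (\<Sum>w\<in>vertices T' \<inter> vertices T. if v = w then bc T' v x else 0)"
      by (rule sum.cong) (auto simp: A.bary_vertex)
    also have "\<dots> = bc T' v x" using v B.fin B.bary_outside[of v x] by auto
    also have "(\<Sum>w\<in>?D. bc T' w x * bc T v w) \<le> (\<Sum>w\<in>?D. bc T' w x * K)"
      by (intro sum_mono mult_left_mono nn K) (use v in auto)
    also have "(\<Sum>w\<in>?D. bc T' w x * K) = K / c * (c * (\<Sum>w\<in>?D. bc T' w x))"
      using c(1) by (simp add: mult.commute flip: sum_distrib_left)
    also have "\<dots> \<le> K / c * (\<Sum>w\<in>vertices T. relu (- bc T w x))"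
      using c(2)[OF x] \<open>0 \<le> K\<close> c(1) by (intro mult_left_mono) auto
    finally show ?thesis by simp
  qed
  then show ?thesis using \<open>0 \<le> K\<close> c(1) by (intro exI[of _ "K / c"]) auto
qed

lemma penalty:
  obtains M where "\<And>T x v. T \<in> \<T> \<Longrightarrow> x \<in> \<Union>\<T> \<Longrightarrow> v \<in> vertices T \<Longrightarrow>
    bc T v x - M * (\<Sum>w\<in>vertices T. relu (- bc T w x)) \<le> hat v x"
proof -
  obtain m where m: "\<And>T T'. T \<in> \<T> \<Longrightarrow> T' \<in> \<T> \<Longrightarrow> 0 \<le> m T T'"
    "\<And>T T' x v. T \<in> \<T> \<Longrightarrow> T' \<in> \<T> \<Longrightarrow> x \<in> T' \<Longrightarrow> v \<in> vertices T \<Longrightarrow>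
      bc T v x - m T T' * (\<Sum>w\<in>vertices T. relu (- bc T w x)) \<le> bc T' v x"
    using penalty_pair by metis
  \<comment> \<open>The sum serves as a common bound of finitely many nonnegative constants; a
    larger factor only lowers the penalized function.\<close>
  define M where "M = (\<Sum>T\<in>\<T>. \<Sum>T'\<in>\<T>. m T T')"
  have "bc T v x - M * (\<Sum>w\<in>vertices T. relu (- bc T w x)) \<le> hat v x"
    if T: "T \<in> \<T>" and x: "x \<in> \<Union>\<T>" and v: "v \<in> vertices T" for T x v
  proof -
    obtain T' where T': "T' \<in> \<T>" "x \<in> T'" using x by blast
    have "m T T' \<le> (\<Sum>T'\<in>\<T>. m T T')" by (rule member_le_sum) (use T T' finite_mesh m in auto)
    also have "\<dots> \<le> M" unfolding M_def
      by (rule member_le_sum) (use T finite_mesh m in \<open>auto intro: sum_nonneg\<close>)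
    finally have "m T T' * (\<Sum>w\<in>vertices T. relu (- bc T w x)) \<le> M * (\<Sum>w\<in>vertices T. relu (- bc T w x))"
      by (intro mult_right_mono sum_nonneg) (auto simp: relu_def)
    then show ?thesis using m(2)[OF T T' v] hat_eq[OF T', of v] by linarith
  qed
  then show ?thesis using that by blast
qed

text \<open>The upper bound is \<open>penalty\<close>. On a cell of the family its own penalty is
  zero, so its term attains the bound.\<close>

lemma hat_max:
  obtains M where "\<And>C v x. v \<in> C \<Longrightarrow> x \<in> \<Union>\<T> \<Longrightarrow> cells C \<noteq> {} \<Longrightarrow>
      relu (MAX T\<in>cells C. bc T v x - M * (\<Sum>w\<in>vertices T. relu (- bc T w x))) \<le> hat v x"
    "\<And>C v x T. v \<in> C \<Longrightarrow> T \<in> cells C \<Longrightarrow> x \<in> T \<Longrightarrow>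
      relu (MAX T\<in>cells C. bc T v x - M * (\<Sum>w\<in>vertices T. relu (- bc T w x))) = hat v x"
proof -
  obtain M where M: "\<And>T x v. T \<in> \<T> \<Longrightarrow> x \<in> \<Union>\<T> \<Longrightarrow> v \<in> vertices T \<Longrightarrow>
    bc T v x - M * (\<Sum>w\<in>vertices T. relu (- bc T w x)) \<le> hat v x"
    using penalty by metis
  let ?h = "\<lambda>v x T. bc T v x - M * (\<Sum>w\<in>vertices T. relu (- bc T w x))"
  have le: "relu (MAX T\<in>cells C. ?h v x T) \<le> hat v x"
    if "v \<in> C" "x \<in> \<Union>\<T>" "cells C \<noteq> {}" for C v x
  proof -
    have "?h v x T \<le> hat v x" if "T \<in> cells C" for T
      using M[of T x v] that \<open>v \<in> C\<close> \<open>x \<in> \<Union>\<T>\<close> by (auto simp: cells_def)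
    then have "(MAX T\<in>cells C. ?h v x T) \<le> hat v x"
      using that(3) finite_cells by (auto intro!: Max.boundedI)
    then show ?thesis using hat_nonneg[OF that(2)] by (simp add: relu_def)
  qed
  have eq: "relu (MAX T\<in>cells C. ?h v x T) = hat v x" if "v \<in> C" "T \<in> cells C" "x \<in> T" for C v x T
  proof (rule antisym)
    have T: "T \<in> \<T>" using that(2) by (simp add: cells_def)
    show "relu (MAX T\<in>cells C. ?h v x T) \<le> hat v x" using le[of v C x] that T by blast
    have "(\<Sum>w\<in>vertices T. relu (- bc T w x)) = 0"
      using in_cell_iff[OF T] that(3) by (intro sum.neutral) (auto simp: relu_def)
    then have "?h v x T = hat v x" using hat_eq[OF T that(3)] by simp
    then have "hat v x \<in> (\<lambda>T. ?h v x T) ` cells C" using that(2) by force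
    then have "hat v x \<le> (MAX T\<in>cells C. ?h v x T)"
      using finite_cells by (intro Max_ge) auto
    then show "hat v x \<le> relu (MAX T\<in>cells C. ?h v x T)" by (simp add: relu_def)
  qed
  show ?thesis by (rule that[of M], (rule le; assumption), (rule eq; assumption))
qed

text \<open>Local convexity on the scale given by a Lebesgue number of the cover by vertex patches.\<close>

lemma vertex_convex_imp_convex:
  assumes vc: "vertex_convex \<T>" and conn: "connected (\<Union>\<T>)"
  shows "convex (\<Union>\<T>)"
proof -
  define N where "N x e \<longleftrightarrow> 0 < e \<and> (\<forall>y z. y \<in> \<Union>\<T> \<inter> ball x e \<longrightarrow> z \<in> \<Union>\<T> \<inter> ball x e \<longrightarrow>
      closed_segment y z \<subseteq> \<Union>\<T>)" for x e
  have ex: "\<exists>e. N x e" if x: "x \<in> \<Union>\<T>" for x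
  proof -
    obtain T where T: "T \<in> \<T>" "x \<in> T" using x by blast
    interpret A: affine_frame "vertices T" using frame T by blast
    \<comment> \<open>The coordinates sum to 1, so one of them is positive at \<open>x\<close>. All
      cells near \<open>x\<close> contain \<open>x\<close>, hence have this \<open>v\<close> as a
      vertex: close to \<open>x\<close> the mesh lies in the convex patch of
      \<open>v\<close>.\<close>
    obtain v where v: "v \<in> vertices T" "bc T v x > 0"
    proof (rule ccontr)
      assume "\<not> thesis"
      then have "\<forall>v\<in>vertices T. bc T v x \<le> 0" using that by force
      then have "(\<Sum>v\<in>vertices T. bc T v x) \<le> 0" by (intro sum_nonpos) auto
      then show False using A.sum_bary by simp
    qed
    have "{v} \<in> subsimplices 0 \<T>"
      unfolding subsimplices_def using T v by (intro CollectI exI[of _ "{v}"] exI[of _ T]) auto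
    then have cv: "convex (patch \<T> v)" using vc by (simp add: vertex_convex_def)
    obtain e where e: "0 < e" "\<And>y T. dist y x < e \<Longrightarrow> T \<in> \<T> \<Longrightarrow> y \<in> T \<Longrightarrow> x \<in> T"
      using local_cells[of x] by metis
    have "y \<in> patch \<T> v" if y: "y \<in> \<Union>\<T> \<inter> ball x e" for y
    proof -
      obtain T' where T': "T' \<in> \<T>" "y \<in> T'" using y by blast
      then have "x \<in> T'" using e(2)[of y T'] y by (simp add: dist_commute)
      then have "bc T' v x > 0" using bc_eq[OF T(1) T'(1) T(2)] v by simp
      then have "v \<in> T'" using bc_pos_vertex vertices_subset T' by blast
      then show ?thesis using T' by (auto simp: patch_def)
    qed
    moreover have "patch \<T> v \<subseteq> \<Union>\<T>" by (auto simp: patch_def)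
    ultimately have "N x e"
      unfolding N_def using e(1) cv by (meson convex_contains_segment order_trans)
    then show ?thesis by blast
  qed
  define \<G> where "\<G> = {ball x e | x e. N x e}"
  have cover: "\<Union>\<T> \<subseteq> \<Union>\<G>"
  proof
    fix x assume "x \<in> \<Union>\<T>"
    then obtain e where "N x e" using ex by blast
    then have "x \<in> ball x e" "ball x e \<in> \<G>" by (auto simp: N_def \<G>_def)
    then show "x \<in> \<Union>\<G>" by blast
  qed
  have "open G" if "G \<in> \<G>" for G using that by (auto simp: \<G>_def)
  then obtain \<epsilon> where eps: "0 < \<epsilon>" "\<And>x. x \<in> \<Union>\<T> \<Longrightarrow> \<exists>G\<in>\<G>. ball x \<epsilon> \<subseteq> G"
    using Heine_Borel_lemma[OF compact_mesh cover] by metis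
  show ?thesis
  proof (rule locally_convex_imp_convex[OF compact_mesh conn])
    \<comment> \<open>Points at distance at most 2 (\<epsilon> / 4) then lie in one ball of radius
      \<epsilon>, thus in one member of the cover.\<close>
    show "0 < \<epsilon> / 4" using eps by simp
    fix x y assume xy: "x \<in> \<Union>\<T>" "y \<in> \<Union>\<T>" "dist x y \<le> 2 * (\<epsilon> / 4)"
    obtain c e where "N c e" "ball x \<epsilon> \<subseteq> ball c e" using eps(2)[OF xy(1)] by (auto simp: \<G>_def)
    moreover have "x \<in> ball x \<epsilon>" "y \<in> ball x \<epsilon>" using eps(1) xy(3) by auto
    ultimately show "closed_segment x y \<subseteq> \<Union>\<T>" using xy unfolding N_def by blast
  qed
qed

text \<open>The facet of \<open>T\<close> opposite \<open>v\<close> supports the patch. Otherwise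
  the segment from its barycentre \<open>z\<close> to \<open>x\<close> would stay in the convex
  patch and immediately enter a cell that contains both the facet and \<open>v\<close>; this can
  only be \<open>T\<close>, where the coordinate is not negative.\<close>

lemma patch_supported:
  assumes vc: "vertex_convex \<T>" and T: "T \<in> \<T>" and v: "v \<in> vertices T" and x: "x \<in> patch \<T> v"
  shows "0 \<le> bc T v x"
proof (rule ccontr)
  assume neg: "\<not> 0 \<le> bc T v x"
  interpret A: affine_frame "vertices T" using frame T by blast
  have "{v} \<in> subsimplices 0 \<T>"
    unfolding subsimplices_def using T v by (intro CollectI exI[of _ "{v}"] exI[of _ T]) auto
  then have cv: "convex (patch \<T> v)" using vc by (simp add: vertex_convex_def)
  let ?F = "vertices T - {v}"
  define n where "n = real (card ?F)"
  have fF: "finite ?F" using A.fin by simp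
  have "card ?F = CARD('d)" using card_vertices[OF T] v by simp
  then have n: "0 < n" by (simp add: n_def)
  have sF: "(\<Sum>w\<in>?F. 1 / n) = 1" using n by (simp add: n_def)
  define z where "z = (\<Sum>w\<in>?F. (1 / n) *\<^sub>R w)"
  have bz: "bc T u z = (if u \<in> ?F then 1 / n else 0)" for u
  proof -
    have "bc T u z = (\<Sum>w\<in>?F. 1 / n * bc T u w)"
      unfolding z_def by (rule A.bary_affine_sum[OF fF sF])
    also have "\<dots> = (\<Sum>w\<in>?F. if u = w then 1 / n else 0)"
      by (rule sum.cong) (auto simp: A.bary_vertex)
    finally show ?thesis using fF by simp
  qed
  then have zT: "z \<in> T" using in_cell_iff[OF T] n by auto
  have vT: "v \<in> T" using v vertices_subset T by blast
  then have zP: "z \<in> patch \<T> v" using T zT by (auto simp: patch_def)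
  obtain e where e: "0 < e" "\<And>y T. dist y z < e \<Longrightarrow> T \<in> \<T> \<Longrightarrow> y \<in> T \<Longrightarrow> z \<in> T"
    using local_cells[of z] by metis
  \<comment> \<open>Makes the displacement at most e / 2; the 1 in the denominator guards against x
    = z.\<close>
  define t where "t = min 1 (e / (2 * (1 + norm (x - z))))"
  have nx: "0 < 1 + norm (x - z)" by (simp add: add_pos_nonneg)
  have t: "0 < t" "t \<le> 1" using e(1) nx by (auto simp: t_def)
  have "t * norm (x - z) \<le> e / (2 * (1 + norm (x - z))) * (1 + norm (x - z))"
    using t by (intro mult_mono) (auto simp: t_def)
  also have "\<dots> = e / 2" by (rule half_cancel[OF nx])
  finally have te: "t * norm (x - z) < e" using e(1) by linarith
  let ?y = "z + t *\<^sub>R (x - z)"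
  have "?y = (1 - t) *\<^sub>R z + t *\<^sub>R x" by (simp add: algebra_simps)
  then have "?y \<in> patch \<T> v" using cv zP x t by (metis convex_alt less_eq_real_def)
  then obtain T' where T': "T' \<in> \<T>" "v \<in> T'" "?y \<in> T'" by (auto simp: patch_def)
  have "z \<in> T'" by (rule e(2)[OF _ T'(1,3)]) (use te t in \<open>simp add: dist_norm\<close>)
  then have "0 < bc T' w z" if "w \<in> ?F" for w
  proof -
    have "bc T' w z = 1 / n" using bc_eq[OF T T'(1) zT \<open>z \<in> T'\<close>, of w] bz[of w] that by simp
    then show ?thesis using n by (metis divide_pos_pos zero_less_one)
  qed
  then have "?F \<subseteq> vertices T'" using bc_pos_vertex[OF T'(1)] by blast
  moreover have "v \<in> vertices T'" using vertex_in_cell[OF T v T'(1)] T'(2) by blast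
  ultimately have "T = T'" using vertices_inj T T'(1) by blast
  then have "0 \<le> bc T v ?y" using T' in_cell_iff by blast
  then have "0 \<le> t * bc T v x" using A.bary_line[of v z t x] bz[of v] by simp
  then show False using neg t by (simp add: zero_le_mult_iff)
qed

text \<open>Project \<open>x\<close> from \<open>v\<close> onto the facet of \<open>T'\<close>
  opposite \<open>v\<close>. At the image \<open>bc T' v\<close> is 0 and \<open>bc T v\<close> is
  nonnegative by \<open>patch_supported\<close>; at \<open>v\<close> both are 1. Both are affine in
  between, so the comparison holds at \<open>x\<close>.\<close>

lemma hat_concave:
  assumes vc: "vertex_convex \<T>" and "T \<in> \<T>" "T' \<in> \<T>" "v \<in> vertices T" "v \<in> vertices T'" "x \<in> T'"
  shows "bc T' v x \<le> bc T v x"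
proof -
  interpret A: affine_frame "vertices T" using frame assms by blast
  interpret B: affine_frame "vertices T'" using frame assms by blast
  define c where "c = bc T' v x"
  have c: "0 \<le> c" using assms in_cell_iff by (auto simp: c_def)
  have vx: "bc T v v = 1" "bc T' v v = 1" using A.bary_vertex B.bary_vertex assms by auto
  have nn: "0 \<le> bc T' w x" for w using assms in_cell_iff by blast
  have others: "(\<Sum>w\<in>vertices T' - {v}. bc T' w x) = 1 - c"
    using B.sum_bary[of x] sum.remove[OF B.fin assms(5), of "\<lambda>w. bc T' w x"] by (simp add: c_def)
  have "0 \<le> (\<Sum>w\<in>vertices T' - {v}. bc T' w x)" by (intro sum_nonneg nn)
  then have c1: "c \<le> 1" using others by simp
  show ?thesis
  proof (cases "c = 1")
    case True
    then have "\<forall>w\<in>vertices T' - {v}. bc T' w x = 0"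
      using others nn B.fin by (simp add: sum_nonneg_eq_0_iff)
    then have "x = (\<Sum>w\<in>vertices T'. (if w = v then v else 0))"
      using True by (subst B.bary_combination[of x, symmetric]) (auto simp: c_def intro!: sum.cong)
    then have "x = v" using B.fin assms(5) by simp
    then show ?thesis using vx by simp
  next
    case False
    then have c': "c < 1" using c1 by simp
    \<comment> \<open>Chosen such that \<open>bc T' v\<close>, which falls from 1 at
      \<open>v\<close> to \<open>c\<close> at \<open>x\<close>, reaches 0 at
      \<open>?y\<close>.\<close>
    define r where "r = 1 / (1 - c)"
    let ?y = "v + r *\<^sub>R (x - v)"
    have r: "0 < r" using c' by (simp add: r_def)
    have "bc T' v ?y = 1 + r * (c - 1)" using B.bary_line[of v v r x] vx by (simp add: c_def)
    also have "\<dots> = 0" using c' by (simp add: r_def field_simps)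
    finally have y0: "bc T' v ?y = 0" .
    have "0 \<le> bc T' w ?y" for w
    proof (cases "w = v")
      case False
      then have "bc T' w v = 0" using B.bary_vertex[OF assms(5), of w] by simp
      then show ?thesis using B.bary_line[of w v r x] nn[of w] r by simp
    qed (use y0 in simp)
    then have "?y \<in> T'" using in_cell_iff assms by blast
    moreover have "v \<in> T'" using assms vertices_subset by blast
    ultimately have "?y \<in> patch \<T> v" using assms by (auto simp: patch_def)
    then have "0 \<le> bc T v ?y" using patch_supported assms by blast
    then have "0 \<le> 1 + r * (bc T v x - 1)" using A.bary_line[of v v r x] vx by simp
    then have "0 \<le> (1 - c) + (bc T v x - 1)"
      using c' by (simp add: r_def field_simps)
    then show ?thesis by (simp add: c_def)
  qed
qed

text \<open>By \<open>hat_concave\<close> the cell containing \<open>x\<close> provides the smallest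
  extension.\<close>

lemma hat_min_inside:
  assumes "vertex_convex \<T>" "v \<in> C" "T \<in> cells C" "x \<in> T"
  shows "relu (MIN T\<in>cells C. bc T v x) = hat v x"
proof -
  have T: "T \<in> \<T>" using assms by (simp add: cells_def)
  have "bc T v x \<le> bc T' v x" if "T' \<in> cells C" for T'
    by (rule hat_concave[OF assms(1) _ T]) (use that assms in \<open>auto simp: cells_def\<close>)
  then have "(MIN T\<in>cells C. bc T v x) = bc T v x"
    using assms(3) finite_cells by (intro Min_eqI) auto
  then show ?thesis using hat_eq[OF T assms(4)] in_cell_iff[OF T] assms(4) by (simp add: relu_def)
qed

text \<open>Follow the segment from \<open>p\<close> to \<open>x\<close> up to its last point \<open>y\<close> in the patch of \<open>p\<close>: there some
  coordinate belonging to \<open>C\<close> has decreased to 0, and by affinity it stays nonpositive up to \<open>x\<close>.\<close>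

lemma hat_min_outside:
  assumes conv: "convex (\<Union>\<T>)" and x: "x \<in> \<Union>\<T>" and ne: "cells C \<noteq> {}"
    and p: "\<And>T. T \<in> cells C \<Longrightarrow> p \<in> T" "\<And>T v. T \<in> cells C \<Longrightarrow> v \<in> C \<Longrightarrow> 0 < bc T v p"
    and out: "\<forall>T\<in>cells C. x \<notin> T"
  shows "\<exists>v\<in>C. relu (MIN T\<in>cells C. bc T v x) = 0"
proof -
  obtain T0 where T0: "T0 \<in> cells C" using ne by blast
  have pU: "p \<in> \<Union>\<T>" using p(1)[OF T0] T0 by (auto simp: cells_def)
  let ?l = "\<lambda>s. p + s *\<^sub>R (x - p)"
  let ?S = "{s \<in> {0..1::real}. ?l s \<in> \<Union>(cells C)}"
  have "closed (\<Union>(cells C))"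
    using finite_cells closed_cell by (intro closed_Union) (auto simp: cells_def)
  moreover have "continuous_on {0..1} ?l" by (intro continuous_intros)
  ultimately have "closed ({0..1} \<inter> ?l -` \<Union>(cells C))"
    by (intro continuous_closed_preimage) auto
  moreover have "?S = {0..1} \<inter> ({0..1} \<inter> ?l -` \<Union>(cells C))" by auto
  ultimately have "compact ?S" by (metis compact_Int_closed compact_Icc)
  moreover have "0 \<in> ?S" using p(1)[OF T0] T0 by auto
  ultimately obtain s where s: "s \<in> ?S" "\<And>r. r \<in> ?S \<Longrightarrow> r \<le> s"
    using compact_attains_sup[of ?S] by blast
  then obtain T where T: "T \<in> cells C" "?l s \<in> T" by blast
  have T': "T \<in> \<T>" using T by (simp add: cells_def)
  interpret A: affine_frame "vertices T" using frame T' by blast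
  have "s \<noteq> 1"
  proof
    assume "s = 1"
    then show False using T out by simp
  qed
  then have s1: "0 \<le> s" "s < 1" using s by auto
  \<comment> \<open>Were all these coordinates still positive, a slightly later point of the
    segment, which is in the mesh by convexity, would lie in a cell that contains
    \<open>?l s\<close> and so has all of \<open>C\<close> as vertices. The family would not have
    been left at \<open>s\<close>.\<close>
  have "\<exists>v\<in>C. bc T v (?l s) = 0"
  proof (rule ccontr)
    assume "\<not> (\<exists>v\<in>C. bc T v (?l s) = 0)"
    then have pos: "0 < bc T v (?l s)" if "v \<in> C" for v
      using that T(2) in_cell_iff[OF T'] by (metis less_eq_real_def)
    obtain e where e: "0 < e" "\<And>y T. dist y (?l s) < e \<Longrightarrow> T \<in> \<T> \<Longrightarrow> y \<in> T \<Longrightarrow> ?l s \<in> T"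
      using local_cells[of "?l s"] by metis
    define h where "h = min (1 - s) (e / (2 * (1 + norm (x - p))))"
    have nx: "0 < 1 + norm (x - p)" by (simp add: add_pos_nonneg)
    have h: "0 < h" "s + h \<le> 1" using e(1) nx s1 by (auto simp: h_def)
    have "h * norm (x - p) \<le> e / (2 * (1 + norm (x - p))) * (1 + norm (x - p))"
      using h by (intro mult_mono) (auto simp: h_def)
    also have "\<dots> = e / 2" by (rule half_cancel[OF nx])
    finally have he: "h * norm (x - p) < e" using e(1) by linarith
    have "?l (s + h) = (1 - (s + h)) *\<^sub>R p + (s + h) *\<^sub>R x" by (simp add: algebra_simps)
    then have "?l (s + h) \<in> \<Union>\<T>"
      using conv x pU h s1 unfolding convex_alt by (metis add_nonneg_nonneg less_eq_real_def)
    then obtain T1 where T1: "T1 \<in> \<T>" "?l (s + h) \<in> T1" by blast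
    have "dist (?l (s + h)) (?l s) = h * norm (x - p)"
      using h by (simp add: dist_norm algebra_simps flip: scaleR_diff_right)
    then have "dist (?l (s + h)) (?l s) < e" using he by (simp only:)
    then have "?l s \<in> T1" using e(2) T1 by blast
    then have "0 < bc T1 v (?l s)" if "v \<in> C" for v
      using pos[OF that] bc_eq[OF T' T1(1) T(2)] by simp
    then have "C \<subseteq> vertices T1" using bc_pos_vertex[OF T1(1)] by blast
    then have "T1 \<in> cells C" using T1 by (simp add: cells_def)
    then have "s + h \<in> ?S" using T1 h s1 by auto
    then show False using s(2) h by fastforce
  qed
  then obtain v where v: "v \<in> C" "bc T v (?l s) = 0" by blast
  have b0: "0 < bc T v p" using p(2) T(1) v(1) by blast
  have "0 = bc T v p + s * (bc T v x - bc T v p)" using v(2) A.bary_line[of v p s x] by simp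
  then have "s * bc T v x = (s - 1) * bc T v p" by (simp add: algebra_simps)
  also have "\<dots> < 0" using s1 b0 by (simp add: mult_neg_pos)
  finally have "bc T v x < 0" using s1 by (simp add: mult_less_0_iff)
  moreover have "(MIN T\<in>cells C. bc T v x) \<le> bc T v x" using finite_cells T(1) by (intro Min_le) auto
  ultimately show ?thesis using v(1) by (intro bexI[of _ v]) (auto simp: relu_def)
qed

end

section \<open>Bernstein monomials\<close>

definition homogeneous_indices :: "(real^'d) set \<Rightarrow> nat \<Rightarrow> (real^'d \<Rightarrow> nat) set" where
  "homogeneous_indices V n = {\<alpha>. (\<forall>v. v \<notin> V \<longrightarrow> \<alpha> v = 0) \<and> sum \<alpha> V = n}"

lemma finite_homogeneous_indices:
  assumes "finite V"
  shows "finite (homogeneous_indices V n)"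
proof (rule finite_subset)
  have "\<alpha> v \<le> n" if "\<alpha> \<in> homogeneous_indices V n" "v \<in> V" for \<alpha> v
    using that member_le_sum[of v V \<alpha>] assms by (auto simp: homogeneous_indices_def)
  then show "homogeneous_indices V n \<subseteq> {f. \<forall>v. (v \<in> V \<longrightarrow> f v \<in> {..n}) \<and> (v \<notin> V \<longrightarrow> f v = 0)}"
    by (auto simp: homogeneous_indices_def)
  show "finite {f. \<forall>v. (v \<in> V \<longrightarrow> f v \<in> {..n}) \<and> (v \<notin> V \<longrightarrow> f v = 0)}"
    by (rule finite_set_of_finite_funs) (use assms in auto)
qed

text \<open>Induction on the variables: with the others fixed, a polynomial in \<open>w\<close>
  vanishes on the positive half-line, so its coefficients vanish, and these are sums in fewer
  variables over the indices with a given exponent at \<open>w\<close>. As indices are total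
  functions, they have to be distinguishable on \<open>C\<close>.\<close>

lemma monomials_independent:
  fixes e :: "('a \<Rightarrow> nat) \<Rightarrow> real"
  assumes "finite C" "finite A" "inj_on (\<lambda>\<alpha>. restrict \<alpha> C) A"
    and "\<And>x. (\<And>v. 0 < x v) \<Longrightarrow> (\<Sum>\<alpha>\<in>A. e \<alpha> * (\<Prod>v\<in>C. x v ^ \<alpha> v)) = 0"
    and "\<alpha> \<in> A"
  shows "e \<alpha> = 0"
  using assms
proof (induction C arbitrary: A \<alpha> rule: finite_induct)
  case empty
  then have "A = {\<alpha>}" by (auto simp: inj_on_def restrict_def)
  then show ?case using empty.prems(3)[of "\<lambda>_. 1"] by simp
next
  case (insert w C)
  define n where "n = Max ((\<lambda>\<alpha>. \<alpha> w) ` A)"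
  have n: "\<beta> w \<le> n" if "\<beta> \<in> A" for \<beta> using that insert.prems(1) by (simp add: n_def)
  let ?A = "\<lambda>j. {\<beta> \<in> A. \<beta> w = j}"
  have "e \<alpha> = 0"
  proof (rule insert.IH)
    show "finite (?A (\<alpha> w))" "\<alpha> \<in> ?A (\<alpha> w)" using insert.prems by auto
    show "inj_on (\<lambda>\<alpha>. restrict \<alpha> C) (?A (\<alpha> w))"
    proof (rule inj_onI)
      fix \<beta> \<gamma> assume b: "\<beta> \<in> ?A (\<alpha> w)" "\<gamma> \<in> ?A (\<alpha> w)" "restrict \<beta> C = restrict \<gamma> C"
      then have "\<forall>v\<in>C. \<beta> v = \<gamma> v" by (metis restrict_apply')
      then have eq: "restrict \<beta> (insert w C) = restrict \<gamma> (insert w C)"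
        using b by (intro restrict_ext) auto
      show "\<beta> = \<gamma>" using inj_onD[OF insert.prems(2), of \<beta> \<gamma>] eq b by blast
    qed
    fix x :: "'a \<Rightarrow> real" assume x: "\<And>v. 0 < x v"
    define c where "c j = (\<Sum>\<beta>\<in>?A j. e \<beta> * (\<Prod>v\<in>C. x v ^ \<beta> v))" for j
    have "(\<Sum>j\<le>n. c j * t ^ j) = 0" if t: "0 < t" for t
    proof -
      have "0 = (\<Sum>\<beta>\<in>A. e \<beta> * (\<Prod>v\<in>insert w C. (x(w := t)) v ^ \<beta> v))"
        using insert.prems(3)[of "x(w := t)"] x t by simp
      also have "\<dots> = (\<Sum>\<beta>\<in>A. e \<beta> * (\<Prod>v\<in>C. x v ^ \<beta> v) * t ^ \<beta> w)"
      proof (rule sum.cong[OF refl])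
        fix \<beta>
        have "(\<Prod>v\<in>C. (x(w := t)) v ^ \<beta> v) = (\<Prod>v\<in>C. x v ^ \<beta> v)"
          by (rule prod.cong) (use insert.hyps in auto)
        then show "e \<beta> * (\<Prod>v\<in>insert w C. (x(w := t)) v ^ \<beta> v) = e \<beta> * (\<Prod>v\<in>C. x v ^ \<beta> v) * t ^ \<beta> w"
          using insert.hyps by simp
      qed
      also have "\<dots> = (\<Sum>j\<le>n. \<Sum>\<beta>\<in>?A j. e \<beta> * (\<Prod>v\<in>C. x v ^ \<beta> v) * t ^ \<beta> w)"
        by (rule sum.group[symmetric]) (use insert.prems(1) n in auto)
      also have "\<dots> = (\<Sum>j\<le>n. c j * t ^ j)"
        unfolding c_def sum_distrib_right by (intro sum.cong) auto
      finally show ?thesis by simp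
    qed
    then have "{0<..} \<subseteq> {t. (\<Sum>j\<le>n. c j * t ^ j) = 0}" by auto
    then have "infinite {t. (\<Sum>j\<le>n. c j * t ^ j) = 0}"
      using infinite_Ioi[of "0::real"] finite_subset by blast
    then have "c (\<alpha> w) = 0" using polyfun_finite_roots[of c n] n[OF insert.prems(4)] by blast
    then show "(\<Sum>\<beta>\<in>?A (\<alpha> w). e \<beta> * (\<Prod>v\<in>C. x v ^ \<beta> v)) = 0" by (simp add: c_def)
  qed
  then show ?case .
qed

section \<open>Polynomials as forms in barycentric coordinates\<close>

context affine_frame
begin

definition homogeneous :: "nat \<Rightarrow> (real^'d \<Rightarrow> real) \<Rightarrow> bool" where
  "homogeneous n f \<longleftrightarrow>
    (\<exists>c. \<forall>x. f x = (\<Sum>\<alpha>\<in>homogeneous_indices V n. c \<alpha> * (\<Prod>v\<in>V. bary V v x ^ \<alpha> v)))"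

lemma homogeneous_zero: "homogeneous n (\<lambda>x. 0)"
  unfolding homogeneous_def by (rule exI[of _ "\<lambda>_. 0"]) simp

lemma homogeneous_add:
  assumes "homogeneous n f" "homogeneous n g"
  shows "homogeneous n (\<lambda>x. f x + g x)"
proof -
  obtain c c' where "\<forall>x. f x = (\<Sum>\<alpha>\<in>homogeneous_indices V n. c \<alpha> * (\<Prod>v\<in>V. bary V v x ^ \<alpha> v))"
    "\<forall>x. g x = (\<Sum>\<alpha>\<in>homogeneous_indices V n. c' \<alpha> * (\<Prod>v\<in>V. bary V v x ^ \<alpha> v))"
    using assms by (auto simp: homogeneous_def)
  then have "\<forall>x. f x + g x = (\<Sum>\<alpha>\<in>homogeneous_indices V n. (c \<alpha> + c' \<alpha>) * (\<Prod>v\<in>V. bary V v x ^ \<alpha> v))"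
    by (simp add: distrib_right sum.distrib)
  then show ?thesis unfolding homogeneous_def by (intro exI)
qed

lemma homogeneous_scale:
  assumes "homogeneous n f"
  shows "homogeneous n (\<lambda>x. r * f x)"
proof -
  obtain c where "\<forall>x. f x = (\<Sum>\<alpha>\<in>homogeneous_indices V n. c \<alpha> * (\<Prod>v\<in>V. bary V v x ^ \<alpha> v))"
    using assms by (auto simp: homogeneous_def)
  then have "\<forall>x. r * f x = (\<Sum>\<alpha>\<in>homogeneous_indices V n. (r * c \<alpha>) * (\<Prod>v\<in>V. bary V v x ^ \<alpha> v))"
    by (simp add: sum_distrib_left mult.assoc)
  then show ?thesis unfolding homogeneous_def by (intro exI)
qed

lemma homogeneous_sum:
  assumes "\<And>i. i \<in> I \<Longrightarrow> homogeneous n (f i)"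
  shows "homogeneous n (\<lambda>x. \<Sum>i\<in>I. f i x)"
  using assms
  by (induction I rule: infinite_finite_induct) (auto intro: homogeneous_zero homogeneous_add)

text \<open>Multiplication raises the exponent at \<open>w\<close> by one; indices with exponent 0
  at \<open>w\<close> are not hit and receive the coefficient 0.\<close>

lemma homogeneous_bary_mult:
  assumes "homogeneous n f" and w: "w \<in> V"
  shows "homogeneous (Suc n) (\<lambda>x. bary V w x * f x)"
proof -
  obtain c where f: "\<And>x. f x = (\<Sum>\<alpha>\<in>homogeneous_indices V n. c \<alpha> * (\<Prod>v\<in>V. bary V v x ^ \<alpha> v))"
    using assms by (auto simp: homogeneous_def)
  let ?up = "\<lambda>\<alpha>. \<alpha>(w := Suc (\<alpha> w))" and ?dn = "\<lambda>\<alpha>. \<alpha>(w := \<alpha> w - 1)"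
  let ?H = "homogeneous_indices V"
  have sum_up: "sum (?up \<alpha>) V = Suc (sum \<alpha> V)" for \<alpha>
    using w fin by (simp add: sum.remove[OF fin w])
  have up: "?up \<alpha> \<in> ?H (Suc n)" if "\<alpha> \<in> ?H n" for \<alpha>
    using that w sum_up[of \<alpha>] by (auto simp: homogeneous_indices_def)
  have dn: "?dn \<beta> \<in> ?H n" "?up (?dn \<beta>) = \<beta>" if "\<beta> \<in> ?H (Suc n)" "0 < \<beta> w" for \<beta>
  proof -
    show u: "?up (?dn \<beta>) = \<beta>" using that(2) by auto
    then have "Suc (sum (?dn \<beta>) V) = Suc n"
      using sum_up[of "?dn \<beta>"] that(1) by (simp add: homogeneous_indices_def)
    then show "?dn \<beta> \<in> ?H n" using that w by (auto simp: homogeneous_indices_def)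
  qed
  have "bary V w x * f x = (\<Sum>\<beta>\<in>?H (Suc n). (if 0 < \<beta> w then c (?dn \<beta>) else 0) * (\<Prod>v\<in>V. bary V v x ^ \<beta> v))"
    for x
  proof -
    have prod_up: "(\<Prod>v\<in>V. bary V v x ^ (?up \<alpha>) v) = bary V w x * (\<Prod>v\<in>V. bary V v x ^ \<alpha> v)" for \<alpha>
      using w fin by (simp add: prod.remove[OF fin w])
    have "bary V w x * f x = (\<Sum>\<alpha>\<in>?H n. c \<alpha> * (\<Prod>v\<in>V. bary V v x ^ (?up \<alpha>) v))"
      unfolding prod_up by (simp add: f sum_distrib_left mult.left_commute)
    also have "\<dots> = (\<Sum>\<beta>\<in>{\<beta>\<in>?H (Suc n). 0 < \<beta> w}. c (?dn \<beta>) * (\<Prod>v\<in>V. bary V v x ^ \<beta> v))"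
      by (rule sum.reindex_bij_witness[of _ ?dn ?up]) (use up dn in \<open>auto simp del: fun_upd_apply\<close>, auto)
    also have "\<dots> = (\<Sum>\<beta>\<in>{\<beta>\<in>?H (Suc n). 0 < \<beta> w}. (if 0 < \<beta> w then c (?dn \<beta>) else 0) * (\<Prod>v\<in>V. bary V v x ^ \<beta> v))"
      by (rule sum.cong) auto
    also have "\<dots> = (\<Sum>\<beta>\<in>?H (Suc n). (if 0 < \<beta> w then c (?dn \<beta>) else 0) * (\<Prod>v\<in>V. bary V v x ^ \<beta> v))"
      by (rule sum.mono_neutral_left) (use finite_homogeneous_indices[OF fin] in auto)
    finally show ?thesis .
  qed
  then show ?thesis unfolding homogeneous_def by (intro exI allI)
qed

text \<open>The assumption on \<open>g\<close> expresses affinity through its vertex values.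
  Cartesian coordinates yield the monomials, while g = 1 raises the formal degree without changing
  the function.\<close>

lemma homogeneous_affine_mult:
  assumes "homogeneous n f" and g: "\<And>x. g x = (\<Sum>v\<in>V. g v * bary V v x)"
  shows "homogeneous (Suc n) (\<lambda>x. g x * f x)"
proof -
  have "homogeneous (Suc n) (\<lambda>x. \<Sum>v\<in>V. g v * (bary V v x * f x))"
    by (intro homogeneous_sum homogeneous_scale homogeneous_bary_mult assms(1))
  moreover have "(\<lambda>x. \<Sum>v\<in>V. g v * (bary V v x * f x)) = (\<lambda>x. g x * f x)"
    by (rule ext, subst g) (simp add: sum_distrib_right mult.assoc)
  ultimately show ?thesis by simp
qed

lemma homogeneous_coord_mult:
  assumes "homogeneous n f"
  shows "homogeneous (Suc n) (\<lambda>x. x $ i * f x)"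
proof (rule homogeneous_affine_mult[OF assms])
  fix x
  have "x $ i = (\<Sum>v\<in>V. bary V v x *\<^sub>R v) $ i" by (simp add: bary_combination)
  then show "x $ i = (\<Sum>v\<in>V. v $ i * bary V v x)" by (simp add: mult.commute)
qed

lemma homogeneous_Suc:
  assumes "homogeneous n f"
  shows "homogeneous (Suc n) f"
  using homogeneous_affine_mult[OF assms, of "\<lambda>_. 1"] by (simp add: sum_bary)

lemma homogeneous_mono:
  assumes "homogeneous m f" "m \<le> n"
  shows "homogeneous n f"
  using assms(2,1) by (induction n rule: dec_induct) (auto intro: homogeneous_Suc)

lemma homogeneous_const: "homogeneous 0 (\<lambda>_. r)"
proof -
  have "homogeneous_indices V 0 = {\<lambda>_. 0}" using fin by (auto simp: homogeneous_indices_def)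
  then show ?thesis unfolding homogeneous_def by (intro exI[of _ "\<lambda>_. r"]) simp
qed

lemma homogeneous_power_mult:
  assumes "homogeneous n f"
  shows "homogeneous (n + a) (\<lambda>x. (x $ i) ^ a * f x)"
proof (induction a)
  case (Suc a)
  show ?case using homogeneous_coord_mult[OF Suc, of i] by (simp add: mult.assoc)
qed (use assms in simp)

lemma homogeneous_monomial:
  assumes "finite I"
  shows "homogeneous (sum \<alpha> I) (\<lambda>x. \<Prod>i\<in>I. (x $ i) ^ \<alpha> i)"
  using assms
proof (induction I)
  case empty
  then show ?case using homogeneous_const by simp
next
  case (insert i I)
  then show ?case using homogeneous_power_mult[of "sum \<alpha> I" _ "\<alpha> i" i] by (simp add: add.commute)
qed

lemma homogeneous_polynomial:
  assumes "polynomial_of_degree_le k p"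
  shows "homogeneous k p"
proof -
  obtain c where c: "\<And>x. p x = (\<Sum>\<alpha>\<in>multi_indices k. c \<alpha> * (\<Prod>i\<in>UNIV. (x $ i) ^ \<alpha> i))"
    using assms by (auto simp: polynomial_of_degree_le_def)
  have "homogeneous k (\<lambda>x. \<Sum>\<alpha>\<in>multi_indices k. c \<alpha> * (\<Prod>i\<in>UNIV. (x $ i) ^ \<alpha> i))"
  proof (intro homogeneous_sum homogeneous_scale)
    fix \<alpha> :: "'d \<Rightarrow> nat" assume "\<alpha> \<in> multi_indices k"
    then show "homogeneous k (\<lambda>x. \<Prod>i\<in>UNIV. (x $ i) ^ \<alpha> i)"
      by (intro homogeneous_mono[OF homogeneous_monomial]) (auto simp: multi_indices_def)
  qed
  then show ?thesis using c by presburger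
qed

text \<open>Homogeneity extends the identity from barycentric coordinates, which sum up to 1, to all positive arguments.\<close>

lemma bernstein_unique:
  assumes "C \<subseteq> V" "C \<noteq> {}"
    and eq: "\<And>x. x \<in> convex hull C \<Longrightarrow>
      (\<Sum>\<alpha>\<in>homogeneous_indices C n. c \<alpha> * (\<Prod>v\<in>C. bary V v x ^ \<alpha> v)) =
      (\<Sum>\<alpha>\<in>homogeneous_indices C n. c' \<alpha> * (\<Prod>v\<in>C. bary V v x ^ \<alpha> v))"
    and "\<alpha> \<in> homogeneous_indices C n"
  shows "c \<alpha> = c' \<alpha>"
proof -
  have fC: "finite C" using assms(1) fin finite_subset by blast
  have "c \<alpha> - c' \<alpha> = 0"
  proof (rule monomials_independent[OF fC finite_homogeneous_indices[OF fC, of n], of "\<lambda>\<alpha>. c \<alpha> - c' \<alpha>"])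
    show "inj_on (\<lambda>\<alpha>. restrict \<alpha> C) (homogeneous_indices C n)"
    proof (rule inj_onI, rule ext)
      fix \<beta> \<gamma> v assume "\<beta> \<in> homogeneous_indices C n" "\<gamma> \<in> homogeneous_indices C n"
        "restrict \<beta> C = restrict \<gamma> C"
      then show "\<beta> v = \<gamma> v"
        by (cases "v \<in> C") (auto simp: homogeneous_indices_def dest: fun_cong[of _ _ v])
    qed
    fix y :: "real^'d \<Rightarrow> real" assume y: "\<And>v. 0 < y v"
    define s where "s = sum y C"
    have s: "0 < s" unfolding s_def using assms(2) fC y by (intro sum_pos) auto
    define x where "x = (\<Sum>v\<in>C. (y v / s) *\<^sub>R v)"
    have one: "(\<Sum>v\<in>C. y v / s) = 1" using s by (simp add: s_def flip: sum_divide_distrib)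
    have "x \<in> convex hull C"
      unfolding convex_hull_finite[OF fC] x_def using one y s
      by (intro CollectI exI[of _ "\<lambda>v. y v / s"]) (auto simp: less_imp_le)
    have "bary V w x = y w / s" if "w \<in> C" for w
    proof -
      have "bary V w x = (\<Sum>v\<in>C. y v / s * bary V w v)"
        unfolding x_def by (rule bary_affine_sum[OF fC one])
      also have "\<dots> = (\<Sum>v\<in>C. if w = v then y w / s else 0)"
        by (rule sum.cong) (use assms(1) bary_vertex in auto)
      finally show ?thesis using that fC by simp
    qed
    then have yb: "y w = s * bary V w x" if "w \<in> C" for w using that s by simp
    have mono: "(\<Prod>v\<in>C. y v ^ \<beta> v) = s ^ n * (\<Prod>v\<in>C. bary V v x ^ \<beta> v)"
      if "\<beta> \<in> homogeneous_indices C n" for \<beta>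
    proof -
      have "(\<Prod>v\<in>C. y v ^ \<beta> v) = (\<Prod>v\<in>C. s ^ \<beta> v * bary V v x ^ \<beta> v)"
        by (rule prod.cong) (auto simp: yb power_mult_distrib)
      also have "\<dots> = s ^ n * (\<Prod>v\<in>C. bary V v x ^ \<beta> v)"
        using that by (simp add: prod.distrib power_sum[symmetric] homogeneous_indices_def)
      finally show ?thesis .
    qed
    have "(\<Sum>\<beta>\<in>homogeneous_indices C n. (c \<beta> - c' \<beta>) * (\<Prod>v\<in>C. y v ^ \<beta> v)) =
      (\<Sum>\<beta>\<in>homogeneous_indices C n. s ^ n * (c \<beta> * (\<Prod>v\<in>C. bary V v x ^ \<beta> v) - c' \<beta> * (\<Prod>v\<in>C. bary V v x ^ \<beta> v)))"
      by (rule sum.cong) (auto simp: mono algebra_simps)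
    also have "\<dots> = 0"
      using eq[OF \<open>x \<in> convex hull C\<close>] by (simp add: sum_subtractf flip: sum_distrib_left)
    finally show "(\<Sum>\<beta>\<in>homogeneous_indices C n. (c \<beta> - c' \<beta>) * (\<Prod>v\<in>C. y v ^ \<beta> v)) = 0" .
  qed (rule assms(4))
  then show ?thesis by simp
qed

end

section \<open>Gluing the local Bernstein expansions\<close>

context mesh
begin

definition supp :: "(real^'d \<Rightarrow> nat) \<Rightarrow> (real^'d) set" where
  "supp \<alpha> = {v. \<alpha> v \<noteq> 0}"

definition mesh_indices :: "nat \<Rightarrow> (real^'d \<Rightarrow> nat) set" where
  "mesh_indices k = (\<Union>T\<in>\<T>. homogeneous_indices (vertices T) k)"

lemma finite_mesh_indices: "finite (mesh_indices k)"
  unfolding mesh_indices_def using finite_mesh finite_vertices finite_homogeneous_indices by blast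

text \<open>On the face all coordinates outside \<open>C\<close> are zero, which removes every
  monomial with an exponent outside \<open>C\<close>.\<close>

lemma restrict_to_face:
  assumes T: "T \<in> \<T>" and C: "C \<subseteq> vertices T" and x: "x \<in> convex hull C"
  shows "(\<Sum>\<alpha>\<in>homogeneous_indices (vertices T) k. c \<alpha> * (\<Prod>v\<in>vertices T. bc T v x ^ \<alpha> v)) =
    (\<Sum>\<alpha>\<in>homogeneous_indices C k. c \<alpha> * (\<Prod>v\<in>C. bc T v x ^ \<alpha> v))"
proof -
  interpret A: affine_frame "vertices T" using frame T by blast
  have z: "bc T v x = 0" if "v \<notin> C" for v using A.in_hull_iff[OF C] x that by blast
  have "(\<Sum>\<alpha>\<in>homogeneous_indices (vertices T) k. c \<alpha> * (\<Prod>v\<in>vertices T. bc T v x ^ \<alpha> v)) =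
    (\<Sum>\<alpha>\<in>homogeneous_indices C k. c \<alpha> * (\<Prod>v\<in>vertices T. bc T v x ^ \<alpha> v))"
  proof (rule sum.mono_neutral_right)
    show "finite (homogeneous_indices (vertices T) k)"
      using finite_homogeneous_indices A.fin by blast
    have "sum \<alpha> C = sum \<alpha> (vertices T)" if "\<forall>v. v \<notin> C \<longrightarrow> \<alpha> v = 0" for \<alpha> :: "real^'d \<Rightarrow> nat"
      by (rule sum.mono_neutral_left) (use A.fin C that in auto)
    then show "homogeneous_indices C k \<subseteq> homogeneous_indices (vertices T) k"
      using C by (auto simp: homogeneous_indices_def)
    show "\<forall>\<alpha>\<in>homogeneous_indices (vertices T) k - homogeneous_indices C k.
        c \<alpha> * (\<Prod>v\<in>vertices T. bc T v x ^ \<alpha> v) = 0"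
    proof
      fix \<alpha> assume a: "\<alpha> \<in> homogeneous_indices (vertices T) k - homogeneous_indices C k"
      have "\<exists>v. v \<notin> C \<and> \<alpha> v \<noteq> 0"
      proof (rule ccontr)
        assume "\<not> (\<exists>v. v \<notin> C \<and> \<alpha> v \<noteq> 0)"
        moreover from this have "sum \<alpha> C = sum \<alpha> (vertices T)"
          by (intro sum.mono_neutral_left) (use A.fin C in auto)
        ultimately show False using a by (auto simp: homogeneous_indices_def)
      qed
      then obtain v where v: "v \<notin> C" "\<alpha> v \<noteq> 0" by blast
      then have "v \<in> vertices T" using a by (auto simp: homogeneous_indices_def)
      then have "(\<Prod>v\<in>vertices T. bc T v x ^ \<alpha> v) = 0"
        using A.fin z[OF v(1)] v(2) by (intro prod_zero) auto
      then show "c \<alpha> * (\<Prod>v\<in>vertices T. bc T v x ^ \<alpha> v) = 0" by simp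
    qed
  qed
  also have "\<dots> = (\<Sum>\<alpha>\<in>homogeneous_indices C k. c \<alpha> * (\<Prod>v\<in>C. bc T v x ^ \<alpha> v))"
  proof (rule sum.cong[OF refl])
    fix \<alpha> assume a: "\<alpha> \<in> homogeneous_indices C k"
    have "(\<Prod>v\<in>vertices T. bc T v x ^ \<alpha> v) = (\<Prod>v\<in>C. bc T v x ^ \<alpha> v)"
      by (rule prod.mono_neutral_right) (use A.fin C a in \<open>auto simp: homogeneous_indices_def\<close>)
    then show "c \<alpha> * (\<Prod>v\<in>vertices T. bc T v x ^ \<alpha> v) = c \<alpha> * (\<Prod>v\<in>C. bc T v x ^ \<alpha> v)" by simp
  qed
  finally show ?thesis .
qed

theorem bernstein_representation:
  assumes "lagrange_function k \<T> u" "1 \<le> k"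
  obtains c where "\<And>x. x \<in> \<Union>\<T> \<Longrightarrow> u x = (\<Sum>\<alpha>\<in>mesh_indices k. c \<alpha> * (\<Prod>v\<in>supp \<alpha>. hat v x ^ \<alpha> v))"
proof -
  have "\<exists>c. \<forall>x\<in>T. u x = (\<Sum>\<alpha>\<in>homogeneous_indices (vertices T) k. c \<alpha> * (\<Prod>v\<in>vertices T. bc T v x ^ \<alpha> v))"
    if T: "T \<in> \<T>" for T
  proof -
    interpret A: affine_frame "vertices T" using frame T by blast
    obtain p where p: "polynomial_of_degree_le k p" "\<forall>x\<in>T. u x = p x"
      using assms(1) T by (auto simp: lagrange_function_def)
    obtain c where "\<forall>x. p x = (\<Sum>\<alpha>\<in>homogeneous_indices (vertices T) k. c \<alpha> * (\<Prod>v\<in>vertices T. bc T v x ^ \<alpha> v))"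
      using A.homogeneous_polynomial[OF p(1)] unfolding A.homogeneous_def by blast
    then show ?thesis using p(2) by (intro exI[of _ c]) simp
  qed
  then have "\<forall>T\<in>\<T>. \<exists>c. \<forall>x\<in>T. u x = (\<Sum>\<alpha>\<in>homogeneous_indices (vertices T) k. c \<alpha> * (\<Prod>v\<in>vertices T. bc T v x ^ \<alpha> v))"
    by (rule ballI)
  from bchoice[OF this] obtain c where c: "\<forall>T\<in>\<T>. \<forall>x\<in>T.
      u x = (\<Sum>\<alpha>\<in>homogeneous_indices (vertices T) k. c T \<alpha> * (\<Prod>v\<in>vertices T. bc T v x ^ \<alpha> v))" ..
  note c = c[rule_format]
  have consistent: "c T \<alpha> = c T' \<alpha>"
    if T: "T \<in> \<T>" "T' \<in> \<T>" and a: "\<alpha> \<in> homogeneous_indices (vertices T) k" "\<alpha> \<in> homogeneous_indices (vertices T') k"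
    for T T' \<alpha>
  proof -
    interpret A: affine_frame "vertices T" using frame T by blast
    let ?C = "vertices T \<inter> vertices T'"
    have "sum \<alpha> ?C = sum \<alpha> (vertices T)"
      by (rule sum.mono_neutral_left) (use A.fin a in \<open>auto simp: homogeneous_indices_def\<close>)
    then have aC: "\<alpha> \<in> homogeneous_indices ?C k" using a by (auto simp: homogeneous_indices_def)
    \<comment> \<open>An index of positive degree has nonempty support, so the shared face on which
      the coefficients are compared is not empty.\<close>
    then have "?C \<noteq> {}" using assms(2) by (auto simp: homogeneous_indices_def)
    show ?thesis
    proof (rule A.bernstein_unique[OF _ \<open>?C \<noteq> {}\<close> _ aC])
      fix x assume x: "x \<in> convex hull ?C"
      then have xT: "x \<in> T" "x \<in> T'" using cell_Int[OF T] by auto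
      have "(\<Sum>\<alpha>\<in>homogeneous_indices ?C k. c T \<alpha> * (\<Prod>v\<in>?C. bc T v x ^ \<alpha> v)) = u x"
        using c[OF T(1) xT(1)] restrict_to_face[OF T(1) _ x] by simp
      also have "\<dots> = (\<Sum>\<alpha>\<in>homogeneous_indices ?C k. c T' \<alpha> * (\<Prod>v\<in>?C. bc T' v x ^ \<alpha> v))"
        using c[OF T(2) xT(2)] restrict_to_face[OF T(2) _ x] by simp
      finally show "(\<Sum>\<alpha>\<in>homogeneous_indices ?C k. c T \<alpha> * (\<Prod>v\<in>?C. bc T v x ^ \<alpha> v)) =
        (\<Sum>\<alpha>\<in>homogeneous_indices ?C k. c T' \<alpha> * (\<Prod>v\<in>?C. bc T v x ^ \<alpha> v))"
        using bc_eq[OF T xT] by simp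
    qed simp
  qed
  define C where "C \<alpha> = c (SOME T. T \<in> \<T> \<and> \<alpha> \<in> homogeneous_indices (vertices T) k) \<alpha>" for \<alpha>
  have C: "C \<alpha> = c T \<alpha>" if "T \<in> \<T>" "\<alpha> \<in> homogeneous_indices (vertices T) k" for T \<alpha>
  proof -
    let ?P = "\<lambda>T. T \<in> \<T> \<and> \<alpha> \<in> homogeneous_indices (vertices T) k"
    have "?P (SOME T. ?P T)" by (rule someI[of ?P T]) (use that in blast)
    then show ?thesis unfolding C_def using consistent that by blast
  qed
  have "u x = (\<Sum>\<alpha>\<in>mesh_indices k. C \<alpha> * (\<Prod>v\<in>supp \<alpha>. hat v x ^ \<alpha> v))" if x: "x \<in> \<Union>\<T>" for x
  proof -
    obtain T where T: "T \<in> \<T>" "x \<in> T" using x by blast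
    interpret A: affine_frame "vertices T" using frame T by blast
    have h: "hat v x = bc T v x" for v by (rule hat_eq[OF T])
    have "(\<Sum>\<alpha>\<in>mesh_indices k. C \<alpha> * (\<Prod>v\<in>supp \<alpha>. hat v x ^ \<alpha> v)) =
        (\<Sum>\<alpha>\<in>homogeneous_indices (vertices T) k. C \<alpha> * (\<Prod>v\<in>supp \<alpha>. hat v x ^ \<alpha> v))"
    proof (rule sum.mono_neutral_right[OF finite_mesh_indices])
      show "homogeneous_indices (vertices T) k \<subseteq> mesh_indices k" using T by (auto simp: mesh_indices_def)
      show "\<forall>\<alpha>\<in>mesh_indices k - homogeneous_indices (vertices T) k. C \<alpha> * (\<Prod>v\<in>supp \<alpha>. hat v x ^ \<alpha> v) = 0"
      proof
        fix \<alpha> assume a: "\<alpha> \<in> mesh_indices k - homogeneous_indices (vertices T) k"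
        then obtain T' where T': "T' \<in> \<T>" "\<alpha> \<in> homogeneous_indices (vertices T') k"
          by (auto simp: mesh_indices_def)
        have sup: "supp \<alpha> \<subseteq> vertices T'" using T'(2) by (auto simp: supp_def homogeneous_indices_def)
        \<comment> \<open>A monomial that does not belong to \<open>T\<close> has a support vertex
          outside \<open>T\<close>, whose hat function vanishes on \<open>T\<close>.\<close>
        have "\<not> supp \<alpha> \<subseteq> vertices T"
        proof
          assume s: "supp \<alpha> \<subseteq> vertices T"
          have "sum \<alpha> (supp \<alpha>) = sum \<alpha> (vertices T)" "sum \<alpha> (supp \<alpha>) = sum \<alpha> (vertices T')"
            by (rule sum.mono_neutral_left; use s sup A.fin finite_vertices T' in \<open>auto simp: supp_def\<close>)+
          then have "\<alpha> \<in> homogeneous_indices (vertices T) k"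
            using s T'(2) by (auto simp: homogeneous_indices_def supp_def)
          then show False using a by blast
        qed
        then obtain v where v: "v \<in> supp \<alpha>" "v \<notin> vertices T" by blast
        then have "hat v x = 0" using h A.bary_outside by simp
        moreover have "finite (supp \<alpha>)" using sup finite_vertices T' finite_subset by blast
        ultimately have "(\<Prod>v\<in>supp \<alpha>. hat v x ^ \<alpha> v) = 0"
          using v by (intro prod_zero) (auto simp: supp_def)
        then show "C \<alpha> * (\<Prod>v\<in>supp \<alpha>. hat v x ^ \<alpha> v) = 0" by simp
      qed
    qed
    also have "\<dots> = (\<Sum>\<alpha>\<in>homogeneous_indices (vertices T) k. c T \<alpha> * (\<Prod>v\<in>vertices T. bc T v x ^ \<alpha> v))"
    proof (rule sum.cong[OF refl])
      fix \<alpha> assume a: "\<alpha> \<in> homogeneous_indices (vertices T) k"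
      have "(\<Prod>v\<in>supp \<alpha>. bc T v x ^ \<alpha> v) = (\<Prod>v\<in>vertices T. bc T v x ^ \<alpha> v)"
        by (rule prod.mono_neutral_left) (use A.fin a in \<open>auto simp: supp_def homogeneous_indices_def\<close>)
      then show "C \<alpha> * (\<Prod>v\<in>supp \<alpha>. hat v x ^ \<alpha> v) = c T \<alpha> * (\<Prod>v\<in>vertices T. bc T v x ^ \<alpha> v)"
        using C[OF T(1) a] h by simp
    qed
    also have "\<dots> = u x" using c[OF T] by simp
    finally show ?thesis by simp
  qed
  then show ?thesis by (rule that)
qed

end

section \<open>Networks for the monomials\<close>

lemma le_two_power_log:
  assumes "1 \<le> m"
  shows "m \<le> 2 ^ nat \<lceil>log 2 (real m)\<rceil>"
proof -
  have "0 \<le> log 2 (real m)" using assms by simp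
  then have n: "real (nat \<lceil>log 2 (real m)\<rceil>) = of_int \<lceil>log 2 (real m)\<rceil>" by simp
  have "real m = 2 powr log 2 (real m)" using assms by simp
  also have "\<dots> \<le> 2 powr real (nat \<lceil>log 2 (real m)\<rceil>)" unfolding n by (intro powr_mono) auto
  also have "\<dots> = real (2 ^ nat \<lceil>log 2 (real m)\<rceil>)" by (simp add: powr_realpow)
  finally show ?thesis by (simp only: of_nat_le_iff)
qed

lemma ceiling_log_mono: "1 \<le> m \<Longrightarrow> m \<le> n \<Longrightarrow> \<lceil>log 2 (real m)\<rceil> \<le> \<lceil>log 2 (real n)\<rceil>"
  by (intro ceiling_mono) simp

lemma ceiling_log_nonneg: "1 \<le> m \<Longrightarrow> 0 \<le> \<lceil>log 2 (real m)\<rceil>"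
  using ceiling_log_mono[of 1 m] by simp

section \<open>Multi-indices as lattice points\<close>

context mesh
begin

text \<open>The point with barycentric coordinates \<open>\<alpha> v / k\<close>; near it the
  monomial of \<open>\<alpha>\<close> has to be reproduced.\<close>

definition node :: "nat \<Rightarrow> (real^'d \<Rightarrow> nat) \<Rightarrow> real^'d" where
  "node k \<alpha> = (1 / real k) *\<^sub>R (\<Sum>v\<in>supp \<alpha>. real (\<alpha> v) *\<^sub>R v)"

lemma mesh_indexE:
  assumes "\<alpha> \<in> mesh_indices k"
  obtains T where "T \<in> \<T>" "T \<in> cells (supp \<alpha>)" "supp \<alpha> \<subseteq> vertices T" "sum \<alpha> (vertices T) = k"
  using assms by (fastforce simp: mesh_indices_def homogeneous_indices_def cells_def supp_def)

lemma sum_supp: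
  assumes "\<alpha> \<in> mesh_indices k"
  shows "finite (supp \<alpha>)" "sum \<alpha> (supp \<alpha>) = k" "card (supp \<alpha>) \<le> CARD('d) + 1" "cells (supp \<alpha>) \<noteq> {}"
proof -
  obtain T where T: "T \<in> \<T>" "T \<in> cells (supp \<alpha>)" "supp \<alpha> \<subseteq> vertices T" "sum \<alpha> (vertices T) = k"
    using mesh_indexE[OF assms] .
  show "finite (supp \<alpha>)" using T finite_vertices finite_subset by blast
  have "sum \<alpha> (supp \<alpha>) = sum \<alpha> (vertices T)"
    by (rule sum.mono_neutral_left) (use T finite_vertices in \<open>auto simp: supp_def\<close>)
  then show "sum \<alpha> (supp \<alpha>) = k" using T by simp
  show "card (supp \<alpha>) \<le> CARD('d) + 1" using card_mono[OF finite_vertices T(3)] T card_vertices by simp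
  show "cells (supp \<alpha>) \<noteq> {}" using T by blast
qed

lemma card_cells_pos: "\<alpha> \<in> mesh_indices k \<Longrightarrow> 1 \<le> card (cells (supp \<alpha>))"
  using sum_supp(4) finite_cells by (simp add: Suc_le_eq card_gt_0_iff)

lemma supp_nonempty: "\<alpha> \<in> mesh_indices k \<Longrightarrow> 1 \<le> k \<Longrightarrow> supp \<alpha> \<noteq> {}"
  using sum_supp(2) by fastforce

lemma bc_node:
  assumes a: "\<alpha> \<in> mesh_indices k" and k: "1 \<le> k" and T: "T \<in> cells (supp \<alpha>)"
  shows "bc T v (node k \<alpha>) = real (\<alpha> v) / real k" "node k \<alpha> \<in> T"
proof -
  have T': "T \<in> \<T>" "supp \<alpha> \<subseteq> vertices T" using T by (auto simp: cells_def)
  interpret A: affine_frame "vertices T" using frame T' by blast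
  note fin = sum_supp(1)[OF a]
  have one: "(\<Sum>v\<in>supp \<alpha>. real (\<alpha> v) / real k) = 1"
    using sum_supp(2)[OF a] k by (simp flip: sum_divide_distrib of_nat_sum)
  have n: "node k \<alpha> = (\<Sum>v\<in>supp \<alpha>. (real (\<alpha> v) / real k) *\<^sub>R v)"
    by (simp add: node_def scaleR_sum_right)
  have *: "bc T v (node k \<alpha>) = real (\<alpha> v) / real k" for v
  proof -
    have "bc T v (node k \<alpha>) = (\<Sum>w\<in>supp \<alpha>. real (\<alpha> w) / real k * bc T v w)"
      unfolding n by (rule A.bary_affine_sum[OF fin one])
    also have "\<dots> = (\<Sum>w\<in>supp \<alpha>. if v = w then real (\<alpha> v) / real k else 0)"
      by (rule sum.cong) (use T'(2) A.bary_vertex in auto)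
    also have "\<dots> = real (\<alpha> v) / real k" using fin by (simp add: supp_def)
    finally show ?thesis .
  qed
  then show "bc T v (node k \<alpha>) = real (\<alpha> v) / real k" .
  show "node k \<alpha> \<in> T" using * in_cell_iff[OF T'(1)] by simp
qed

text \<open>The coordinates of the node are the same in every cell that contains it and are positive
  on the support, so the support consists of vertices of such a cell.\<close>

lemma cells_node:
  assumes a: "\<alpha> \<in> mesh_indices k" and k: "1 \<le> k"
  shows "{T \<in> \<T>. node k \<alpha> \<in> T} = cells (supp \<alpha>)"
proof
  show "cells (supp \<alpha>) \<subseteq> {T \<in> \<T>. node k \<alpha> \<in> T}"
    using bc_node(2)[OF a k] by (auto simp: cells_def)
  obtain T where T: "T \<in> \<T>" "T \<in> cells (supp \<alpha>)" using mesh_indexE[OF a] .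
  show "{T \<in> \<T>. node k \<alpha> \<in> T} \<subseteq> cells (supp \<alpha>)"
  proof
    fix T' assume T': "T' \<in> {T \<in> \<T>. node k \<alpha> \<in> T}"
    have "v \<in> vertices T'" if "v \<in> supp \<alpha>" for v
    proof (rule bc_pos_vertex)
      have "bc T' v (node k \<alpha>) = real (\<alpha> v) / real k"
        using bc_eq[OF T(1) _ bc_node(2)[OF a k T(2)], of T' v] bc_node(1)[OF a k T(2)] T' by simp
      then show "0 < bc T' v (node k \<alpha>)" using that k by (simp add: supp_def)
    qed (use T' in simp)
    then show "T' \<in> cells (supp \<alpha>)" using T' by (auto simp: cells_def)
  qed
qed

lemma inj_node:
  assumes "1 \<le> k"
  shows "inj_on (node k) (mesh_indices k)"
proof (rule inj_onI, rule ext)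
  fix \<alpha> \<beta> v assume a: "\<alpha> \<in> mesh_indices k" "\<beta> \<in> mesh_indices k" "node k \<alpha> = node k \<beta>"
  have c: "cells (supp \<alpha>) = cells (supp \<beta>)" using cells_node[OF a(1) assms] cells_node[OF a(2) assms] a(3) by simp
  obtain T where T: "T \<in> cells (supp \<alpha>)" using mesh_indexE[OF a(1)] .
  have "real (\<alpha> v) / real k = real (\<beta> v) / real k"
    using bc_node(1)[OF a(1) assms T, of v] bc_node(1)[OF a(2) assms T[unfolded c], of v] a(3) by metis
  then show "\<alpha> v = \<beta> v" using assms by simp
qed

text \<open>All weights on the support are positive, which places the node in the relative interior
  of the face spanned by it; hence the dimension \<open>card (supp \<alpha>) - 1\<close>.\<close>

lemma node_lattice:
  assumes a: "\<alpha> \<in> mesh_indices k" and k: "1 \<le> k"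
  shows "node k \<alpha> \<in> lattice_on k (card (supp \<alpha>) - 1) \<T>"
proof -
  obtain T where T: "T \<in> \<T>" "T \<in> cells (supp \<alpha>)" "supp \<alpha> \<subseteq> vertices T" "sum \<alpha> (vertices T) = k"
    using mesh_indexE[OF a] .
  interpret A: affine_frame "vertices T" using frame T by blast
  note fin = sum_supp(1)[OF a]
  have "(\<Sum>v\<in>supp \<alpha>. real (\<alpha> v) *\<^sub>R v) = (\<Sum>v\<in>vertices T. real (\<alpha> v) *\<^sub>R v)"
    by (rule sum.mono_neutral_left) (use T A.fin in \<open>auto simp: supp_def\<close>)
  then have "node k \<alpha> \<in> lattice_simplex k T"
    unfolding lattice_simplex_def node_def mem_Collect_eq using T(4) by (intro exI[of _ \<alpha>]) simp
  then have l: "node k \<alpha> \<in> lattice k \<T>" using T by (auto simp: lattice_def)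
  have "\<not> affine_dependent (supp \<alpha>)" using T(3) A.indep affine_independent_subset by blast
  then have ri: "rel_interior (convex hull (supp \<alpha>)) =
      {y. \<exists>u. (\<forall>x\<in>supp \<alpha>. 0 < u x) \<and> sum u (supp \<alpha>) = 1 \<and> (\<Sum>x\<in>supp \<alpha>. u x *\<^sub>R x) = y}"
    by (rule rel_interior_convex_hull_explicit)
  have "node k \<alpha> \<in> rel_interior (convex hull (supp \<alpha>))"
    unfolding ri
  proof (intro CollectI exI conjI)
    show "(\<Sum>v\<in>supp \<alpha>. real (\<alpha> v) / real k) = 1"
      using sum_supp(2)[OF a] k by (simp flip: sum_divide_distrib of_nat_sum)
    show "(\<Sum>v\<in>supp \<alpha>. (real (\<alpha> v) / real k) *\<^sub>R v) = node k \<alpha>"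
      by (simp add: node_def scaleR_sum_right)
    show "\<forall>v\<in>supp \<alpha>. 0 < real (\<alpha> v) / real k" using k by (simp add: supp_def)
  qed
  moreover have "convex hull (supp \<alpha>) \<in> subsimplices (card (supp \<alpha>) - 1) \<T>"
  proof -
    have "0 < card (supp \<alpha>)" using fin supp_nonempty[OF a k] by (simp add: card_gt_0_iff)
    then show ?thesis unfolding subsimplices_def using T by auto
  qed
  ultimately show ?thesis using l by (auto simp: lattice_on_def)
qed

text \<open>Provides finiteness of the lattice, without which \<open>card\<close> and
  \<open>Max\<close> in \<open>eta\<close> and \<open>tau\<close> would say nothing.\<close>

lemma lattice_subset_nodes: "lattice k \<T> \<subseteq> node k ` mesh_indices k"
proof
  fix p assume "p \<in> lattice k \<T>"
  then obtain T \<alpha> where T: "T \<in> \<T>" and p: "p = (1 / real k) *\<^sub>R (\<Sum>v\<in>vertices T. real (\<alpha> v) *\<^sub>R v)"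
    and s: "(\<Sum>v\<in>vertices T. \<alpha> v) = k"
    by (auto simp: lattice_def lattice_simplex_def)
  \<comment> \<open>The weights of a lattice point are arbitrary off the vertices of
    \<open>T\<close>, whereas indices must vanish there.\<close>
  define \<beta> where "\<beta> v = (if v \<in> vertices T then \<alpha> v else 0)" for v
  have "\<beta> \<in> mesh_indices k" using T s by (auto simp: mesh_indices_def homogeneous_indices_def \<beta>_def)
  moreover have "p = node k \<beta>"
  proof -
    have "(\<Sum>v\<in>supp \<beta>. real (\<beta> v) *\<^sub>R v) = (\<Sum>v\<in>vertices T. real (\<beta> v) *\<^sub>R v)"
      by (rule sum.mono_neutral_left) (use finite_vertices[OF T] in \<open>auto simp: supp_def \<beta>_def\<close>)
    also have "\<dots> = (\<Sum>v\<in>vertices T. real (\<alpha> v) *\<^sub>R v)"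
      by (rule sum.cong) (auto simp: \<beta>_def)
    finally show ?thesis by (simp add: p node_def)
  qed
  ultimately show "p \<in> node k ` mesh_indices k" by blast
qed

lemma finite_lattice_on: "finite (lattice_on k l \<T>)"
proof -
  have "finite (lattice k \<T>)"
    using lattice_subset_nodes finite_mesh_indices by (meson finite_imageI finite_subset)
  then show ?thesis by (rule rev_finite_subset) (auto simp: lattice_on_def)
qed

lemma card_indices_le_eta:
  assumes "1 \<le> k"
  shows "card {\<alpha> \<in> mesh_indices k. card (supp \<alpha>) - 1 = l} \<le> eta k \<T> l"
  unfolding eta_def
proof (rule card_inj_on_le[of "node k"])
  show "inj_on (node k) {\<alpha> \<in> mesh_indices k. card (supp \<alpha>) - 1 = l}"
    using inj_node[OF assms] by (rule inj_on_subset) auto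
qed (use node_lattice[OF _ assms] finite_lattice_on in auto)

lemma eta_nonzero:
  assumes "\<alpha> \<in> mesh_indices k" "1 \<le> k"
  shows "eta k \<T> (card (supp \<alpha>) - 1) \<noteq> 0"
  using node_lattice[OF assms] finite_lattice_on by (auto simp: eta_def)

lemma card_cells_le_tau:
  assumes "\<alpha> \<in> mesh_indices k" "1 \<le> k"
  shows "card (cells (supp \<alpha>)) \<le> tau k \<T> (card (supp \<alpha>) - 1)"
proof -
  have "tau_point \<T> (node k \<alpha>) \<le> tau k \<T> (card (supp \<alpha>) - 1)"
    unfolding tau_def using finite_lattice_on node_lattice[OF assms] by (intro Max_ge) auto
  then show ?thesis by (simp add: tau_point_def cells_node[OF assms])
qed

lemma tau_pos:
  assumes "eta k \<T> l \<noteq> 0" "1 \<le> k"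
  shows "1 \<le> tau k \<T> l"
proof -
  obtain p where p: "p \<in> lattice_on k l \<T>" using assms(1) by (fastforce simp: eta_def)
  then obtain \<alpha> where a: "\<alpha> \<in> mesh_indices k" "p = node k \<alpha>"
    using lattice_subset_nodes by (auto simp: lattice_on_def)
  have "1 \<le> tau_point \<T> p"
    using card_cells_pos[OF a(1)] cells_node[OF a(1) assms(2)] a(2) by (simp add: tau_point_def)
  also have "\<dots> \<le> tau k \<T> l" unfolding tau_def using finite_lattice_on p by (intro Max_ge) auto
  finally show ?thesis .
qed

lemma vertex_index:
  assumes "T \<in> \<T>" "v \<in> vertices T" "1 \<le> k"
  shows "(\<lambda>w. if w = v then k else 0) \<in> mesh_indices k" "supp (\<lambda>w. if w = v then k else 0) = {v}"
  using assms finite_vertices by (auto simp: mesh_indices_def homogeneous_indices_def supp_def)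

text \<open>A cell containing the whole support contains any single vertex \<open>v\<close> of it,
  and \<open>v\<close> is itself a lattice point, namely the node of the index with value
  \<open>k\<close> at \<open>v\<close>.\<close>

lemma card_cells_le_tau_0:
  assumes a: "\<alpha> \<in> mesh_indices k" and k: "1 \<le> k"
  shows "card (cells (supp \<alpha>)) \<le> tau k \<T> 0"
proof -
  obtain T where T: "T \<in> \<T>" "T \<in> cells (supp \<alpha>)" "supp \<alpha> \<subseteq> vertices T" "sum \<alpha> (vertices T) = k"
    using mesh_indexE[OF a] .
  obtain v where v: "v \<in> supp \<alpha>" using supp_nonempty[OF a k] by blast
  then have "card (cells (supp \<alpha>)) \<le> card (cells {v})"
    by (intro card_mono finite_cells) (auto simp: cells_def)
  also have "\<dots> \<le> tau k \<T> 0"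
    using card_cells_le_tau[OF vertex_index(1)[OF T(1) _ k, of v] k] vertex_index(2)[OF T(1) _ k, of v] v T(3)
    by auto
  finally show ?thesis .
qed

section \<open>A block of layers for one monomial\<close>

lemma bdd_coords_mesh: "bdd_funs (\<Union>\<T>) coords"
  by (intro bdd_coords compact_imp_bounded compact_mesh)

text \<open>Outside the family the true product is zero, because the cell of \<open>x\<close> misses
  some support vertex; exponents on the support are positive, so one vanishing surrogate is
  enough.\<close>

lemma prod_hat_eq:
  assumes a: "\<alpha> \<in> mesh_indices k" and x: "x \<in> \<Union>\<T>"
    and inside: "\<And>T v. T \<in> cells (supp \<alpha>) \<Longrightarrow> x \<in> T \<Longrightarrow> v \<in> supp \<alpha> \<Longrightarrow> r v = hat v x"
    and outside: "\<forall>T\<in>cells (supp \<alpha>). x \<notin> T \<Longrightarrow> \<exists>v\<in>supp \<alpha>. r v = 0"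
  shows "(\<Prod>v\<in>supp \<alpha>. r v ^ \<alpha> v) = (\<Prod>v\<in>supp \<alpha>. hat v x ^ \<alpha> v)"
proof (cases "\<exists>T\<in>cells (supp \<alpha>). x \<in> T")
  case True
  then show ?thesis using inside by (intro prod.cong) auto
next
  case False
  have zero: "(\<Prod>v\<in>supp \<alpha>. f v ^ \<alpha> v) = 0" if "\<exists>v\<in>supp \<alpha>. f v = 0" for f :: "real^'d \<Rightarrow> real"
    using that sum_supp(1)[OF a] by (auto simp: supp_def)
  obtain T where T: "T \<in> \<T>" "x \<in> T" using x by blast
  then obtain v where v: "v \<in> supp \<alpha>" "v \<notin> vertices T" using False by (auto simp: cells_def)
  then have "hat v x = 0" using hat_eq[OF T] affine_frame.bary_outside[OF frame[OF T(1)]] by simp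
  then show ?thesis using zero[of r] zero[of "\<lambda>v. hat v x"] outside False v(1) by (metis (no_types))
qed

lemma reach_relus:
  assumes "finite C" "\<And>v. v \<in> C \<Longrightarrow> f v \<in> aff D S"
  shows "reach D (card C) (Suc 0) S ((\<lambda>v x. relu (f v x)) ` C)"
  using reach_UN[OF assms(1), of D 1 "Suc 0" S "\<lambda>v. {\<lambda>x. relu (f v x)}"] layer_relu[OF assms(2)]
  by (simp add: reach_layer UNION_singleton_eq_range del: reach.simps)

text \<open>The depth splits into \<open>s\<close> for the minima over the cells, one layer of
  positive parts and \<open>m\<close> for the product of \<open>k\<close> factors.\<close>

lemma reach_convex:
  assumes vc: "vertex_convex \<T>" and conv: "convex (\<Union>\<T>)"
    and a: "\<alpha> \<in> mesh_indices k" and k: "1 \<le> k"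
    and s: "card (cells (supp \<alpha>)) \<le> 2 ^ s" and m: "k \<le> 2 ^ m"
    and W: "card (supp \<alpha>) * card (cells (supp \<alpha>)) \<le> W" "k \<le> W"
  shows "reach (\<Union>\<T>) W (s + Suc m) coords {\<lambda>x. \<Prod>v\<in>supp \<alpha>. hat v x ^ \<alpha> v}"
proof -
  let ?D = "\<Union>\<T>" and ?C = "supp \<alpha>"
  let ?f = "\<lambda>v x. MIN T\<in>cells ?C. bc T v x"
  let ?r = "\<lambda>v x. relu (?f v x)"
  note C = sum_supp[OF a]
  have Wc: "card ?C \<le> W" using W(1) card_cells_pos[OF a] by (metis le_trans mult.right_neutral mult_le_mono2)
  have "reach ?D (card (cells ?C)) s coords {?f v}" for v
    by (rule reach_Min[OF bdd_coords_mesh finite_cells C(4) _ s])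
      (use frame affine_frame.bary_aff_coords in \<open>auto simp: cells_def\<close>)
  then have "reach ?D (card ?C * card (cells ?C)) s coords (\<Union>v\<in>?C. {?f v})"
    by (intro reach_UN C(1))
  then have 1: "reach ?D W s coords (?f ` ?C)"
    by (rule reach_mono) (use W in \<open>auto intro: aff_base\<close>)
  have "reach ?D (card ?C) (Suc 0) (?f ` ?C) (?r ` ?C)"
    by (rule reach_relus[OF C(1)]) (auto intro: aff_base)
  then have 2: "reach ?D W (Suc 0) (?f ` ?C) (?r ` ?C)"
    by (rule reach_mono) (use Wc in \<open>auto intro: aff_base\<close>)
  have "bdd_funs ?D (?r ` ?C)" using reach_bdd[OF 2 reach_bdd[OF 1 bdd_coords_mesh]] .
  then have "reach ?D k m (?r ` ?C) {\<lambda>x. \<Prod>v\<in>?C. ?r v x ^ \<alpha> v}"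
    by (rule reach_monomial[OF _ C(1) _ C(2) k m]) (auto intro: aff_base)
  moreover have "(\<lambda>x. \<Prod>v\<in>?C. hat v x ^ \<alpha> v) \<in> aff ?D {\<lambda>x. \<Prod>v\<in>?C. ?r v x ^ \<alpha> v}"
  proof (rule aff_cong[OF aff_base[OF singletonI]])
    fix x assume x: "x \<in> ?D"
    show "(\<Prod>v\<in>?C. hat v x ^ \<alpha> v) = (\<Prod>v\<in>?C. ?r v x ^ \<alpha> v)"
    proof (rule prod_hat_eq[OF a x, symmetric])
      show "?r v x = hat v x" if "T \<in> cells ?C" "x \<in> T" "v \<in> ?C" for T v
        using hat_min_inside[OF vc that(3,1,2)] .
      show "\<exists>v\<in>?C. ?r v x = 0" if "\<forall>T\<in>cells ?C. x \<notin> T"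
      proof (rule hat_min_outside[OF conv x C(4) _ _ that])
        show "node k \<alpha> \<in> T" if "T \<in> cells ?C" for T using bc_node(2)[OF a k that] .
        show "0 < bc T v (node k \<alpha>)" if "T \<in> cells ?C" "v \<in> ?C" for T v
          using bc_node(1)[OF a k that(1), of v] that(2) k by (simp add: supp_def)
      qed
    qed
  qed
  ultimately have 3: "reach ?D W m (?r ` ?C) {\<lambda>x. \<Prod>v\<in>?C. hat v x ^ \<alpha> v}"
    by (elim reach_mono) (use W in \<open>auto intro: aff_base\<close>)
  show ?thesis using reach_trans[OF 1 reach_trans[OF 2 3]] by simp
qed

text \<open>The depth splits into one layer of negative parts, \<open>s\<close> for the maxima, one
  layer of positive parts, \<open>m\<close> for the powers and \<open>t\<close> for their product.
  The inequality for \<open>m\<close> is strict because \<open>m\<close> binary digits represent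
  only exponents below \<open>2 ^ m\<close>.\<close>

lemma reach_general:
  assumes a: "\<alpha> \<in> mesh_indices k" and k: "1 \<le> k"
    and s: "card (cells (supp \<alpha>)) \<le> 2 ^ s" and m: "k < 2 ^ m" and t: "card (supp \<alpha>) \<le> 2 ^ t"
    and W: "(CARD('d) + 1) * card (cells (supp \<alpha>)) + CARD('d) \<le> W" "card (supp \<alpha>) * 3 \<le> W"
  shows "reach (\<Union>\<T>) W (Suc s + Suc (m + t)) coords {\<lambda>x. \<Prod>v\<in>supp \<alpha>. hat v x ^ \<alpha> v}"
proof -
  let ?D = "\<Union>\<T>" and ?C = "supp \<alpha>"
  note C = sum_supp[OF a]
  obtain M where M: "\<And>C v x. v \<in> C \<Longrightarrow> x \<in> \<Union>\<T> \<Longrightarrow> cells C \<noteq> {} \<Longrightarrow>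
      relu (MAX T\<in>cells C. bc T v x - M * (\<Sum>w\<in>vertices T. relu (- bc T w x))) \<le> hat v x"
    "\<And>C v x T. v \<in> C \<Longrightarrow> T \<in> cells C \<Longrightarrow> x \<in> T \<Longrightarrow>
      relu (MAX T\<in>cells C. bc T v x - M * (\<Sum>w\<in>vertices T. relu (- bc T w x))) = hat v x"
    using hat_max by blast
  let ?h = "\<lambda>T v x. bc T v x - M * (\<Sum>w\<in>vertices T. relu (- bc T w x))"
  let ?f = "\<lambda>v x. MAX T\<in>cells ?C. ?h T v x"
  let ?r = "\<lambda>v x. relu (?f v x)"
  let ?P = "\<Union>T\<in>cells ?C. (\<lambda>w x. relu (- bc T w x)) ` vertices T"
  have cT: "T \<in> \<T>" if "T \<in> cells ?C" for T using that by (simp add: cells_def)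
  have neg: "(\<lambda>x. - bc T w x) \<in> aff ?D coords" if "T \<in> \<T>" for T w
    using aff_scale[OF affine_frame.bary_aff_coords[OF frame[OF that]], of "-1" w] by simp
  have "reach ?D (CARD('d) + 1) (Suc 0) coords ((\<lambda>w x. relu (- bc T w x)) ` vertices T)"
    if "T \<in> cells ?C" for T
    using reach_relus[OF finite_vertices[OF cT[OF that]] neg[OF cT[OF that]]] card_vertices[OF cT[OF that]]
    by simp
  \<comment> \<open>The negative parts do not depend on \<open>v\<close>: one copy per cell serves
    all factors. The coordinates have to pass this layer too, since the affine extensions are still
    needed.\<close>
  then have "reach ?D (card (cells ?C) * (CARD('d) + 1)) (Suc 0) coords ?P"
    by (intro reach_UN finite_cells)
  moreover have "reach ?D (card (coords :: (real^'d \<Rightarrow> real) set)) (Suc 0) coords coords"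
    by (rule reach_ids[OF bdd_coords_mesh]) simp
  ultimately have "reach ?D (card (cells ?C) * (CARD('d) + 1) + card (coords :: (real^'d \<Rightarrow> real) set)) (Suc 0) coords (?P \<union> coords)"
    by (rule reach_Un_same)
  moreover have "card (coords :: (real^'d \<Rightarrow> real) set) \<le> CARD('d)" by (rule card_image_le) simp
  ultimately have 0: "reach ?D W (Suc 0) coords (?P \<union> coords)"
    by (elim reach_mono) (use W(1) in \<open>auto intro: aff_base simp: mult.commute\<close>)
  have bP: "bdd_funs ?D (?P \<union> coords)" using reach_bdd[OF 0 bdd_coords_mesh] .
  have hP: "?h T v \<in> aff ?D (?P \<union> coords)" if "T \<in> cells ?C" for T v
  proof (intro aff_diff aff_scale aff_sum)
    show "bc T v \<in> aff ?D (?P \<union> coords)"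
      using affine_frame.bary_aff_coords[OF frame[OF cT[OF that]]] aff_mono[of coords "?P \<union> coords"] by blast
    show "(\<lambda>x. relu (- bc T w x)) \<in> aff ?D (?P \<union> coords)" if "w \<in> vertices T" for w
      using that \<open>T \<in> cells ?C\<close> by (intro aff_base) blast
  qed
  have "reach ?D (card (cells ?C)) s (?P \<union> coords) {?f v}" for v
    by (rule reach_Max[OF bP finite_cells C(4) _ s]) (use hP in blast)
  then have "reach ?D (card ?C * card (cells ?C)) s (?P \<union> coords) (\<Union>v\<in>?C. {?f v})"
    by (intro reach_UN C(1))
  moreover have "card ?C * card (cells ?C) \<le> W"
    using W(1) mult_le_mono1[OF C(3), of "card (cells ?C)"] by linarith
  ultimately have 1: "reach ?D W s (?P \<union> coords) (?f ` ?C)"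
    by (elim reach_mono) (auto intro: aff_base)
  have "reach ?D (card ?C) (Suc 0) (?f ` ?C) (?r ` ?C)"
    by (rule reach_relus[OF C(1)]) (auto intro: aff_base)
  then have 2: "reach ?D W (Suc 0) (?f ` ?C) (?r ` ?C)"
    by (rule reach_mono) (use W in \<open>auto intro: aff_base\<close>)
  have bR: "bdd_funs ?D (?r ` ?C)" using reach_bdd[OF 2 reach_bdd[OF 1 bP]] .
  let ?p = "\<lambda>v x. ?r v x ^ \<alpha> v"
  have "reach ?D 3 m (?r ` ?C) {?p v}" if v: "v \<in> ?C" for v
  proof -
    have "\<alpha> v \<le> k" using member_le_sum[of v ?C \<alpha>] C v by simp
    then have "reach ?D 3 m (?r ` ?C) {\<lambda>x. (\<lambda>_. 1) x * ?r v x ^ \<alpha> v}"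
      by (intro reach_power bR aff_const aff_base) (use v m in auto)
    then show ?thesis by simp
  qed
  then have "reach ?D (card ?C * 3) m (?r ` ?C) (\<Union>v\<in>?C. {?p v})"
    by (intro reach_UN C(1))
  then have 3: "reach ?D W m (?r ` ?C) (?p ` ?C)"
    by (rule reach_mono) (use W in \<open>auto intro: aff_base\<close>)
  have "reach ?D (card ?C) t (?p ` ?C) {\<lambda>x. \<Prod>v\<in>?C. ?p v x}"
    by (rule reach_prod[OF reach_bdd[OF 3 bR] C(1) supp_nonempty[OF a k] _ t]) (auto intro: aff_base)
  moreover have "(\<lambda>x. \<Prod>v\<in>?C. hat v x ^ \<alpha> v) \<in> aff ?D {\<lambda>x. \<Prod>v\<in>?C. ?p v x}"
  proof (rule aff_cong[OF aff_base[OF singletonI]])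
    fix x assume x: "x \<in> ?D"
    show "(\<Prod>v\<in>?C. hat v x ^ \<alpha> v) = (\<Prod>v\<in>?C. ?p v x)"
    proof (rule prod_hat_eq[OF a x, symmetric])
      show "?r v x = hat v x" if "T \<in> cells ?C" "x \<in> T" "v \<in> ?C" for T v
        using M(2)[OF that(3,1,2)] .
      \<comment> \<open>For a support vertex outside the cell of \<open>x\<close> the surrogate is
        squeezed between 0 and a vanishing hat function.\<close>
      show "\<exists>v\<in>?C. ?r v x = 0" if out: "\<forall>T\<in>cells ?C. x \<notin> T"
      proof -
        obtain T where T: "T \<in> \<T>" "x \<in> T" using x by blast
        then obtain v where v: "v \<in> ?C" "v \<notin> vertices T" using out by (auto simp: cells_def)
        then have "hat v x = 0" using hat_eq[OF T] affine_frame.bary_outside[OF frame[OF T(1)]] by simp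
        then have "?r v x \<le> 0" using M(1)[OF v(1) x C(4)] by simp
        moreover have "0 \<le> ?r v x" by (simp add: relu_def)
        ultimately show ?thesis using v(1) by (intro bexI[of _ v] antisym)
      qed
    qed
  qed
  ultimately have 4: "reach ?D W t (?p ` ?C) {\<lambda>x. \<Prod>v\<in>?C. hat v x ^ \<alpha> v}"
    by (elim reach_mono) (use W in \<open>auto intro: aff_base\<close>)
  show ?thesis
    using reach_trans[OF 0 reach_trans[OF 1 reach_trans[OF 2 reach_trans[OF 3 4]]]] by simp
qed

section \<open>Assembly and counting\<close>

lemma network_of_reach:
  assumes u: "lagrange_function k \<T> u" and k: "1 \<le> k" and ne: "\<T> \<noteq> {}"
    and r: "\<And>\<alpha>. \<alpha> \<in> mesh_indices k \<Longrightarrow> 1 \<le> n \<alpha> \<and> reach (\<Union>\<T>) W (n \<alpha>) coords {\<lambda>x. \<Prod>v\<in>supp \<alpha>. hat v x ^ \<alpha> v}"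
  obtains u' where "u' \<in> relu_networks (sum n (mesh_indices k)) (\<lambda>_. W + CARD('d) + 1)"
    "\<And>x. x \<in> \<Union>\<T> \<Longrightarrow> u' x = u x" "1 \<le> sum n (mesh_indices k)"
proof -
  obtain c where c: "\<And>x. x \<in> \<Union>\<T> \<Longrightarrow> u x = (\<Sum>\<alpha>\<in>mesh_indices k. c \<alpha> * (\<Prod>v\<in>supp \<alpha>. hat v x ^ \<alpha> v))"
    using bernstein_representation[OF u k] by blast
  let ?I = "mesh_indices k"
  let ?f = "\<lambda>\<alpha> x. c \<alpha> * (\<Prod>v\<in>supp \<alpha>. hat v x ^ \<alpha> v)"
  have "reach (\<Union>\<T>) W (n \<alpha>) coords {?f \<alpha>}" if "\<alpha> \<in> ?I" for \<alpha>
    by (rule reach_mono[of _ W "n \<alpha>" coords "{\<lambda>x. \<Prod>v\<in>supp \<alpha>. hat v x ^ \<alpha> v}"])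
      (use r[OF that] in \<open>auto intro: aff_base aff_scale\<close>)
  then have R: "reach (\<Union>\<T>) (W + CARD('d) + 1) (sum n ?I) coords (insert (\<lambda>x. \<Sum>\<alpha>\<in>?I. ?f \<alpha> x) coords)"
    by (intro reach_sum compact_imp_bounded compact_mesh finite_mesh_indices)
  obtain T v where "T \<in> \<T>" "v \<in> vertices T" using ne vertices_nonempty by blast
  then have "?I \<noteq> {}" using vertex_index(1)[of T v k] k by blast
  then obtain \<alpha> where \<alpha>: "\<alpha> \<in> ?I" by blast
  have "n \<alpha> \<le> sum n ?I" by (rule member_le_sum[OF \<alpha>]) (use finite_mesh_indices in auto)
  then have L: "1 \<le> sum n ?I" using r[OF \<alpha>] by linarith
  obtain u' where "u' \<in> relu_networks (sum n ?I) (\<lambda>_. W + CARD('d) + 1)"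
    "\<And>x. x \<in> \<Union>\<T> \<Longrightarrow> u' x = (\<Sum>\<alpha>\<in>?I. ?f \<alpha> x)"
    using reach_imp_network[OF R insertI1 _ L] by auto
  then show ?thesis using that L c by simp
qed

text \<open>Monomials are grouped by the dimension of the face of their node. Nonnegativity of
  \<open>X\<close> allows replacing the size of a group by its upper bound
  \<open>eta\<close>.\<close>

lemma sum_by_dimension:
  assumes k: "1 \<le> k" and X: "\<And>\<alpha>. \<alpha> \<in> mesh_indices k \<Longrightarrow> int (n \<alpha>) \<le> X (card (supp \<alpha>) - 1)"
    and nonneg: "\<And>l. eta k \<T> l \<noteq> 0 \<Longrightarrow> 0 \<le> X l"
  shows "int (sum n (mesh_indices k)) \<le> (\<Sum>l\<in>{l\<in>{0..CARD('d)}. eta k \<T> l \<noteq> 0}. int (eta k \<T> l) * X l)"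
proof -
  let ?I = "mesh_indices k" and ?L = "{l\<in>{0..CARD('d)}. eta k \<T> l \<noteq> 0}"
  let ?J = "\<lambda>l. {\<alpha> \<in> ?I. card (supp \<alpha>) - 1 = l}"
  have L: "card (supp \<alpha>) - 1 \<in> ?L" if "\<alpha> \<in> ?I" for \<alpha>
    using sum_supp(3)[OF that] eta_nonzero[OF that k] by auto
  have "int (sum n ?I) = (\<Sum>\<alpha>\<in>?I. int (n \<alpha>))" by simp
  also have "\<dots> = (\<Sum>l\<in>?L. \<Sum>\<alpha>\<in>?J l. int (n \<alpha>))"
    by (rule sum.group[symmetric]) (use L finite_mesh_indices in auto)
  also have "\<dots> \<le> (\<Sum>l\<in>?L. int (eta k \<T> l) * X l)"
  proof (rule sum_mono)
    fix l assume l: "l \<in> ?L"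
    show "(\<Sum>\<alpha>\<in>?J l. int (n \<alpha>)) \<le> int (eta k \<T> l) * X l"
    proof -
      have "(\<Sum>\<alpha>\<in>?J l. int (n \<alpha>)) \<le> (\<Sum>\<alpha>\<in>?J l. X l)" by (rule sum_mono) (use X in auto)
      also have "\<dots> = int (card (?J l)) * X l" by simp
      also have "\<dots> \<le> int (eta k \<T> l) * X l"
        using card_indices_le_eta[OF k, of l] nonneg[of l] l by (intro mult_right_mono) auto
      finally show ?thesis .
    qed
  qed
  finally show ?thesis .
qed

text \<open>The larger of \<open>l + 1\<close> and \<open>k - l - 1\<close> is at least half of
  \<open>k\<close>, also under truncated subtraction. Removing 0 implements the convention for the
  logarithm of 0.\<close>

lemma ceiling_log_max_split:
  assumes "1 \<le> k"
  shows "\<lceil>log 2 (real k)\<rceil> \<le> (MAX m\<in>{l + 1, k - l - 1} - {0}. \<lceil>log 2 (real m)\<rceil>) + 1"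
proof -
  define q where "q = max (l + 1) (k - l - 1)"
  have q: "1 \<le> q" "k \<le> 2 * q" unfolding q_def by arith+
  have "\<lceil>log 2 (real k)\<rceil> \<le> \<lceil>log 2 (real (2 * q))\<rceil>" by (rule ceiling_log_mono[OF assms q(2)])
  also have "log 2 (real (2 * q)) = log 2 (real q) + 1" using q(1) by (simp add: log_mult)
  also have "\<lceil>log 2 (real q) + 1\<rceil> = \<lceil>log 2 (real q)\<rceil> + 1" by simp
  also have "\<lceil>log 2 (real q)\<rceil> \<le> (MAX m\<in>{l + 1, k - l - 1} - {0}. \<lceil>log 2 (real m)\<rceil>)"
    using q(1) by (intro Max_ge) (auto simp: q_def max_def)
  finally show ?thesis by simp
qed

lemma convex_network:
  assumes vc: "vertex_convex \<T>" and conv: "convex (\<Union>\<T>)" and ne: "\<T> \<noteq> {}" and k: "1 \<le> k"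
    and u: "lagrange_function k \<T> u"
  shows "\<exists>L n u'. u' \<in> relu_networks L n \<and> (\<forall>x\<in>\<Union>\<T>. u' x = u x) \<and>
          int L \<le> (\<Sum>l\<in>{l\<in>{0..CARD('d)}. eta k \<T> l \<noteq> 0}.
            int (eta k \<T> l) *
              (\<lceil>log 2 (real (tau k \<T> l))\<rceil>
                + (MAX m\<in>{l + 1, k - l - 1} - {0}. \<lceil>log 2 (real m)\<rceil>) + 3)) \<and>
          (MAX j\<in>{1..L}. n j) \<le>
            4 * (MAX l\<in>{l\<in>{0..CARD('d)}. eta k \<T> l \<noteq> 0}.
                   max (l + 1) (k - l - 1) * tau k \<T> l) + 2 * CARD('d) + 1"
proof -
  let ?Ls = "{l\<in>{0..CARD('d)}. eta k \<T> l \<noteq> 0}"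
  let ?m = "\<lambda>l. MAX m\<in>{l + 1, k - l - 1} - {0}. \<lceil>log 2 (real m)\<rceil>"
  define Q where "Q = (MAX l\<in>?Ls. max (l + 1) (k - l - 1) * tau k \<T> l)"
  define m where "m = nat \<lceil>log 2 (real k)\<rceil>"
  define n where "n \<alpha> = nat \<lceil>log 2 (real (card (cells (supp \<alpha>))))\<rceil> + Suc m" for \<alpha>
  have mk: "k \<le> 2 ^ m" unfolding m_def by (rule le_two_power_log[OF k])
  have "1 \<le> n \<alpha> \<and> reach (\<Union>\<T>) (4 * Q + CARD('d)) (n \<alpha>) coords {\<lambda>x. \<Prod>v\<in>supp \<alpha>. hat v x ^ \<alpha> v}"
    if a: "\<alpha> \<in> mesh_indices k" for \<alpha>
  proof
    show "1 \<le> n \<alpha>" by (simp add: n_def)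
    let ?l = "card (supp \<alpha>) - 1"
    have c: "card (supp \<alpha>) = ?l + 1"
      using sum_supp(1)[OF a] supp_nonempty[OF a k] by (simp add: card_gt_0_iff Suc_leI)
    have l: "?l \<in> ?Ls" using sum_supp(3)[OF a] eta_nonzero[OF a k] by auto
    have Q: "max (?l + 1) (k - ?l - 1) * tau k \<T> ?l \<le> Q"
      unfolding Q_def using l by (intro Max_ge) auto
    have "card (supp \<alpha>) * card (cells (supp \<alpha>)) \<le> max (?l + 1) (k - ?l - 1) * tau k \<T> ?l"
      using card_cells_le_tau[OF a k] c by (intro mult_le_mono) auto
    then have 1: "card (supp \<alpha>) * card (cells (supp \<alpha>)) \<le> 4 * Q + CARD('d)" using Q by linarith
    have "max (?l + 1) (k - ?l - 1) * 1 \<le> max (?l + 1) (k - ?l - 1) * tau k \<T> ?l"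
      using tau_pos[OF eta_nonzero[OF a k] k] by (intro mult_le_mono) auto
    then have "max (?l + 1) (k - ?l - 1) \<le> Q" using Q by linarith
    \<comment> \<open>As \<open>k\<close> is at most the sum of \<open>l + 1\<close> and
      \<open>k - l - 1\<close>, it is at most twice their maximum, hence at most 2 Q.\<close>
    then have 2: "k \<le> 4 * Q + CARD('d)" by linarith
    show "reach (\<Union>\<T>) (4 * Q + CARD('d)) (n \<alpha>) coords {\<lambda>x. \<Prod>v\<in>supp \<alpha>. hat v x ^ \<alpha> v}"
      unfolding n_def
      by (rule reach_convex[OF vc conv a k le_two_power_log[OF card_cells_pos[OF a]] mk 1 2])
  qed
  then obtain u' where u': "u' \<in> relu_networks (sum n (mesh_indices k)) (\<lambda>_. 4 * Q + CARD('d) + CARD('d) + 1)"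
    "\<And>x. x \<in> \<Union>\<T> \<Longrightarrow> u' x = u x" "1 \<le> sum n (mesh_indices k)"
    using network_of_reach[OF u k ne, of n "4 * Q + CARD('d)"] by blast
  have "int (sum n (mesh_indices k)) \<le> (\<Sum>l\<in>?Ls. int (eta k \<T> l) * (\<lceil>log 2 (real (tau k \<T> l))\<rceil> + ?m l + 3))"
  proof (rule sum_by_dimension[OF k])
    fix \<alpha> assume a: "\<alpha> \<in> mesh_indices k"
    have "int (n \<alpha>) = \<lceil>log 2 (real (card (cells (supp \<alpha>))))\<rceil> + \<lceil>log 2 (real k)\<rceil> + 1"
      using ceiling_log_nonneg[OF card_cells_pos[OF a]] ceiling_log_nonneg[OF k] by (simp add: n_def m_def)
    then show "int (n \<alpha>) \<le> \<lceil>log 2 (real (tau k \<T> (card (supp \<alpha>) - 1)))\<rceil> + ?m (card (supp \<alpha>) - 1) + 3"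
      using ceiling_log_mono[OF card_cells_pos[OF a] card_cells_le_tau[OF a k]]
        ceiling_log_max_split[OF k, of "card (supp \<alpha>) - 1"] by linarith
  next
    fix l assume "eta k \<T> l \<noteq> 0"
    then show "0 \<le> \<lceil>log 2 (real (tau k \<T> l))\<rceil> + ?m l + 3"
      using ceiling_log_nonneg[OF tau_pos[OF _ k], of l] ceiling_log_max_split[OF k, of l]
        ceiling_log_nonneg[OF k] by linarith
  qed
  moreover have "(MAX j\<in>{1..sum n (mesh_indices k)}. 4 * Q + CARD('d) + CARD('d) + 1) \<le> 4 * Q + 2 * CARD('d) + 1"
    using u'(3) by (subst image_constant[of 1]) auto
  ultimately show ?thesis using u'(1,2) unfolding Q_def by blast
qed

lemma general_network:
  assumes ne: "\<T> \<noteq> {}" and k: "1 \<le> k" and u: "lagrange_function k \<T> u"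
  shows "\<exists>L n u'. u' \<in> relu_networks L n \<and> (\<forall>x\<in>\<Union>\<T>. u' x = u x) \<and>
          int L \<le> (\<lceil>log 2 (real (tau k \<T> 0))\<rceil> + \<lceil>log 2 (real (CARD('d) + 1))\<rceil>
                     + \<lceil>log 2 (real k)\<rceil> + 7) * (\<Sum>l=0..CARD('d). int (eta k \<T> l)) \<and>
          (MAX j\<in>{1..L}. n j) \<le>
            4 * (CARD('d) + 1) * min (CARD('d)) (k + 1) * tau k \<T> 0 + 2 * CARD('d) + 1"
proof -
  define Q where "Q = (CARD('d) + 1) * min (CARD('d)) (k + 1) * tau k \<T> 0"
  define s where "s = nat \<lceil>log 2 (real (tau k \<T> 0))\<rceil>"
  define m where "m = nat \<lceil>log 2 (real k)\<rceil>"
  define t where "t = nat \<lceil>log 2 (real (CARD('d) + 1))\<rceil>"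
  \<comment> \<open>The same depth s + m + t + 3 for every monomial. \<open>Suc m\<close> digits are
    provided because an exponent may equal \<open>k\<close>, possibly \<open>2 ^ m\<close>
    itself.\<close>
  define N where "N = Suc s + Suc (Suc m + t)"
  let ?I = "mesh_indices k"
  obtain T v where Tv: "T \<in> \<T>" "v \<in> vertices T" using ne vertices_nonempty by blast
  have tau: "1 \<le> tau k \<T> 0"
    using card_cells_le_tau_0[OF vertex_index(1)[OF Tv k] k] card_cells_pos[OF vertex_index(1)[OF Tv k]]
    by linarith
  \<comment> \<open>The minimum is at least 1, so \<open>Q\<close> dominates d + 1 times
    \<open>tau k \<T> 0\<close>, which covers the negative parts of all coordinates.\<close>
  have "1 \<le> min (CARD('d)) (k + 1)" by (simp add: Suc_leI)
  then have "(CARD('d) + 1) * 1 * tau k \<T> 0 \<le> Q" unfolding Q_def by (intro mult_le_mono order_refl)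
  then have Q: "(CARD('d) + 1) * tau k \<T> 0 \<le> Q" by simp
  have "k \<le> 2 ^ m" unfolding m_def by (rule le_two_power_log[OF k])
  then have mk: "k < 2 ^ Suc m" by (simp add: order_le_less_trans)
  have "1 \<le> N \<and> reach (\<Union>\<T>) (4 * Q + CARD('d)) N coords {\<lambda>x. \<Prod>v\<in>supp \<alpha>. hat v x ^ \<alpha> v}"
    if a: "\<alpha> \<in> ?I" for \<alpha>
  proof
    show "1 \<le> N" by (simp add: N_def)
    have 1: "card (cells (supp \<alpha>)) \<le> 2 ^ s"
      using card_cells_le_tau_0[OF a k] le_two_power_log[OF tau] unfolding s_def by linarith
    have 2: "card (supp \<alpha>) \<le> 2 ^ t"
      using sum_supp(3)[OF a] le_two_power_log[of "CARD('d) + 1"] unfolding t_def by linarith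
    have "(CARD('d) + 1) * card (cells (supp \<alpha>)) \<le> (CARD('d) + 1) * tau k \<T> 0"
      using card_cells_le_tau_0[OF a k] by (intro mult_le_mono2)
    then have 3: "(CARD('d) + 1) * card (cells (supp \<alpha>)) + CARD('d) \<le> 4 * Q + CARD('d)" using Q by linarith
    have "CARD('d) + 1 \<le> Q"
      using mult_le_mono2[OF tau, of "CARD('d) + 1"] Q by (metis order_trans mult.right_neutral)
    then have 4: "card (supp \<alpha>) * 3 \<le> 4 * Q + CARD('d)" using sum_supp(3)[OF a] by linarith
    show "reach (\<Union>\<T>) (4 * Q + CARD('d)) N coords {\<lambda>x. \<Prod>v\<in>supp \<alpha>. hat v x ^ \<alpha> v}"
      unfolding N_def by (rule reach_general[OF a k 1 mk 2 3 4])
  qed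
  then obtain u' where u': "u' \<in> relu_networks (\<Sum>\<alpha>\<in>?I. N) (\<lambda>_. 4 * Q + CARD('d) + CARD('d) + 1)"
    "\<And>x. x \<in> \<Union>\<T> \<Longrightarrow> u' x = u x" "1 \<le> (\<Sum>\<alpha>\<in>?I. N)"
    using network_of_reach[OF u k ne, of "\<lambda>_. N" "4 * Q + CARD('d)"] by blast
  let ?E = "\<Sum>l=0..CARD('d). int (eta k \<T> l)"
  let ?B = "\<lceil>log 2 (real (tau k \<T> 0))\<rceil> + \<lceil>log 2 (real (CARD('d) + 1))\<rceil> + \<lceil>log 2 (real k)\<rceil> + 7"
  have NB: "int N \<le> ?B"
    using ceiling_log_nonneg[OF tau] ceiling_log_nonneg[OF k] ceiling_log_nonneg[of "CARD('d) + 1"]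
    unfolding N_def s_def m_def t_def by simp
  have "int (\<Sum>\<alpha>\<in>?I. N) \<le> (\<Sum>l\<in>{l\<in>{0..CARD('d)}. eta k \<T> l \<noteq> 0}. int (eta k \<T> l) * ?B)"
    by (rule sum_by_dimension[OF k]) (use NB in linarith)+
  also have "\<dots> \<le> (\<Sum>l=0..CARD('d). int (eta k \<T> l) * ?B)"
    by (rule sum_mono2) (use NB in \<open>auto intro!: mult_nonneg_nonneg\<close>)
  also have "\<dots> = ?B * ?E" unfolding sum_distrib_right[symmetric] by (rule mult.commute)
  finally have "int (\<Sum>\<alpha>\<in>?I. N) \<le> ?B * ?E" .
  moreover have "(MAX j\<in>{1..\<Sum>\<alpha>\<in>?I. N}. 4 * Q + CARD('d) + CARD('d) + 1) \<le>
      4 * (CARD('d) + 1) * min (CARD('d)) (k + 1) * tau k \<T> 0 + 2 * CARD('d) + 1"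
    using u'(3) unfolding Q_def by (subst image_constant[of 1]) (auto simp: algebra_simps)
  ultimately show ?thesis using u'(1,2) by blast
qed

end

theorem theorem4p2:
  fixes \<Omega> :: "(real^'d) set" and \<T> :: "(real^'d) set set"
    and k :: nat and u\<^sub>h :: "real^'d \<Rightarrow> real"
  assumes "polytope_domain \<Omega>"
    and "simplicial_mesh \<T> \<Omega>"
    and "k \<ge> 1"
    and "lagrange_function k \<T> u\<^sub>h"
  shows
    "(vertex_convex \<T> \<longrightarrow>
       (\<exists>L n u. u \<in> relu_networks L n \<and> (\<forall>x\<in>\<Omega>. u x = u\<^sub>h x) \<and>
          int L \<le> (\<Sum>l\<in>{l\<in>{0..CARD('d)}. eta k \<T> l \<noteq> 0}.
            int (eta k \<T> l) *
              (\<lceil>log 2 (real (tau k \<T> l))\<rceil>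
                + (MAX m\<in>{l + 1, k - l - 1} - {0}. \<lceil>log 2 (real m)\<rceil>) + 3)) \<and>
          (MAX j\<in>{1..L}. n j) \<le>
            4 * (MAX l\<in>{l\<in>{0..CARD('d)}. eta k \<T> l \<noteq> 0}.
                   max (l + 1) (k - l - 1) * tau k \<T> l) + 2 * CARD('d) + 1)) \<and>
     (\<exists>L n u. u \<in> relu_networks L n \<and> (\<forall>x\<in>\<Omega>. u x = u\<^sub>h x) \<and>
          int L \<le> (\<lceil>log 2 (real (tau k \<T> 0))\<rceil> + \<lceil>log 2 (real (CARD('d) + 1))\<rceil>
                     + \<lceil>log 2 (real k)\<rceil> + 7) * (\<Sum>l=0..CARD('d). int (eta k \<T> l)) \<and>
          (MAX j\<in>{1..L}. n j) \<le>
            4 * (CARD('d) + 1) * min (CARD('d)) (k + 1) * tau k \<T> 0 + 2 * CARD('d) + 1)"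
proof -
  interpret mesh \<T> using assms(2) by unfold_locales (auto simp: simplicial_mesh_def)
  have \<Omega>: "\<Union>\<T> = \<Omega>" using assms(2) by (simp add: simplicial_mesh_def)
  have "connected \<Omega>" "\<Omega> \<noteq> {}"
    using assms(1) connected_imp_connected_closure interior_subset unfolding polytope_domain_def
    by (metis, fastforce)
  then have "vertex_convex \<T> \<longrightarrow> convex (\<Union>\<T>)" "\<T> \<noteq> {}"
    using vertex_convex_imp_convex \<Omega> by auto
  then show ?thesis
    using convex_network[OF _ _ _ assms(3,4)] general_network[OF _ assms(3,4)] unfolding \<Omega> by blast
qed

end
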